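(* Let $K$ be a finite extension of $\mathbb Q$ with $r$ real embeddings and $s$ pairs of complex conjugate embeddings, and let $\Sigma$ be the set of its embeddings (one from each complex conjugate pair). Let $B\subset\mathbb R$ be a compact interval and let $\varphi=(\varphi_\sigma)_{\sigma\in\Sigma}:B\to\mathbb R^r\times\mathbb C^s$ be a $C^{1+\varepsilon}$-map for some $\varepsilon>0$ such that for each $\sigma$, either $\dot\varphi_\sigma\equiv0$ or $\dot\varphi_\sigma$ has finitely many zeros. Assume further that $$\#\{\sigma\in\Sigma:\dot\varphi_\sigma\not\equiv0,\ \sigma\text{ real}\}+2\,\#\{\sigma\in\Sigma:\dot\varphi_\sigma\not\equiv0,\ \sigma\text{ complex}\}>\frac{r+2s}2.$$ Then the following hold. (1) The Hausdorff dimension of the set of points $t\in B$ for which $\varphi(t)$ is $K$-singular on average is at most $$\frac12+\frac12\cdot\frac{\#\{\sigma\text{ real}:\dot\varphi_\sigma\equiv0\}+2\,\#\{\sigma\text{ complex}:\dot\varphi_\sigma\equiv0\}}{\#\{\sigma\text{ real}:\dot\varphi_\sigma\not\equiv0\}+2\,\#\{\sigma\text{ complex}:\dot\varphi_\sigma\not\equiv0\}}.$$ (2) The set of points $t\in B$ for which $\varphi(t)$ is $K$-badly approximable is winning for a Schmidt game on $B$. In particular, this set is thick in $B$. (3) The set of points $t\in B$ for which $\varphi(t)$ is $K$-very well approximable has Lebesgue measure $0$.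
   Context: $\mathcal O_K$ is the ring of integers of $K$, and $K_\Sigma=\mathbb R^r\times\mathbb C^s$ has coordinates indexed by $\Sigma$. A $C^{1+\varepsilon}$-map is a $C^1$ map whose derivative is $\varepsilon$-Hölder. A point $\mathbf x=(x_\sigma)_{\sigma\in\Sigma}\in K_\Sigma$ is: - $K$-badly approximable if there is $\epsilon(\mathbf x)>0$ such that for all $p,q\in\mathcal O_K$ with $q\ne0$, $\max_{\sigma}|\sigma(p)+x_\sigma\sigma(q)|\cdot\max_\sigma|\sigma(q)|\ge\epsilon(\mathbf x)$; - $K$-very well approximable if for some $\gamma>0$ there exist infinitely many pairs $(p,q)\in\mathcal O_K^2$ with $q\neq0$ such that $\max_\sigma|\sigma(p)+x_\sigma\sigma(q)|\cdot\max_\sigma|\sigma(q)|^{1+\gamma}<1$; - $K$-singular on average if for all $\epsilon>0$, $$\lim_{N\to\infty}\frac1N\#\Big\{1\le\ell\le N:\exists\,p,q\in\mathcal O_K,\ \max_\sigma|\sigma(p)+x_\sigma\sigma(q)|<\epsilon2^{-\ell},\ 0<\max_\sigma|\sigma(q)|\le2^\ell\Big\}=1.$$ A subset of a metric space is thick if its intersection with every non-empty open set has full Hausdorff dimension. Modified Schmidt game on a compact interval $I_0\subset\mathbb R$ with parameter $\kappa>0$: let $\Phi_t(x)=e^{-\kappa t}x$. Given $a,b>0$, Bob first picks $t_0>0$ and $x_1\in\mathbb R$ so that $B_1=\Phi_{t_0}(I_0)+x_1\subset I_0$. Then Alice picks a translate $A_1$ of $\Phi_a(B_1)$ contained in $B_1$,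 Bob picks a translate $B_2$ of $\Phi_b(A_1)$ contained in $A_1$, and so on (Alice's $A_k\subset B_k$ is a translate of $\Phi_a(B_k)$ and Bob's $B_{k+1}\subset A_k$ is a translate of $\Phi_b(A_k)$). The intersection $\bigcap_kA_k=\bigcap_kB_k$ is a single point. A set $S\subseteq\mathbb R$ is $(a,b)$-winning if Alice can always play so that this point lies in $S$, no matter how Bob plays; $a$-winning if it is $(a,b)$-winning for all $b>0$; winning if it is $a$-winning for some $a>0$. (Changing $\kappa$ only rescales $a$ and $b$, so "winning" does not depend on $\kappa$.) A Schmidt game on $B$ is this game with $I_0=B$. *)

theory Defs
  imports "HOL-Analysis.Analysis" "HOL-Computational_Algebra.Polynomial"
begin

section \<open>Number fields and their embeddings\<close>

text \<open>The field \<open>K\<close> is a type of characteristic zero; multiplication by the image of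
  a rational makes it a vector space over the rationals.\<close>

definition number_field :: "'k::field_char_0 itself \<Rightarrow> bool" where
  "number_field _ \<longleftrightarrow>
     (\<exists>Basis :: 'k set. finite_dimensional_vector_space (\<lambda>(c::rat) (x::'k). of_rat c * x) Basis)"

definition ring_of_integers :: "'k::field_char_0 set" where
  "ring_of_integers = {x. algebraic_int x}"

definition embedding :: "('k::field_char_0 \<Rightarrow> complex) \<Rightarrow> bool" where
  "embedding \<sigma> \<longleftrightarrow> \<sigma> 1 = 1 \<and>
     (\<forall>x y. \<sigma> (x + y) = \<sigma> x + \<sigma> y) \<and> (\<forall>x y. \<sigma> (x * y) = \<sigma> x * \<sigma> y)"

definition real_embedding :: "('k::field_char_0 \<Rightarrow> complex) \<Rightarrow> bool" where
  "real_embedding \<sigma> \<longleftrightarrow> embedding \<sigma> \<and> range \<sigma> \<subseteq> \<real>"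

definition complex_embedding :: "('k::field_char_0 \<Rightarrow> complex) \<Rightarrow> bool" where
  "complex_embedding \<sigma> \<longleftrightarrow> embedding \<sigma> \<and> \<not> range \<sigma> \<subseteq> \<real>"

text \<open>All real embeddings, and exactly one embedding out of each complex conjugate pair
  (a real embedding equals its own conjugate).\<close>

definition embedding_representatives :: "('k::field_char_0 \<Rightarrow> complex) set \<Rightarrow> bool" where
  "embedding_representatives \<Sigma> \<longleftrightarrow> (\<forall>\<sigma>\<in>\<Sigma>. embedding \<sigma>) \<and>
     (\<forall>\<tau>. embedding \<tau> \<longrightarrow> (\<exists>!\<sigma>. \<sigma> \<in> \<Sigma> \<and> (\<sigma> = \<tau> \<or> \<sigma> = cnj \<circ> \<tau>)))"

text \<open>The space \<open>\<real>\<^sup>r \<times> \<complex>\<^sup>s\<close> with coordinates indexed by \<open>\<Sigma>\<close>;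
  a real coordinate is a complex number lying in \<open>\<real>\<close>.\<close>

definition K_space :: "('k::field_char_0 \<Rightarrow> complex) set \<Rightarrow> (('k \<Rightarrow> complex) \<Rightarrow> complex) set" where
  "K_space \<Sigma> = (\<Pi>\<^sub>E \<sigma>\<in>\<Sigma>. if real_embedding \<sigma> then \<real> else UNIV)"


section \<open>Diophantine properties\<close>

definition max_norm :: "('k \<Rightarrow> complex) set \<Rightarrow> (('k \<Rightarrow> complex) \<Rightarrow> complex) \<Rightarrow> real" where
  "max_norm \<Sigma> y = Max ((\<lambda>\<sigma>. cmod (y \<sigma>)) ` \<Sigma>)"

definition K_badly_approximable ::
    "('k::field_char_0 \<Rightarrow> complex) set \<Rightarrow> (('k \<Rightarrow> complex) \<Rightarrow> complex) \<Rightarrow> bool" where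
  "K_badly_approximable \<Sigma> x \<longleftrightarrow>
     (\<exists>\<epsilon>>0. \<forall>p\<in>ring_of_integers. \<forall>q\<in>ring_of_integers. q \<noteq> 0 \<longrightarrow>
        max_norm \<Sigma> (\<lambda>\<sigma>. \<sigma> p + x \<sigma> * \<sigma> q) * max_norm \<Sigma> (\<lambda>\<sigma>. \<sigma> q) \<ge> \<epsilon>)"

definition K_very_well_approximable ::
    "('k::field_char_0 \<Rightarrow> complex) set \<Rightarrow> (('k \<Rightarrow> complex) \<Rightarrow> complex) \<Rightarrow> bool" where
  "K_very_well_approximable \<Sigma> x \<longleftrightarrow>
     (\<exists>\<gamma>>0. infinite {(p, q). p \<in> ring_of_integers \<and> q \<in> ring_of_integers \<and> q \<noteq> 0 \<and>
        max_norm \<Sigma> (\<lambda>\<sigma>. \<sigma> p + x \<sigma> * \<sigma> q) * max_norm \<Sigma> (\<lambda>\<sigma>. \<sigma> q) powr (1 + \<gamma>) < 1})"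

definition K_singular_on_average ::
    "('k::field_char_0 \<Rightarrow> complex) set \<Rightarrow> (('k \<Rightarrow> complex) \<Rightarrow> complex) \<Rightarrow> bool" where
  "K_singular_on_average \<Sigma> x \<longleftrightarrow>
     (\<forall>\<epsilon>>0. (\<lambda>N. 1 / real N * real (card {l \<in> {1..N}.
        \<exists>p\<in>ring_of_integers. \<exists>q\<in>ring_of_integers.
          max_norm \<Sigma> (\<lambda>\<sigma>. \<sigma> p + x \<sigma> * \<sigma> q) < \<epsilon> / 2 ^ l \<and>
          0 < max_norm \<Sigma> (\<lambda>\<sigma>. \<sigma> q) \<and> max_norm \<Sigma> (\<lambda>\<sigma>. \<sigma> q) \<le> 2 ^ l}))
        \<longlonglongrightarrow> 1)"


section \<open>Curves\<close>

text \<open>The derivative is taken within \<open>B\<close>, so it is one-sided at the end points.\<close>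

abbreviation deriv_on :: "real set \<Rightarrow> (real \<Rightarrow> complex) \<Rightarrow> real \<Rightarrow> complex" where
  "deriv_on B f t \<equiv> vector_derivative f (at t within B)"

definition C1_Holder_on :: "real \<Rightarrow> real set \<Rightarrow> (real \<Rightarrow> complex) \<Rightarrow> bool" where
  "C1_Holder_on \<epsilon> B f \<longleftrightarrow>
     (\<forall>t\<in>B. f differentiable (at t within B)) \<and>
     continuous_on B (deriv_on B f) \<and>
     (\<exists>C. \<forall>t\<in>B. \<forall>u\<in>B. cmod (deriv_on B f t - deriv_on B f u) \<le> C * \<bar>t - u\<bar> powr \<epsilon>)"

definition stationary_on :: "real set \<Rightarrow> (real \<Rightarrow> complex) \<Rightarrow> bool" where
  "stationary_on B f \<longleftrightarrow> (\<forall>t\<in>B. deriv_on B f t = 0)"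

text \<open>Number of real embeddings in \<open>S\<close> plus twice the number of complex ones.\<close>

definition weighted_card :: "('k::field_char_0 \<Rightarrow> complex) set \<Rightarrow> nat" where
  "weighted_card S = card {\<sigma>\<in>S. real_embedding \<sigma>} + 2 * card {\<sigma>\<in>S. complex_embedding \<sigma>}"


section \<open>Hausdorff dimension\<close>

definition hausdorff_premeasure :: "real \<Rightarrow> real \<Rightarrow> 'a::metric_space set \<Rightarrow> ennreal" where
  "hausdorff_premeasure d \<delta> A =
     (INF U \<in> {U :: nat \<Rightarrow> 'a set. A \<subseteq> (\<Union>i. U i) \<and> (\<forall>i. bounded (U i) \<and> diameter (U i) \<le> \<delta>)}.
        \<Sum>i. ennreal (diameter (U i) powr d))"

definition hausdorff_measure :: "real \<Rightarrow> 'a::metric_space set \<Rightarrow> ennreal" where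
  "hausdorff_measure d A = (SUP \<delta>\<in>{0<..}. hausdorff_premeasure d \<delta> A)"

text \<open>Only exponents \<open>d > 0\<close> are used: this does not change the infimum, and it avoids the
  convention for \<open>0\<^sup>0\<close> in the counting measure. The empty set gets dimension \<open>0\<close>.\<close>

definition hausdorff_dim :: "'a::metric_space set \<Rightarrow> ereal" where
  "hausdorff_dim A = (INF d \<in> {d. 0 < d \<and> hausdorff_measure d A = 0}. ereal d)"

definition thick_in :: "'a::metric_space set \<Rightarrow> 'a set \<Rightarrow> bool" where
  "thick_in X S \<longleftrightarrow> S \<subseteq> X \<and>
     (\<forall>U. openin (top_of_set X) U \<and> U \<noteq> {} \<longrightarrow> hausdorff_dim (S \<inter> U) = hausdorff_dim X)"


section \<open>The modified Schmidt game\<close>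

definition contraction :: "real \<Rightarrow> real \<Rightarrow> real \<Rightarrow> real" where
  "contraction \<kappa> t x = exp (- (\<kappa> * t)) * x"

definition legal_move :: "real \<Rightarrow> real \<Rightarrow> real set \<Rightarrow> real set \<Rightarrow> bool" where
  "legal_move \<kappa> t X Y \<longleftrightarrow> Y \<subseteq> X \<and> (\<exists>c. Y = (\<lambda>x. contraction \<kappa> t x + c) ` X)"

text \<open>A strategy for Alice maps the list of the moves Bob has made so far to her reply; her own
  earlier moves are determined by it. Indices start at \<open>0\<close>, so \<open>Bs 0\<close> is \<open>B\<^sub>1\<close>.\<close>

definition alice_move :: "(real set list \<Rightarrow> real set) \<Rightarrow> (nat \<Rightarrow> real set) \<Rightarrow> nat \<Rightarrow> real set" where
  "alice_move strat Bs k = strat (map Bs [0..<Suc k])"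

fun bob_legal :: "real \<Rightarrow> real set \<Rightarrow> real \<Rightarrow> (real set list \<Rightarrow> real set) \<Rightarrow>
    (nat \<Rightarrow> real set) \<Rightarrow> nat \<Rightarrow> bool" where
  "bob_legal \<kappa> I\<^sub>0 b strat Bs 0 \<longleftrightarrow> (\<exists>t\<^sub>0>0. legal_move \<kappa> t\<^sub>0 I\<^sub>0 (Bs 0))"
| "bob_legal \<kappa> I\<^sub>0 b strat Bs (Suc k) \<longleftrightarrow> legal_move \<kappa> b (alice_move strat Bs k) (Bs (Suc k))"

definition ab_winning :: "real \<Rightarrow> real set \<Rightarrow> real \<Rightarrow> real \<Rightarrow> real set \<Rightarrow> bool" where
  "ab_winning \<kappa> I\<^sub>0 a b S \<longleftrightarrow> (\<exists>strat. \<forall>Bs.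
     (\<forall>n. (\<forall>k\<le>n. bob_legal \<kappa> I\<^sub>0 b strat Bs k) \<longrightarrow>
        legal_move \<kappa> a (Bs n) (alice_move strat Bs n)) \<and>
     ((\<forall>k. bob_legal \<kappa> I\<^sub>0 b strat Bs k) \<longrightarrow>
        (\<exists>x\<in>S. (\<Inter>k. alice_move strat Bs k) = {x})))"

definition a_winning :: "real \<Rightarrow> real set \<Rightarrow> real \<Rightarrow> real set \<Rightarrow> bool" where
  "a_winning \<kappa> I\<^sub>0 a S \<longleftrightarrow> (\<forall>b>0. ab_winning \<kappa> I\<^sub>0 a b S)"

definition winning :: "real \<Rightarrow> real set \<Rightarrow> real set \<Rightarrow> bool" where
  "winning \<kappa> I\<^sub>0 S \<longleftrightarrow> (\<exists>a>0. a_winning \<kappa> I\<^sub>0 a S)"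

end

theory Submission
  imports Defs "Jordan_Normal_Form.Char_Poly"
begin

text \<open>
  For \<open>p, q, p', q'\<close> integral in \<open>K\<close>, the norm of \<open>p q' - p' q\<close> is at least 1 unless it vanishes. Hence the
  rational points \<open>- p / q\<close> which approximate a short piece of the curve at a given scale all coincide, and
  the parameters they affect lie in one short interval for each moving coordinate. In the game Alice
  meets an approximation of complexity \<open>(max |\<sigma> q|) (max |\<sigma> q| over moving \<sigma>)\<close> when the current interval
  has length about the inverse of the complexity, and steps aside; a Borel--Cantelli
  argument over dyadic complexities gives the measure statement. Singularity on average forces the
  trajectory under the diagonal flow into long excursions to the cusp, each governed by a single
  rational point. Convexity of the height along an excursion bounds the number of cells needed to
  cover the parameters which follow it, and a recursion over the last excursion bounds the dimension.
  Full dimension of a winning set comes from letting Bob play against an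
  economical cover.
\<close>

section \<open>Algebraic integers\<close>

text \<open>A denominator is determined only up to units, so the values
  \<open>cmod (\<sigma> q)\<close> may differ wildly in size, and nothing can be done in the
  stationary coordinates. Two sizes are therefore kept: \<open>Q q\<close>, the maximum over all
  places, which fixes the precision demanded of an approximation, and \<open>R q\<close>, the
  maximum over the moving ones. Precision \<epsilon> / \<open>Q q\<close> confines the coordinate
  where \<open>R q\<close> is attained to a disc of radius \<epsilon> / (\<open>Q q * R q\<close>),
  whence the complexity. For two approximations with x = \<open>Q q / Q q'\<close> at most 1, the
  determinant is below x at the moving places but may reach 1 / x at the stationary ones. With m and
  n the total local degrees of moving and stationary places, the assumption on the curve says n < m,
  so the norm is below x^(m - n) and the determinant vanishes. The same weights give the dimension:
  along an excursion the stationary places lose at most 2^n per step, so some moving place gains at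
  most about 2^(n/m) per step; of the 4 subintervals per step about 2 * 2^(n/m) survive, and log_4
  of this is the bound 1/2 + n/(2 m).\<close>

lemma algebraic_int_via_integer_matrix:
  fixes x :: "'a::field_char_0"
  assumes fin: "finite I" and k: "k \<in> I" "m k \<noteq> 0"
    and A: "\<And>i. i \<in> I \<Longrightarrow> x * m i = (\<Sum>j\<in>I. of_int (A i j) * m j)"
  shows "algebraic_int x"
proof -
  define n where "n = card I"
  obtain f where f: "bij_betw f {0..<n} I"
    using ex_bij_betw_nat_finite[OF fin] unfolding n_def by blast
  define M where "M = Matrix.mat n n (\<lambda>(i, j). A (f i) (f j))"
  define v where "v = Matrix.vec n (\<lambda>i. m (f i))"
  have M: "M \<in> carrier_mat n n" by (simp add: M_def)
  obtain k' where k': "k' < n" "f k' = k"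
    using f k(1) by (metis atLeastLessThan_iff bij_betw_iff_bijections)
  have "map_mat of_int M *\<^sub>v v = x \<cdot>\<^sub>v v"
  proof (rule eq_vecI)
    fix i assume "i < dim_vec (x \<cdot>\<^sub>v v)"
    then have i: "i < n" by (simp add: v_def)
    then have "f i \<in> I" using f by (auto simp: bij_betw_def)
    have "(map_mat of_int M *\<^sub>v v) $ i = (\<Sum>j = 0..<n. of_int (A (f i) (f j)) * m (f j))"
      using i by (simp add: M_def v_def scalar_prod_def)
    also have "\<dots> = (\<Sum>j\<in>I. of_int (A (f i) j) * m j)"
      by (rule sum.reindex_bij_betw[OF f])
    also have "\<dots> = (x \<cdot>\<^sub>v v) $ i"
      using A[OF \<open>f i \<in> I\<close>] i by (simp add: v_def)
    finally show "(map_mat of_int M *\<^sub>v v) $ i = (x \<cdot>\<^sub>v v) $ i" .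
  qed (simp add: M_def v_def)
  moreover have "v \<noteq> 0\<^sub>v n"
  proof
    assume "v = 0\<^sub>v n"
    then have "v $ k' = 0" using k' by simp
    then show False using k' k by (simp add: v_def)
  qed
  \<comment> \<open>Determinant trick: generators of a finitely generated module stable under
    \<open>x\<close> form an eigenvector, so \<open>x\<close> is a root of a monic integer
    characteristic polynomial.\<close>
  ultimately have "eigenvector (map_mat of_int M) v x"
    unfolding eigenvector_def by (simp add: M_def v_def)
  then have "poly (char_poly (map_mat of_int M)) x = 0"
    using eigenvalue_root_char_poly[of "map_mat of_int M" n x] M unfolding eigenvalue_def by auto
  moreover have "char_poly (map_mat of_int M :: 'a Matrix.mat) = map_poly of_int (char_poly M)"
    using of_int_hom.char_poly_hom[OF M] by simp
  moreover have "lead_coeff (char_poly M) = 1" using degree_monic_char_poly[OF M] by simp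
  ultimately show ?thesis unfolding algebraic_int_altdef_ipoly by auto
qed

text \<open>These are the rows of the companion matrix: all but the last only shift the powers, and
  the last uses the monic equation.\<close>

lemma algebraic_int_power_relation:
  fixes x :: "'a::field_char_0"
  assumes "algebraic_int x"
  obtains d :: nat and A where "d > 0"
    "\<And>i. i < d \<Longrightarrow> x * x ^ i = (\<Sum>k<d. of_int (A i k) * x ^ k)"
proof -
  obtain p where p: "poly (map_poly of_int p) x = 0" "lead_coeff p = 1"
    using assms unfolding algebraic_int_altdef_ipoly by blast
  define d where "d = degree p"
  have "0 = (\<Sum>i\<le>d. of_int (poly.coeff p i) * x ^ i)"
    using p(1) by (simp add: poly_altdef d_def)
  also have "\<dots> = (\<Sum>i<d. of_int (poly.coeff p i) * x ^ i) + x ^ d"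
    using p(2) by (simp add: d_def lessThan_Suc_atMost[symmetric])
  finally have xd: "x ^ d = (\<Sum>i<d. of_int (- poly.coeff p i) * x ^ i)"
    by (simp add: eq_neg_iff_add_eq_0 sum_negf add.commute)
  have d0: "d > 0" using xd by (cases d) auto
  show thesis
  proof (rule that[OF d0])
    fix i assume i: "i < d"
    let ?A = "\<lambda>i k. if Suc i < d then of_bool (k = Suc i) else - poly.coeff p k"
    show "x * x ^ i = (\<Sum>k<d. of_int (?A i k) * x ^ k)"
    proof (cases "Suc i < d")
      case True
      then have "(\<Sum>k<d. of_int (?A i k) * x ^ k) = (\<Sum>k<d. if k = Suc i then x ^ k else 0)"
        by (intro sum.cong) auto
      then show ?thesis using True by simp
    next
      case False
      then have "d = Suc i" using i by simp
      then show ?thesis using xd False by simp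
    qed
  qed
qed

text \<open>The products \<open>x ^ i * y ^ j\<close> generate a module stable under both elements.
  For \<open>x * y\<close> the matrix is the Kronecker product of the two power relations, for
  \<open>x + y\<close> their Kronecker sum.\<close>

lemma
  fixes x y :: "'a::field_char_0"
  assumes "algebraic_int x" "algebraic_int y"
  shows algebraic_int_add: "algebraic_int (x + y)" and algebraic_int_mult: "algebraic_int (x * y)"
proof -
  obtain d A where d: "d > 0" and A: "\<And>i. i < d \<Longrightarrow> x * x ^ i = (\<Sum>k<d. of_int (A i k) * x ^ k)"
    using algebraic_int_power_relation[OF assms(1)] by metis
  obtain e B where e: "e > 0" and B: "\<And>i. i < e \<Longrightarrow> y * y ^ i = (\<Sum>k<e. of_int (B i k) * y ^ k)"
    using algebraic_int_power_relation[OF assms(2)] by metis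
  define I where "I = {..<d} \<times> {..<e}"
  define m where "m = (\<lambda>(i, j). x ^ i * y ^ j)"
  have I: "finite I" "(0, 0) \<in> I" "m (0, 0) \<noteq> 0" using d e by (auto simp: I_def m_def)
  show "algebraic_int (x * y)"
  proof (rule algebraic_int_via_integer_matrix[where m = m, OF I, where A = "\<lambda>(i, j) (k, l). A i k * B j l"])
    fix z assume "z \<in> I"
    then obtain i j where z: "z = (i, j)" "i < d" "j < e" by (auto simp: I_def)
    have "x * y * m z = (x * x ^ i) * (y * y ^ j)" by (simp add: z m_def mult_ac)
    also have "\<dots> = (\<Sum>k<d. \<Sum>l<e. of_int (A i k * B j l) * m (k, l))"
      by (simp add: A B z sum_product m_def mult_ac)
    finally show "x * y * m z = (\<Sum>w\<in>I. of_int ((case z of (i, j) \<Rightarrow> \<lambda>(k, l). A i k * B j l) w) * m w)"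
      by (simp add: I_def sum.cartesian_product z case_prod_unfold)
  qed
  show "algebraic_int (x + y)"
  proof (rule algebraic_int_via_integer_matrix[where m = m, OF I,
        where A = "\<lambda>(i, j) (k, l). A i k * of_bool (l = j) + of_bool (k = i) * B j l"])
    fix z assume "z \<in> I"
    then obtain i j where z: "z = (i, j)" "i < d" "j < e" by (auto simp: I_def)
    have 1: "(\<Sum>k<d. \<Sum>l<e. of_int (A i k * of_bool (l = j)) * m (k, l))
        = (\<Sum>k<d. of_int (A i k) * m (k, j))"
    proof (rule sum.cong[OF refl])
      fix k
      have "(\<Sum>l<e. of_int (A i k * of_bool (l = j)) * m (k, l))
          = (\<Sum>l<e. if l = j then of_int (A i k) * m (k, l) else 0)"
        by (intro sum.cong) auto
      then show "(\<Sum>l<e. of_int (A i k * of_bool (l = j)) * m (k, l)) = of_int (A i k) * m (k, j)"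
        using z by simp
    qed
    have 2: "(\<Sum>k<d. \<Sum>l<e. of_int (of_bool (k = i) * B j l) * m (k, l))
        = (\<Sum>l<e. of_int (B j l) * m (i, l))"
    proof -
      have "(\<Sum>k<d. \<Sum>l<e. of_int (of_bool (k = i) * B j l) * m (k, l))
          = (\<Sum>k<d. if k = i then \<Sum>l<e. of_int (B j l) * m (k, l) else 0)"
        by (intro sum.cong) auto
      then show ?thesis using z by simp
    qed
    have "(x + y) * m z = (x * x ^ i) * y ^ j + x ^ i * (y * y ^ j)"
      by (simp add: z m_def algebra_simps)
    also have "\<dots> = (\<Sum>k<d. of_int (A i k) * m (k, j)) + (\<Sum>l<e. of_int (B j l) * m (i, l))"
      by (simp add: A B z sum_distrib_left sum_distrib_right m_def mult_ac)
    also have "\<dots> = (\<Sum>k<d. \<Sum>l<e. of_int (A i k * of_bool (l = j) + of_bool (k = i) * B j l) * m (k, l))"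
      unfolding 1[symmetric] 2[symmetric] by (simp only: of_int_add distrib_right sum.distrib)
    finally show "(x + y) * m z = (\<Sum>w\<in>I. of_int ((case z of (i, j) \<Rightarrow>
        \<lambda>(k, l). A i k * of_bool (l = j) + of_bool (k = i) * B j l) w) * m w)"
      by (simp add: I_def sum.cartesian_product z case_prod_unfold)
  qed
qed

section \<open>Embeddings with prescribed values\<close>

abbreviation rpoly :: "rat poly \<Rightarrow> 'a::field_char_0 \<Rightarrow> 'a" where
  "rpoly p x \<equiv> poly (map_poly of_rat p) x"

abbreviation rat_scale :: "rat \<Rightarrow> 'a::field_char_0 \<Rightarrow> 'a" where
  "rat_scale c x \<equiv> of_rat c * x"

lemma vector_space_rat: "vector_space (rat_scale :: rat \<Rightarrow> 'a::field_char_0 \<Rightarrow> 'a)"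
  by unfold_locales (auto simp: algebra_simps of_rat_add of_rat_mult)

text \<open>Phrased by the absence of a relation of degree below \<open>e\<close>, so that it
  applies both with \<open>e\<close> beyond the dimension, to show that some relation exists, and
  with \<open>e\<close> the degree of a minimal polynomial.\<close>

lemma powers_independent:
  fixes y :: "'a::field_char_0"
  assumes "\<And>p. p \<noteq> 0 \<Longrightarrow> degree p < e \<Longrightarrow> rpoly p y \<noteq> 0"
  shows "inj_on (\<lambda>i. y ^ i) {..<e}" and "\<not> module.dependent rat_scale ((\<lambda>i. y ^ i) ` {..<e})"
proof -
  interpret vector_space "rat_scale :: rat \<Rightarrow> 'a \<Rightarrow> 'a" by (rule vector_space_rat)
  have ne: "y ^ i \<noteq> y ^ j" if "i < j" "j < e" for i j
  proof
    assume eq: "y ^ i = y ^ j"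
    let ?p = "monom 1 j + monom (-1) i :: rat poly"
    have "poly.coeff ?p j = 1" using that by simp
    then have "?p \<noteq> 0" by force
    moreover have "degree ?p < e"
      using that by (intro le_less_trans[OF degree_add_le_max]) (auto simp: degree_monom_eq)
    moreover have "rpoly ?p y = 0" using eq by (simp add: of_rat_hom.map_poly_hom_add poly_monom)
    ultimately show False using assms by blast
  qed
  show inj: "inj_on (\<lambda>i. y ^ i) {..<e}"
    
  proof (rule inj_onI)
    fix i j assume "i \<in> {..<e}" "j \<in> {..<e}" "y ^ i = y ^ j"
    then show "i = j" using ne[of i j] ne[of j i] by (cases i j rule: linorder_cases) auto
  qed
  show "independent ((\<lambda>i. y ^ i) ` {..<e})"
  proof (subst dependent_finite)
    show "\<not> (\<exists>c. (\<exists>v\<in>(\<lambda>i. y ^ i) ` {..<e}. c v \<noteq> 0) \<and> (\<Sum>v\<in>(\<lambda>i. y ^ i) ` {..<e}. of_rat (c v) * v) = 0)"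
    proof clarsimp
      fix c i assume i: "i < e" "c (y ^ i) \<noteq> 0"
        and sum: "(\<Sum>v\<in>(\<lambda>i. y ^ i) ` {..<e}. of_rat (c v) * v) = 0"
      define p where "p = (\<Sum>i<e. monom (c (y ^ i)) i)"
      have cf: "poly.coeff p j = (if j < e then c (y ^ j) else 0)" for j
        by (simp add: p_def coeff_sum)
      then have "p \<noteq> 0" using i by (metis coeff_0)
      have z: "c (y ^ j) = 0" if "degree p < j" "j < e" for j
        using cf[of j] coeff_eq_0[of p j] that by simp
      note \<open>p \<noteq> 0\<close>
      moreover have "degree p < e" unfolding p_def
        by (rule degree_sum_less) (use i in \<open>auto intro: le_less_trans[OF degree_monom_le]\<close>)
      moreover have "rpoly p y = (\<Sum>i<e. of_rat (c (y ^ i)) * y ^ i)"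
        using \<open>degree p < e\<close> z unfolding poly_altdef
        by (intro sum.mono_neutral_cong_left) (auto simp: cf not_le)
      ultimately show False
        using assms[of p] sum by (simp add: sum.reindex[OF inj])
    qed
  qed simp
qed

lemma number_field_rpoly_root:
  assumes "number_field TYPE('k::field_char_0)"
  obtains p where "p \<noteq> 0" "rpoly p (x::'k) = 0"
proof -
  obtain Basis :: "'k set" where "finite_dimensional_vector_space rat_scale Basis"
    using assms unfolding number_field_def by blast
  then interpret finite_dimensional_vector_space rat_scale Basis .
  have False if *: "\<And>p. p \<noteq> 0 \<Longrightarrow> rpoly p x \<noteq> 0"
  proof -
    let ?S = "(\<lambda>i. x ^ i) ` {..<Suc dimension}"
    have "independent ?S" "card ?S = Suc dimension"
      using powers_independent[of "Suc dimension" x] * by (auto simp: card_image)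
    then show False
      using independent_card_le_dim[of ?S UNIV] by (simp add: dimension_def)
  qed
  then show thesis using that by blast
qed

lemma number_field_algebraic:
  assumes "number_field TYPE('k::field_char_0)"
  shows "algebraic (x::'k)"
proof -
  obtain p where "p \<noteq> 0" "rpoly p x = 0" using number_field_rpoly_root[OF assms] .
  then show ?thesis
    by (intro algebraicI'[of "map_poly of_rat p"]) auto
qed

text \<open>Divisibility makes additive maps between fields of characteristic zero linear over the
  rationals, so additivity is all that has to be carried along for functionals.\<close>

lemma additive_of_rat_mult:
  fixes \<mu> :: "'a::field_char_0 \<Rightarrow> 'b::field_char_0"
  assumes "Modules.additive \<mu>"
  shows "\<mu> (of_rat c * z) = of_rat c * \<mu> z"
proof -
  interpret Modules.additive \<mu> by fact
  have nat: "\<mu> (of_nat n * w) = of_nat n * \<mu> w" for n w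
    by (induction n) (auto simp: algebra_simps add zero)
  have int: "\<mu> (of_int n * w) = of_int n * \<mu> w" for n w
    by (cases n) (auto simp: nat minus simp del: of_nat_Suc)
  obtain a b :: int where "c = Rat.Fract a b" "b > 0" by (cases c)
  then have c: "c = of_int a / of_int b" "b \<noteq> 0" by (auto simp: Fract_of_int_quotient)
  have "of_int b * \<mu> (of_rat c * z) = \<mu> (of_int b * (of_rat c * z))" by (rule int[symmetric])
  also have "of_int b * (of_rat c * z) = of_int a * z"
    using c by (simp add: of_rat_divide)
  also have "\<mu> (of_int a * z) = of_int b * (of_rat c * \<mu> z)"
    using c by (simp add: int of_rat_divide)
  finally show ?thesis using c by simp
qed

text \<open>The polynomials act on the functionals on \<open>K\<close>, the variable acting as multiplication of the
  argument by \<open>b\<close>. A common eigenvector of all these actions is a multiple of an embedding.\<close>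

definition act :: "complex poly \<Rightarrow> 'k::field_char_0 \<Rightarrow> ('k \<Rightarrow> complex) \<Rightarrow> 'k \<Rightarrow> complex" where
  "act g b \<mu> z = (\<Sum>i\<le>degree g. poly.coeff g i * \<mu> (b ^ i * z))"

lemma act_altdef:
  assumes "degree g \<le> n"
  shows "act g b \<mu> z = (\<Sum>i\<le>n. poly.coeff g i * \<mu> (b ^ i * z))"
  unfolding act_def using assms by (intro sum.mono_neutral_left) (auto simp: coeff_eq_0)

text \<open>If \<open>[:-\<gamma>, 1:] * g\<close> annihilates \<mu>, this says that
  \<open>act g b \<mu>\<close> satisfies the eigenvalue equation with \<gamma> for multiplication by
  \<open>b\<close>.\<close>

lemma act_linear_factor: "act ([:-\<gamma>, 1:] * g) b \<mu> z = act g b \<mu> (b * z) - \<gamma> * act g b \<mu> z"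
proof -
  define n where "n = degree g"
  have "degree ([:-\<gamma>, 1:] * g) \<le> Suc n"
    using degree_mult_le[of "[:-\<gamma>, 1:]" g] by (simp add: n_def)
  then have "act ([:-\<gamma>, 1:] * g) b \<mu> z
      = (\<Sum>i\<le>Suc n. poly.coeff ([:-\<gamma>, 1:] * g) i * \<mu> (b ^ i * z))" by (rule act_altdef)
  \<comment> \<open>Both sums run to \<open>Suc n\<close> so that they can be subtracted term by
    term; \<open>pCons 0 g\<close> is \<open>g\<close> times the variable.\<close>
  also have "\<dots> = (\<Sum>i\<le>Suc n. poly.coeff (pCons 0 g) i * \<mu> (b ^ i * z))
      - \<gamma> * (\<Sum>i\<le>Suc n. poly.coeff g i * \<mu> (b ^ i * z))"
    by (simp add: sum_distrib_left sum_subtractf[symmetric] algebra_simps del: sum.atMost_Suc)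
  also have "(\<Sum>i\<le>Suc n. poly.coeff g i * \<mu> (b ^ i * z)) = act g b \<mu> z"
    by (rule act_altdef[symmetric]) (simp add: n_def)
  also have "(\<Sum>i\<le>Suc n. poly.coeff (pCons 0 g) i * \<mu> (b ^ i * z)) = act g b \<mu> (b * z)"
    unfolding sum.atMost_Suc_shift act_def n_def by (simp add: mult_ac)
  finally show ?thesis .
qed

lemma act_additive: "Modules.additive \<mu> \<Longrightarrow> Modules.additive (act g b \<mu>)"
  by (unfold_locales) (simp add: act_def distrib_left additive.add sum.distrib)

text \<open>Rational coefficients can be moved inside \<mu>, so a rational polynomial vanishing at
  \<open>b\<close> annihilates every additive functional.\<close>

lemma act_rpoly:
  assumes "Modules.additive \<mu>"
  shows "act (map_poly of_rat p) b \<mu> z = \<mu> (rpoly p b * z)"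
proof -
  have "\<mu> (rpoly p b * z) = \<mu> (\<Sum>i\<le>degree p. of_rat (poly.coeff p i) * (b ^ i * z))"
    by (simp add: poly_altdef sum_distrib_right mult.assoc)
  also have "\<dots> = (\<Sum>i\<le>degree p. of_rat (poly.coeff p i) * \<mu> (b ^ i * z))"
    by (simp add: additive.sum[OF assms] additive_of_rat_mult[OF assms])
  finally show ?thesis by (simp add: act_def)
qed

text \<open>Multiplications commute, so passing to an eigenvector for a further element preserves
  the eigenvalues already obtained.\<close>

lemma act_common_eigen:
  assumes "\<And>z. \<mu> (x * z) = \<theta> * \<mu> z"
  shows "act g b \<mu> (x * z) = \<theta> * act g b \<mu> z"
  unfolding act_def sum_distrib_left
  by (rule sum.cong) (auto simp: assms mult.left_commute[of _ x])

text \<open>Split the annihilating polynomial into linear factors and apply them one after the other: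
  the last nonzero functional obtained is an eigenvector.\<close>

lemma eigenfunctional_refine:
  assumes "h \<noteq> 0" "\<And>z. act h b \<mu> z = 0" "Modules.additive \<mu>" "\<mu> \<noteq> (\<lambda>_. 0)"
    and "\<And>x \<theta> z. (x, \<theta>) \<in> A \<Longrightarrow> \<mu> (x * z) = \<theta> * \<mu> z"
  shows "\<exists>\<nu> \<gamma>. Modules.additive \<nu> \<and> \<nu> \<noteq> (\<lambda>_. 0) \<and> (\<forall>z. \<nu> (b * z) = \<gamma> * \<nu> z) \<and>
    (\<forall>(x, \<theta>)\<in>A. \<forall>z. \<nu> (x * z) = \<theta> * \<nu> z)"
  using assms(1,2)
proof (induction "degree h" arbitrary: h rule: less_induct)
  case less
  show ?case
  proof (cases "degree h = 0")
    case True
    then obtain c where "h = [:c:]" by (auto elim: degree_eq_zeroE)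
    then show ?thesis using less.prems assms(4) by (auto simp: act_def)
  next
    case False
    then obtain \<gamma> where "poly h \<gamma> = 0" using alg_closed_imp_poly_has_root by blast
    then obtain g where g: "h = [:-\<gamma>, 1:] * g" by (metis dvdE poly_eq_0_iff_dvd)
    have "g \<noteq> 0" using g less.prems(1) by auto
    then have deg: "degree g < degree h" unfolding g by (subst degree_mult_eq) auto
    show ?thesis
    proof (cases "\<forall>z. act g b \<mu> z = 0")
      case True
      then show ?thesis using less.hyps[OF deg \<open>g \<noteq> 0\<close>] by blast
    next
      case False
      then have "act g b \<mu> \<noteq> (\<lambda>_. 0)" by auto
      moreover have "act g b \<mu> (b * z) = \<gamma> * act g b \<mu> z" for z
        using less.prems(2)[of z] unfolding g act_linear_factor by simp
      ultimately show ?thesis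
        using act_additive[OF assms(3)] act_common_eigen[of \<mu>] assms(5)
        by (intro exI[of _ "act g b \<mu>"] exI[of _ \<gamma>]) blast
    qed
  qed
qed

lemma number_field_common_eigenfunctional:
  fixes y :: "'k::field_char_0" and \<mu> :: "'k \<Rightarrow> complex"
  assumes K: "number_field TYPE('k)" and fin: "finite S"
    and \<mu>: "Modules.additive \<mu>" "\<mu> \<noteq> (\<lambda>_. 0)" "\<And>z. \<mu> (y * z) = \<beta> * \<mu> z"
  shows "\<exists>\<nu> :: 'k \<Rightarrow> complex. Modules.additive \<nu> \<and> \<nu> \<noteq> (\<lambda>_. 0) \<and> (\<forall>z. \<nu> (y * z) = \<beta> * \<nu> z) \<and>
    (\<forall>b\<in>S. \<exists>\<gamma>. \<forall>z. \<nu> (b * z) = \<gamma> * \<nu> z)"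
  using fin
proof (induction S)
  case empty
  then show ?case using \<mu> by blast
next
  case (insert b S)
  then obtain \<nu> where \<nu>: "Modules.additive \<nu>" "\<nu> \<noteq> (\<lambda>_. 0)" "\<forall>z. \<nu> (y * z) = \<beta> * \<nu> z"
    "\<forall>b\<in>S. \<exists>\<gamma>. \<forall>z. \<nu> (b * z) = \<gamma> * \<nu> z" by blast
  obtain p where p: "p \<noteq> 0" "rpoly p b = 0" using number_field_rpoly_root[OF K] .
  have "act (map_poly of_rat p) b \<nu> z = 0" for z
    using p additive.zero[OF \<nu>(1)] by (simp add: act_rpoly[OF \<nu>(1)])
  moreover have "map_poly of_rat p \<noteq> (0 :: complex poly)" using p by simp
  \<comment> \<open>All eigenpairs of \<nu> are handed over, so those of \<open>y\<close> and of the
    elements treated before survive.\<close>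
  ultimately obtain \<nu>' \<gamma> where "Modules.additive \<nu>'" "\<nu>' \<noteq> (\<lambda>_. 0)" "\<forall>z. \<nu>' (b * z) = \<gamma> * \<nu>' z"
    and "\<forall>(x, \<theta>)\<in>{(x, \<theta>). \<forall>z. \<nu> (x * z) = \<theta> * \<nu> z}. \<forall>z. \<nu>' (x * z) = \<theta> * \<nu>' z"
    using eigenfunctional_refine[of "map_poly of_rat p" b \<nu> "{(x, \<theta>). \<forall>z. \<nu> (x * z) = \<theta> * \<nu> z}"] \<nu>
    by blast
  then show ?case using \<nu> by (intro exI[of _ \<nu>']) blast
qed

text \<open>The functional \<eta> singles out the top power \<open>y ^ d\<close> among the powers
  below the degree of \<open>f\<close>. Acting on it by the cofactor \<open>g\<close> of the linear
  factor of \<beta> gives a nonzero functional with eigenvalue \<beta> at \<open>y\<close>. Once it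
  is refined to an eigenvector for a whole basis it is one for the whole field, and dividing by its
  value at 1 makes it multiplicative.\<close>

lemma number_field_embedding_of_root:
  fixes y :: "'k::field_char_0"
  assumes K: "number_field TYPE('k)"
    and f: "f \<noteq> 0" "rpoly f y = 0" "\<And>p. p \<noteq> 0 \<Longrightarrow> degree p < degree f \<Longrightarrow> rpoly p y \<noteq> 0"
    and \<beta>: "rpoly f \<beta> = 0"
  shows "\<exists>\<sigma>. embedding \<sigma> \<and> \<sigma> y = \<beta>"
proof -
  obtain Basis :: "'k set" where "finite_dimensional_vector_space rat_scale Basis"
    using K unfolding number_field_def by blast
  then interpret fd: finite_dimensional_vector_space rat_scale Basis .
  interpret vector_space_pair "rat_scale :: rat \<Rightarrow> 'k \<Rightarrow> 'k" "rat_scale :: rat \<Rightarrow> complex \<Rightarrow> complex"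
    by (intro vector_space_pair.intro vector_space_rat)
  obtain g where g: "map_poly of_rat f = [:-\<beta>, 1:] * g" by (metis \<beta> dvdE poly_eq_0_iff_dvd)
  have "map_poly of_rat f \<noteq> (0 :: complex poly)" using f by simp
  then have g0: "g \<noteq> 0" using g by auto
  have "degree f = degree (map_poly of_rat f :: complex poly)" by simp
  also have "\<dots> = Suc (degree g)" unfolding g using g0 by (subst degree_mult_eq) auto
  finally have deg: "degree f = Suc (degree g)" .
  define d where "d = degree g"
  have ind: "inj_on (\<lambda>i. y ^ i) {..<degree f}"
    "\<not> module.dependent rat_scale ((\<lambda>i. y ^ i) ` {..<degree f})"
    using powers_independent[of "degree f" y] f(3) by blast+
  obtain \<eta> :: "'k \<Rightarrow> complex" where \<eta>: "Vector_Spaces.linear rat_scale rat_scale \<eta>"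
    "\<And>x. x \<in> (\<lambda>i. y ^ i) ` {..<degree f} \<Longrightarrow> \<eta> x = of_bool (x = y ^ d)"
    using linear_independent_extend[OF ind(2), of "\<lambda>x. of_bool (x = y ^ d)"] by blast
  interpret \<eta>: Vector_Spaces.linear rat_scale rat_scale \<eta> by fact
  have add\<eta>: "Modules.additive \<eta>" by unfold_locales (rule \<eta>.add)
  have pow: "\<eta> (y ^ i) = of_bool (i = d)" if "i \<le> d" for i
    using \<eta>(2)[of "y ^ i"] that inj_onD[OF ind(1), of i d] by (auto simp: deg d_def)
  define \<mu> where "\<mu> = act g y \<eta>"
  \<comment> \<open>Only the term \<open>i = d\<close> survives, so this value is the leading
    coefficient of \<open>g\<close>.\<close>
  have "\<mu> 1 = (\<Sum>i\<le>d. poly.coeff g i * of_bool (i = d))"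
    unfolding \<mu>_def act_def d_def[symmetric] by (rule sum.cong) (auto simp: pow)
  also have "\<dots> = (\<Sum>i\<le>d. if i = d then poly.coeff g i else 0)" by (rule sum.cong) auto
  also have "\<dots> = poly.coeff g d" by simp
  finally have "\<mu> 1 \<noteq> 0" using g0 by (simp add: d_def)
  then have "\<mu> \<noteq> (\<lambda>_. 0)" by auto
  moreover have "\<mu> (y * z) = \<beta> * \<mu> z" for z
  proof -
    have "\<mu> (y * z) - \<beta> * \<mu> z = act (map_poly of_rat f) y \<eta> z"
      unfolding \<mu>_def g act_linear_factor ..
    also have "\<dots> = 0" using f(2) additive.zero[OF add\<eta>] by (simp add: act_rpoly[OF add\<eta>])
    finally show ?thesis by simp
  qed
  moreover have "Modules.additive \<mu>" unfolding \<mu>_def by (rule act_additive[OF add\<eta>])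
  ultimately obtain \<nu> where \<nu>: "Modules.additive \<nu>" "\<nu> \<noteq> (\<lambda>_. 0)" "\<And>z. \<nu> (y * z) = \<beta> * \<nu> z"
    "\<And>b. b \<in> Basis \<Longrightarrow> \<exists>\<gamma>. \<forall>z. \<nu> (b * z) = \<gamma> * \<nu> z"
    using number_field_common_eigenfunctional[OF K fd.finite_Basis, of \<mu> y \<beta>] by blast
  have eig: "\<exists>\<gamma>. \<forall>z. \<nu> (x * z) = \<gamma> * \<nu> z" for x
  proof -
    have "x \<in> fd.span Basis" by (simp add: fd.span_Basis)
    then show ?thesis
    proof (induction rule: fd.span_induct_alt)
      case base
      then show ?case using additive.zero[OF \<nu>(1)] by (intro exI[of _ 0]) simp
    next
      case (step c b x)
      then obtain \<gamma> \<delta> where "\<forall>z. \<nu> (b * z) = \<gamma> * \<nu> z" "\<forall>z. \<nu> (x * z) = \<delta> * \<nu> z"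
        using \<nu>(4) by blast
      then have "\<nu> ((of_rat c * b + x) * z) = (of_rat c * \<gamma> + \<delta>) * \<nu> z" for z
        by (simp add: distrib_right additive.add[OF \<nu>(1)] additive_of_rat_mult[OF \<nu>(1)] mult.assoc)
      then show ?case by blast
    qed
  qed
  \<comment> \<open>Each side equals the eigenvalue of \<open>x\<close> times
    \<open>\<nu> 1 * \<nu> z\<close>; the identity is the multiplicativity of \<nu> divided by
    \<open>\<nu> 1\<close>.\<close>
  have eig1: "\<nu> x * \<nu> z = \<nu> 1 * \<nu> (x * z)" for x z
  proof -
    obtain \<gamma> where "\<forall>z. \<nu> (x * z) = \<gamma> * \<nu> z" using eig by blast
    then show ?thesis by (metis mult.assoc mult.commute mult.right_neutral)
  qed
  have \<nu>1: "\<nu> 1 \<noteq> 0"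
  proof
    assume "\<nu> 1 = 0"
    then have "\<nu> x = 0" for x using eig1[of x x] by simp
    then show False using \<nu>(2) by auto
  qed
  define \<sigma> where "\<sigma> x = \<nu> x / \<nu> 1" for x
  have "embedding \<sigma>" unfolding embedding_def \<sigma>_def
    using \<nu>1 eig1 by (auto simp: additive.add[OF \<nu>(1)] field_simps)
  moreover have "\<sigma> y = \<beta>" using \<nu>(3)[of 1] \<nu>1 by (simp add: \<sigma>_def)
  ultimately show ?thesis by blast
qed

section \<open>The norm of an algebraic integer\<close>

lemma embedding_field_hom: "embedding \<sigma> \<Longrightarrow> field_char_0_hom \<sigma>"
  unfolding embedding_def by unfold_locales (auto, metis add_cancel_left_left)

lemma embedding_of_rat:
  assumes "embedding \<sigma>"
  shows "\<sigma> (of_rat c) = of_rat c"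
proof -
  interpret field_char_0_hom \<sigma> by (rule embedding_field_hom[OF assms])
  have "Modules.additive \<sigma>" by unfold_locales (rule hom_add)
  then show ?thesis using additive_of_rat_mult[of \<sigma> c 1] by simp
qed

lemma embedding_rpoly:
  assumes "embedding \<sigma>"
  shows "\<sigma> (rpoly p x) = rpoly p (\<sigma> x)"
proof -
  interpret field_char_0_hom \<sigma> by (rule embedding_field_hom[OF assms])
  show ?thesis by (simp add: poly_altdef hom_distribs embedding_of_rat[OF assms])
qed

lemma embedding_algebraic_int:
  assumes "embedding \<sigma>" "algebraic_int x"
  shows "algebraic_int (\<sigma> x)"
proof -
  interpret field_char_0_hom \<sigma> by (rule embedding_field_hom[OF assms(1)])
  obtain p where p: "poly (map_poly of_int p) x = 0" "lead_coeff p = 1"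
    using assms(2) unfolding algebraic_int_altdef_ipoly by blast
  have "poly (map_poly of_int p) (\<sigma> x) = \<sigma> (poly (map_poly of_int p) x)"
    by (simp add: poly_altdef hom_distribs)
  then show ?thesis using p unfolding algebraic_int_altdef_ipoly by auto
qed

text \<open>An embedding is determined by its values on a basis, and each of these is a root of a
  fixed polynomial.\<close>

lemma finite_embeddings:
  assumes K: "number_field TYPE('k::field_char_0)"
  shows "finite {\<sigma> :: 'k \<Rightarrow> complex. embedding \<sigma>}"
proof -
  obtain Basis :: "'k set" where "finite_dimensional_vector_space rat_scale Basis"
    using K unfolding number_field_def by blast
  then interpret fd: finite_dimensional_vector_space rat_scale Basis .
  have "\<exists>p. p \<noteq> 0 \<and> rpoly p b = 0" for b :: 'k
    using number_field_rpoly_root[OF K] by metis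
  then obtain P where P: "\<And>b::'k. P b \<noteq> 0" "\<And>b. rpoly (P b) b = 0" by metis
  let ?R = "\<lambda>b. {z::complex. rpoly (P b) z = 0}"
  have fin: "finite (?R b)" for b using P(1) by (intro poly_roots_finite) simp
  have "(\<lambda>\<sigma>. restrict \<sigma> Basis) ` {\<sigma>. embedding \<sigma>} \<subseteq> (\<Pi>\<^sub>E b\<in>Basis. ?R b)"
  proof (clarify, unfold restrict_PiE_iff, intro ballI CollectI)
    fix \<sigma> :: "'k \<Rightarrow> complex" and b assume "embedding \<sigma>"
    then interpret field_char_0_hom \<sigma> by (rule embedding_field_hom)
    show "rpoly (P b) (\<sigma> b) = 0"
      by (simp add: embedding_rpoly[OF \<open>embedding \<sigma>\<close>, symmetric] P(2))
  qed
  then have "finite ((\<lambda>\<sigma>. restrict \<sigma> Basis) ` {\<sigma> :: 'k \<Rightarrow> complex. embedding \<sigma>})"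
    by (rule finite_subset) (intro finite_PiE fd.finite_Basis fin)
  moreover have "inj_on (\<lambda>\<sigma>. restrict \<sigma> Basis) {\<sigma> :: 'k \<Rightarrow> complex. embedding \<sigma>}"
  proof (rule inj_onI, clarsimp)
    fix \<sigma> \<tau> :: "'k \<Rightarrow> complex"
    assume \<sigma>: "embedding \<sigma>" and \<tau>: "embedding \<tau>" and eq: "restrict \<sigma> Basis = restrict \<tau> Basis"
    interpret \<sigma>: field_char_0_hom \<sigma> by (rule embedding_field_hom[OF \<sigma>])
    interpret \<tau>: field_char_0_hom \<tau> by (rule embedding_field_hom[OF \<tau>])
    show "\<sigma> = \<tau>"
    proof
      fix x
      have "x \<in> fd.span Basis" by (simp add: fd.span_Basis)
      then show "\<sigma> x = \<tau> x"
      proof (induction rule: fd.span_induct_alt)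
        case (step c b x)
        have "\<sigma> b = \<tau> b" using fun_cong[OF eq, of b] step(1) by simp
        then show ?case using step
          by (simp add: \<sigma>.hom_add \<tau>.hom_add \<sigma>.hom_mult \<tau>.hom_mult embedding_of_rat \<sigma> \<tau>)
      qed simp
    qed
  qed
  ultimately show ?thesis by (rule finite_imageD)
qed

lemma rpoly_mult: "rpoly (p * q) (x::'a::field_char_0) = rpoly p x * rpoly q x"
proof -
  interpret map_poly_comm_semiring_hom "of_rat :: rat \<Rightarrow> 'a" by unfold_locales
  show ?thesis by (simp add: hom_mult)
qed

lemma minimal_rpoly_exists:
  assumes "q \<noteq> 0" "rpoly q (y::'a::field_char_0) = 0"
  obtains f where "f \<noteq> 0" "rpoly f y = 0"
    "\<And>p. p \<noteq> 0 \<Longrightarrow> degree p < degree f \<Longrightarrow> rpoly p y \<noteq> 0"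
proof -
  from ex_has_least_nat[where P = "\<lambda>p. p \<noteq> 0 \<and> rpoly p y = 0" and m = degree and k = q] assms
  obtain f where "f \<noteq> 0" "rpoly f y = 0" "\<And>p. p \<noteq> 0 \<Longrightarrow> rpoly p y = 0 \<Longrightarrow> degree f \<le> degree p"
    by blast
  then show thesis using that[of f] by (metis linorder_not_le)
qed

lemma minimal_rpoly_dvd:
  assumes "f \<noteq> 0" "rpoly f (y::'a::field_char_0) = 0"
    "\<And>p. p \<noteq> 0 \<Longrightarrow> degree p < degree f \<Longrightarrow> rpoly p y \<noteq> 0"
    and "rpoly p y = 0"
  shows "f dvd p"
proof -
  have "rpoly (p div f * f + p mod f) y = 0" using assms(4) by simp
  then have "rpoly (p mod f) y = 0"
    using assms(2) by (simp only: of_rat_hom.map_poly_hom_add poly_add rpoly_mult) simp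
  then have "p mod f = 0" using assms(1,3) degree_mod_less[OF assms(1), of p] by blast
  then show ?thesis by (simp add: mod_eq_0_iff_dvd)
qed

text \<open>Let \<open>g\<close> be minimal for \<beta>. If \<beta> were a double root,
  \<open>g\<close> would divide the derivative of \<open>f\<close>, so its degree would be below
  that of \<open>f\<close> and \<open>g\<close> would not vanish at \<open>y\<close>. Then the
  cofactor of \<open>g\<close> in \<open>f\<close> vanishes at \<open>y\<close>, which leaves only
  degree 0 for \<open>g\<close>.\<close>

lemma minimal_rpoly_separable:
  fixes y :: "'a::field_char_0" and \<beta> :: complex
  assumes f: "f \<noteq> 0" "rpoly f y = 0" "\<And>p. p \<noteq> 0 \<Longrightarrow> degree p < degree f \<Longrightarrow> rpoly p y \<noteq> 0"
    and \<beta>: "rpoly f \<beta> = 0"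
  shows "rpoly (pderiv f) \<beta> \<noteq> 0"
proof
  assume \<beta>': "rpoly (pderiv f) \<beta> = 0"
  have "degree f > 0"
  proof (rule Nat.gr0I)
    assume "degree f = 0"
    then obtain c where "f = [:c:]" by (auto elim: degree_eq_zeroE)
    then show False using f(1,2) by simp
  qed
  then have f': "pderiv f \<noteq> 0" "degree (pderiv f) < degree f"
    by (auto simp: pderiv_eq_0_iff degree_pderiv)
  obtain g where g: "g \<noteq> 0" "rpoly g \<beta> = 0"
    "\<And>p. p \<noteq> 0 \<Longrightarrow> degree p < degree g \<Longrightarrow> rpoly p \<beta> \<noteq> 0"
    using minimal_rpoly_exists[OF f(1) \<beta>] by blast
  have "degree g \<le> degree (pderiv f)"
    using minimal_rpoly_dvd[OF g \<beta>'] f'(1) by (rule dvd_imp_degree_le)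
  then have gy: "rpoly g y \<noteq> 0" using f(3)[OF g(1)] f'(2) by simp
  obtain h where h: "f = g * h" using minimal_rpoly_dvd[OF g \<beta>] by (rule dvdE)
  have h0: "h \<noteq> 0" using h f(1) by auto
  have "rpoly g y * rpoly h y = 0" using f(2) by (simp only: h rpoly_mult)
  then have "rpoly h y = 0" using gy by simp
  then have "\<not> degree h < degree f" using f(3)[OF h0] by blast
  then have "degree g = 0" using g(1) h0 by (simp add: h degree_mult_eq)
  then obtain c where c: "g = [:c:]" by (auto elim: degree_eq_zeroE)
  then show False using g by simp
qed

text \<open>For a generic \<open>y\<close> the embeddings correspond one to one to the roots of its
  minimal polynomial, because every root comes from an embedding. The roots are simple, so the
  product is read off from the constant and the leading coefficient.\<close>

lemma prod_embeddings_rational: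
  assumes K: "number_field TYPE('k::field_char_0)"
    and inj: "inj_on (\<lambda>\<sigma>. \<sigma> y) {\<sigma> :: 'k \<Rightarrow> complex. embedding \<sigma>}"
  shows "(\<Prod>\<sigma> | embedding \<sigma>. \<sigma> (y::'k)) \<in> \<rat>"
proof -
  obtain q where q: "q \<noteq> 0" "rpoly q y = 0" by (rule number_field_rpoly_root[OF K])
  obtain f where f: "f \<noteq> 0" "rpoly f y = 0" "\<And>p. p \<noteq> 0 \<Longrightarrow> degree p < degree f \<Longrightarrow> rpoly p y \<noteq> 0"
    using minimal_rpoly_exists[OF q] by blast
  let ?F = "map_poly of_rat f :: complex poly"
  have roots: "{z. poly ?F z = 0} = (\<lambda>\<sigma>. \<sigma> y) ` {\<sigma>. embedding \<sigma>}"
  proof (intro equalityI subsetI)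
    fix z assume "z \<in> {z. poly ?F z = 0}"
    then show "z \<in> (\<lambda>\<sigma>. \<sigma> y) ` {\<sigma>. embedding \<sigma>}"
      using number_field_embedding_of_root[OF K f] by auto
  next
    fix z assume "z \<in> (\<lambda>\<sigma>. \<sigma> y) ` {\<sigma>. embedding \<sigma>}"
    then obtain \<sigma> where \<sigma>: "embedding \<sigma>" "z = \<sigma> y" by blast
    interpret field_char_0_hom \<sigma> by (rule embedding_field_hom[OF \<sigma>(1)])
    show "z \<in> {z. poly ?F z = 0}"
      using f(2) by (simp add: \<sigma> embedding_rpoly[OF \<sigma>(1), symmetric])
  qed
  have "rsquarefree ?F"
    unfolding rsquarefree_roots using minimal_rpoly_separable[OF f]
    by (auto simp: of_rat_hom.map_poly_pderiv)
  then have "?F = Polynomial.smult (lead_coeff ?F) (\<Prod>z | poly ?F z = 0. [:-z, 1:])"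
    by (rule complex_poly_decompose_rsquarefree[symmetric])
  then have "poly ?F 0 = poly (Polynomial.smult (lead_coeff ?F) (\<Prod>z | poly ?F z = 0. [:-z, 1:])) 0" by metis
  also have "\<dots> = lead_coeff ?F * (\<Prod>z\<in>(\<lambda>\<sigma>. \<sigma> y) ` {\<sigma>. embedding \<sigma>}. - z)"
    by (simp add: poly_prod roots)
  also have "\<dots> = lead_coeff ?F * (\<Prod>\<sigma> | embedding \<sigma>. - \<sigma> y)"
    by (simp add: prod.reindex[OF inj])
  also have "\<dots> = lead_coeff ?F * (- 1) ^ card {\<sigma> :: 'k \<Rightarrow> complex. embedding \<sigma>} * (\<Prod>\<sigma> | embedding \<sigma>. \<sigma> y)"
    by (simp add: prod_uminus)
  finally have "(\<Prod>\<sigma> | embedding \<sigma>. \<sigma> y)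
      = of_rat (poly.coeff f 0) / (of_rat (lead_coeff f) * (- 1) ^ card {\<sigma> :: 'k \<Rightarrow> complex. embedding \<sigma>})"
    using f(1) by (simp add: field_simps poly_0_coeff_0)
  also have "\<dots> \<in> \<rat>" by (intro Rats_divide Rats_mult Rats_power) auto
  finally show ?thesis .
qed

lemma algebraic_int_prod: "(\<And>i. i \<in> S \<Longrightarrow> algebraic_int (h i)) \<Longrightarrow> algebraic_int (prod h S)"
  for h :: "'b \<Rightarrow> 'a::field_char_0"
  by (induction S rule: infinite_finite_induct) (auto intro: algebraic_int_mult)

lemma prod_embeddings_ge_1_generic:
  assumes K: "number_field TYPE('k::field_char_0)"
    and inj: "inj_on (\<lambda>\<sigma>. \<sigma> y) {\<sigma> :: 'k \<Rightarrow> complex. embedding \<sigma>}"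
    and y: "algebraic_int (y::'k)" "y \<noteq> 0"
  shows "1 \<le> (\<Prod>\<sigma> | embedding \<sigma>. cmod (\<sigma> y))"
proof -
  let ?N = "\<Prod>\<sigma> | embedding \<sigma>. \<sigma> y"
  have "algebraic_int ?N" using embedding_algebraic_int y(1) by (intro algebraic_int_prod) auto
  then have "?N \<in> \<int>" using prod_embeddings_rational[OF K inj] by (rule rational_algebraic_int_is_int)
  then obtain a where a: "?N = of_int a" by (elim Ints_cases)
  have "?N \<noteq> 0"
  proof (subst prod_zero_iff[OF finite_embeddings[OF K]], safe)
    fix \<sigma> :: "'k \<Rightarrow> complex" assume "embedding \<sigma>" "\<sigma> y = 0"
    then interpret field_char_0_hom \<sigma> by (intro embedding_field_hom)
    show False using \<open>\<sigma> y = 0\<close> y(2) by simp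
  qed
  then have "a \<noteq> 0" using a by auto
  then have "1 \<le> \<bar>real_of_int a\<bar>" by linarith
  also have "\<dots> = cmod ?N" by (simp add: a)
  finally show ?thesis by (simp add: prod_norm)
qed

lemma algebraic_imp_algebraic_int_multiple:
  fixes x :: "'a::field_char_0"
  assumes "algebraic x"
  obtains c :: int where "c \<noteq> 0" "algebraic_int (of_int c * x)"
proof -
  obtain p where p: "\<And>i. poly.coeff p i \<in> \<int>" "poly p x = 0" "p \<noteq> 0"
    using assms by (elim algebraicE) auto
  have "\<forall>i. \<exists>z. poly.coeff p i = of_int z" using p(1) by (auto elim: Ints_cases)
  then obtain q where q: "\<And>i. poly.coeff p i = of_int (q i)" by (auto dest: choice)
  define d where "d = degree p"
  define c where "c = q d"
  have c0: "c \<noteq> 0" using p(3) q[of d] by (auto simp: c_def d_def)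
  have d0: "d > 0"
  proof (rule Nat.gr0I)
    assume "d = 0"
    then obtain a where "p = [:a:]" by (auto simp: d_def elim: degree_eq_zeroE)
    then show False using p(2,3) by simp
  qed
  define y where "y = of_int c * x"
  have "0 = (\<Sum>i\<le>d. of_int (q i) * x ^ i)" using p(2) by (simp add: poly_altdef q d_def)
  also have "\<dots> = (\<Sum>i<d. of_int (q i) * x ^ i) + of_int c * x ^ d"
    by (simp add: c_def lessThan_Suc_atMost[symmetric])
  finally have xd: "of_int c * x ^ d = - (\<Sum>i<d. of_int (q i) * x ^ i)"
    by (simp add: eq_neg_iff_add_eq_0 add.commute)
  \<comment> \<open>The equation of \<open>x\<close>, multiplied by \<open>c ^ (d - 1)\<close> and
    rewritten in powers of \<open>y\<close>, is monic.\<close>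
  have yd: "y ^ d = (\<Sum>i<d. of_int (- q i * c ^ (d - 1 - i)) * y ^ i)"
  proof -
    have "y ^ d = of_int c ^ (d - 1) * (of_int c * x ^ d)"
      using d0 by (cases d) (simp_all add: y_def power_mult_distrib mult_ac)
    also have "\<dots> = (\<Sum>i<d. - (of_int (q i) * (of_int c ^ (d - 1) * x ^ i)))"
      by (simp add: xd sum_distrib_left sum_negf mult_ac)
    also have "\<dots> = (\<Sum>i<d. of_int (- q i * c ^ (d - 1 - i)) * y ^ i)"
    proof (rule sum.cong[OF refl])
      fix i assume "i \<in> {..<d}"
      then have "of_int c ^ (d - 1) = (of_int c ^ (d - 1 - i) * of_int c ^ i :: 'a)"
        by (simp flip: power_add)
      then show "- (of_int (q i) * (of_int c ^ (d - 1) * x ^ i)) = of_int (- q i * c ^ (d - 1 - i)) * y ^ i"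
        by (simp add: y_def power_mult_distrib)
    qed
    finally show ?thesis .
  qed
  let ?A = "\<lambda>i k. if Suc i < d then of_bool (k = Suc i) else - q k * c ^ (d - 1 - k)"
  have "algebraic_int y"
  proof (rule algebraic_int_via_integer_matrix[where I = "{..<d}" and m = "\<lambda>i. y ^ i" and k = 0 and A = ?A])
    fix i assume i: "i \<in> {..<d}"
    show "y * y ^ i = (\<Sum>k<d. of_int (?A i k) * y ^ k)"
    proof (cases "Suc i < d")
      case True
      then have "(\<Sum>k<d. of_int (?A i k) * y ^ k) = (\<Sum>k<d. if k = Suc i then y ^ k else 0)"
        by (intro sum.cong) auto
      then show ?thesis using True by simp
    next
      case False
      then have "d = Suc i" using i by simp
      then show ?thesis using yd False by simp
    qed
  qed (use d0 in auto)
  then show thesis using c0 that by (simp add: y_def)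
qed

text \<open>A nontrivial affine function of \<open>j\<close> has at most one zero, so
  \<open>card P\<close> of them cannot spoil \<open>card P + 1\<close> values of
  \<open>j\<close>.\<close>

lemma avoid_affine_zeros:
  fixes a b :: "'i \<Rightarrow> complex"
  assumes fin: "finite P" and ne: "\<And>p. p \<in> P \<Longrightarrow> a p \<noteq> 0 \<or> b p \<noteq> 0"
  shows "\<exists>j\<le>card P. \<forall>p\<in>P. a p + of_nat j * b p \<noteq> 0"
proof (rule ccontr)
  assume "\<not> ?thesis"
  then have "\<forall>j\<in>{..card P}. \<exists>p. p \<in> P \<and> a p + of_nat j * b p = 0" by auto
  then obtain f where f: "\<And>j. j \<le> card P \<Longrightarrow> f j \<in> P \<and> a (f j) + of_nat j * b (f j) = 0"
    by (metis atMost_iff)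
  have "inj_on f {..card P}"
  proof (rule inj_onI)
    fix i j assume ij: "i \<in> {..card P}" "j \<in> {..card P}" "f i = f j"
    have "(of_nat i - of_nat j) * b (f j)
        = (a (f j) + of_nat i * b (f j)) - (a (f j) + of_nat j * b (f j))"
      by (simp add: algebra_simps)
    also have "\<dots> = 0" using f[of i] f[of j] ij by (simp only: atMost_iff) simp
    finally have "(of_nat i - of_nat j) * b (f j) = 0" .
    moreover have "b (f j) \<noteq> 0" using f[of j] ne[of "f j"] ij by auto
    ultimately show "i = j" by simp
  qed
  moreover have "f ` {..card P} \<subseteq> P" using f by auto
  ultimately have "card {..card P} \<le> card P" using card_inj_on_le fin by blast
  then show False by simp
qed

text \<open>One pair at a time: adding a suitable multiple of an element separating the new pair
  keeps the earlier pairs separated. The result takes the place of a primitive element.\<close>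

lemma embeddings_separated:
  assumes "finite P" "\<And>\<sigma> \<tau>. (\<sigma>, \<tau>) \<in> P \<Longrightarrow> embedding \<sigma> \<and> embedding \<tau> \<and> \<sigma> \<noteq> \<tau>"
  shows "\<exists>\<alpha> :: 'k::field_char_0. \<forall>(\<sigma>, \<tau>)\<in>P. \<sigma> \<alpha> \<noteq> \<tau> \<alpha>"
  using assms
proof (induction P)
  case empty
  then show ?case by simp
next
  case (insert p P)
  then obtain \<alpha> where \<alpha>: "\<forall>(\<sigma>, \<tau>)\<in>P. \<sigma> \<alpha> \<noteq> \<tau> \<alpha>" by auto
  obtain \<sigma>0 \<tau>0 where p: "p = (\<sigma>0, \<tau>0)" by (cases p)
  then obtain x where x: "\<sigma>0 x \<noteq> \<tau>0 x" using insert.prems[of \<sigma>0 \<tau>0] by auto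
  let ?d = "\<lambda>z (\<sigma>, \<tau>). \<sigma> z - \<tau> z :: complex"
  have "?d \<alpha> q \<noteq> 0 \<or> ?d x q \<noteq> 0" if "q \<in> insert p P" for q
    using that \<alpha> x by (auto simp: p split: prod.splits)
  then obtain j :: nat where j: "\<And>q. q \<in> insert p P \<Longrightarrow> ?d \<alpha> q + of_nat j * ?d x q \<noteq> 0"
    using avoid_affine_zeros[of "insert p P" "?d \<alpha>" "?d x"] insert.hyps(1) by blast
  have "\<sigma> (\<alpha> + of_nat j * x) \<noteq> \<tau> (\<alpha> + of_nat j * x)" if q: "(\<sigma>, \<tau>) \<in> insert p P" for \<sigma> \<tau>
  proof -
    interpret \<sigma>: field_char_0_hom \<sigma> using insert.prems[OF q] embedding_field_hom by blast
    interpret \<tau>: field_char_0_hom \<tau> using insert.prems[OF q] embedding_field_hom by blast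
    show ?thesis using j[OF q] by (simp add: \<sigma>.hom_add \<tau>.hom_add \<sigma>.hom_mult \<tau>.hom_mult
          \<sigma>.hom_of_nat \<tau>.hom_of_nat algebra_simps)
  qed
  then show ?case by blast
qed

text \<open>Nothing is known directly about an element \<open>x\<close> that takes the same value at two embeddings.
  Multiplying a power of \<open>x\<close> by one of finitely many elements makes it generic, and the bounded
  error disappears in the limit of high powers.\<close>

lemma prod_embeddings_ge_1:
  assumes K: "number_field TYPE('k::field_char_0)"
    and x: "algebraic_int (x::'k)" "x \<noteq> 0"
  shows "1 \<le> (\<Prod>\<sigma> | embedding \<sigma>. cmod (\<sigma> x))"
proof (cases "{\<sigma> :: 'k \<Rightarrow> complex. embedding \<sigma>} = {}")
  case True
  then show ?thesis by simp
next
  case False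
  then obtain \<sigma>0 :: "'k \<Rightarrow> complex" where \<sigma>0: "embedding \<sigma>0" by blast
  let ?E = "{\<sigma> :: 'k \<Rightarrow> complex. embedding \<sigma>}"
  define D where "D = {(\<sigma>, \<tau>). \<sigma> \<in> ?E \<and> \<tau> \<in> ?E \<and> \<sigma> \<noteq> \<tau>}"
  have finD: "finite D"
    by (rule finite_subset[of _ "?E \<times> ?E"]) (auto simp: D_def finite_embeddings[OF K])
  obtain \<alpha>0 where \<alpha>0: "\<And>\<sigma> \<tau>. (\<sigma>, \<tau>) \<in> D \<Longrightarrow> \<sigma> \<alpha>0 \<noteq> \<tau> \<alpha>0"
    using embeddings_separated[OF finD] by (auto simp: D_def)
  obtain c :: int where c: "c \<noteq> 0" "algebraic_int (of_int c * \<alpha>0)"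
    by (rule algebraic_imp_algebraic_int_multiple[OF number_field_algebraic[OF K]])
  define \<alpha> where "\<alpha> = of_int c * \<alpha>0"
  have \<alpha>: "\<sigma> \<alpha> \<noteq> \<tau> \<alpha>" if "(\<sigma>, \<tau>) \<in> D" for \<sigma> \<tau>
  proof -
    interpret \<sigma>: field_char_0_hom \<sigma> using that embedding_field_hom by (auto simp: D_def)
    interpret \<tau>: field_char_0_hom \<tau> using that embedding_field_hom by (auto simp: D_def)
    show ?thesis using \<alpha>0[OF that] c(1) by (simp add: \<alpha>_def \<sigma>.hom_mult \<tau>.hom_mult \<sigma>.hom_of_int \<tau>.hom_of_int)
  qed
  \<comment> \<open>The conditions on \<open>j\<close>: a pair asks that its two embeddings differ
    at \<open>x ^ k * (\<alpha> + of_nat j)\<close>, and \<open>None\<close> asks that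
    \<open>\<alpha> + of_nat j\<close> is nonzero.\<close>
  define P where "P = insert None (Some ` D)"
  have finP: "finite P" using finD by (simp add: P_def)
  define N where "N y = (\<Prod>\<sigma>\<in>?E. cmod (\<sigma> y))" for y :: 'k
  have N0: "0 \<le> N y" for y unfolding N_def by (intro prod_nonneg) auto
  have N_mult: "N (y * z) = N y * N z" for y z
    unfolding N_def prod.distrib[symmetric]
    by (rule prod.cong) (auto simp: embedding_def norm_mult)
  have N_1: "N 1 = 1" unfolding N_def by (intro prod.neutral) (auto simp: embedding_def)
  have N_power: "N (y ^ k) = N y ^ k" for y k by (induction k) (auto simp: N_mult N_1)
  \<comment> \<open>As \<open>j\<close> is at most \<open>card P\<close>, this bounds the cost of
    the correcting factor independently of \<open>k\<close>.\<close>
  define C where "C = (\<Sum>j\<le>card P. N (\<alpha> + of_nat j))"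
  have bound: "1 \<le> N x ^ k * C" for k
  proof -
    let ?a = "\<lambda>p. case p of None \<Rightarrow> \<sigma>0 \<alpha> | Some (\<sigma>, \<tau>) \<Rightarrow> \<sigma> x ^ k * \<sigma> \<alpha> - \<tau> x ^ k * \<tau> \<alpha>"
    let ?b = "\<lambda>p. case p of None \<Rightarrow> 1 | Some (\<sigma>, \<tau>) \<Rightarrow> \<sigma> x ^ k - \<tau> x ^ k"
    have "?a p \<noteq> 0 \<or> ?b p \<noteq> 0" if "p \<in> P" for p
    proof (cases p)
      case (Some q)
      obtain \<sigma> \<tau> where q: "q = (\<sigma>, \<tau>)" by (cases q)
      then have D: "(\<sigma>, \<tau>) \<in> D" using that Some by (auto simp: P_def)
      then have "embedding \<tau>" by (auto simp: D_def)
      then interpret \<tau>: field_char_0_hom \<tau> by (rule embedding_field_hom)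
      have "\<tau> x \<noteq> 0" using x(2) by simp
      then show ?thesis using \<alpha>[OF D] by (cases "\<sigma> x ^ k = \<tau> x ^ k") (auto simp: Some q)
    qed simp
    then obtain j where j: "j \<le> card P" "\<And>p. p \<in> P \<Longrightarrow> ?a p + of_nat j * ?b p \<noteq> 0"
      using avoid_affine_zeros[OF finP, of ?a ?b] by blast
    let ?y = "x ^ k * (\<alpha> + of_nat j)"
    have ev: "\<sigma> ?y = \<sigma> x ^ k * (\<sigma> \<alpha> + of_nat j)" if "embedding \<sigma>" for \<sigma>
    proof -
      interpret field_char_0_hom \<sigma> using that by (rule embedding_field_hom)
      show ?thesis by (simp add: hom_distribs)
    qed
    have "inj_on (\<lambda>\<sigma>. \<sigma> ?y) ?E"
    proof (rule inj_onI, rule ccontr)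
      fix \<sigma> \<tau> assume *: "\<sigma> \<in> ?E" "\<tau> \<in> ?E" "\<sigma> ?y = \<tau> ?y" "\<sigma> \<noteq> \<tau>"
      then have "Some (\<sigma>, \<tau>) \<in> P" by (auto simp: P_def D_def)
      moreover have "\<sigma> x ^ k * (\<sigma> \<alpha> + of_nat j) = \<tau> x ^ k * (\<tau> \<alpha> + of_nat j)"
        using *(1-3) by (simp only: mem_Collect_eq ev)
      ultimately show False using j(2)[of "Some (\<sigma>, \<tau>)"] by (simp add: algebra_simps)
    qed
    moreover have "algebraic_int (x ^ k)" for k
      by (induction k) (auto intro: algebraic_int_mult x(1))
    then have "algebraic_int ?y"
      using c(2) by (intro algebraic_int_mult algebraic_int_add) (auto simp: \<alpha>_def)
    moreover have "?y \<noteq> 0"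
    proof
      assume "?y = 0"
      then have "\<alpha> + of_nat j = 0" using x(2) by simp
      moreover interpret field_char_0_hom \<sigma>0 using \<sigma>0 by (rule embedding_field_hom)
      have "\<sigma>0 (\<alpha> + of_nat j) = \<sigma>0 \<alpha> + of_nat j" by (simp add: hom_distribs)
      ultimately show False using j(2)[of None] by (simp add: P_def)
    qed
    ultimately have "1 \<le> N ?y" unfolding N_def by (rule prod_embeddings_ge_1_generic[OF K])
    also have "\<dots> = N x ^ k * N (\<alpha> + of_nat j)" by (simp add: N_mult N_power)
    also have "\<dots> \<le> N x ^ k * C"
      unfolding C_def using j(1) N0 by (intro mult_left_mono member_le_sum zero_le_power) auto
    finally show ?thesis .
  qed
  show ?thesis
  proof (rule ccontr)
    assume "\<not> ?thesis"
    then have N1: "N x < 1" by (simp add: N_def)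
    have C: "C > 0" using bound[of 0] by simp
    then obtain k where "N x ^ k < 1 / C"
      using real_arch_pow_inv[of "1 / C" "N x"] N1 by auto
    then have "N x ^ k * C < 1" using C by (simp add: field_simps)
    then show False using bound[of k] by simp
  qed
qed

section \<open>Local degrees and products over representatives\<close>

definition wt :: "('k::field_char_0 \<Rightarrow> complex) \<Rightarrow> nat" where
  "wt \<sigma> = (if real_embedding \<sigma> then 1 else 2)"

lemma weighted_card_eq_sum:
  assumes "finite S" "\<forall>\<sigma>\<in>S. embedding \<sigma>"
  shows "weighted_card S = (\<Sum>\<sigma>\<in>S. wt \<sigma>)"
proof -
  have S: "S = {\<sigma>\<in>S. real_embedding \<sigma>} \<union> {\<sigma>\<in>S. complex_embedding \<sigma>}"
    using assms(2) by (auto simp: real_embedding_def complex_embedding_def)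
  have "(\<Sum>\<sigma>\<in>S. wt \<sigma>) = (\<Sum>\<sigma>\<in>{\<sigma>\<in>S. real_embedding \<sigma>}. wt \<sigma>) + (\<Sum>\<sigma>\<in>{\<sigma>\<in>S. complex_embedding \<sigma>}. wt \<sigma>)"
    by (subst S, rule sum.union_disjoint)
       (use assms(1) in \<open>auto simp: real_embedding_def complex_embedding_def\<close>)
  also have "(\<Sum>\<sigma>\<in>{\<sigma>\<in>S. real_embedding \<sigma>}. wt \<sigma>) = card {\<sigma>\<in>S. real_embedding \<sigma>}"
    by (simp add: wt_def)
  also have "(\<Sum>\<sigma>\<in>{\<sigma>\<in>S. complex_embedding \<sigma>}. wt \<sigma>) = (\<Sum>\<sigma>\<in>{\<sigma>\<in>S. complex_embedding \<sigma>}. 2)"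
    by (rule sum.cong) (auto simp: wt_def real_embedding_def complex_embedding_def)
  finally show ?thesis by (simp add: weighted_card_def)
qed

lemma embedding_cnj: "embedding \<sigma> \<Longrightarrow> embedding (cnj \<circ> \<sigma>)"
  by (auto simp: embedding_def)

lemma embeddings_eq_UN:
  fixes \<Sigma> :: "('k::field_char_0 \<Rightarrow> complex) set"
  assumes "embedding_representatives \<Sigma>"
  shows "{\<tau>. embedding \<tau>} = (\<Union>\<sigma>\<in>\<Sigma>. {\<sigma>, cnj \<circ> \<sigma>})"
proof (intro equalityI subsetI)
  fix \<tau> :: "'k \<Rightarrow> complex" assume "\<tau> \<in> {\<tau>. embedding \<tau>}"
  then obtain \<sigma> where \<sigma>: "\<sigma> \<in> \<Sigma>" "\<sigma> = \<tau> \<or> \<sigma> = cnj \<circ> \<tau>"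
    using assms unfolding embedding_representatives_def by blast
  then have "\<tau> = \<sigma> \<or> \<tau> = cnj \<circ> \<sigma>" by (auto simp: fun_eq_iff)
  then show "\<tau> \<in> (\<Union>\<sigma>\<in>\<Sigma>. {\<sigma>, cnj \<circ> \<sigma>})" using \<sigma>(1) by auto
next
  fix \<tau> :: "'k \<Rightarrow> complex" assume "\<tau> \<in> (\<Union>\<sigma>\<in>\<Sigma>. {\<sigma>, cnj \<circ> \<sigma>})"
  then show "\<tau> \<in> {\<tau>. embedding \<tau>}"
    using assms embedding_cnj unfolding embedding_representatives_def by auto
qed

text \<open>An embedding is fixed by conjugation exactly if it is real, so \<open>wt\<close> is the
  local degree of the place.\<close>

lemma card_conjugate_pair:
  assumes "embedding \<sigma>"
  shows "card {\<sigma>, cnj \<circ> \<sigma>} = wt \<sigma>"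
proof -
  have "\<sigma> = cnj \<circ> \<sigma> \<longleftrightarrow> (\<forall>x. cnj (\<sigma> x) = \<sigma> x)" by (auto simp: fun_eq_iff)
  also have "\<dots> \<longleftrightarrow> range \<sigma> \<subseteq> \<real>" by (simp add: image_subset_iff Reals_cnj_iff)
  finally show ?thesis using assms by (auto simp: wt_def real_embedding_def card_insert_if)
qed

lemma embedding_pairs_disjoint:
  assumes "embedding_representatives \<Sigma>" "\<sigma> \<in> \<Sigma>" "\<tau> \<in> \<Sigma>" "\<sigma> \<noteq> \<tau>"
  shows "{\<sigma>, cnj \<circ> \<sigma>} \<inter> {\<tau>, cnj \<circ> \<tau>} = {}"
proof (rule ccontr)
  assume "\<not> ?thesis"
  then obtain \<rho> where \<rho>: "\<rho> = \<sigma> \<or> \<rho> = cnj \<circ> \<sigma>" "\<rho> = \<tau> \<or> \<rho> = cnj \<circ> \<tau>" by auto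
  have "embedding \<rho>"
    using \<rho>(1) assms(1,2) embedding_cnj unfolding embedding_representatives_def by auto
  then have "\<exists>!\<eta>. \<eta> \<in> \<Sigma> \<and> (\<eta> = \<rho> \<or> \<eta> = cnj \<circ> \<rho>)"
    using assms(1) unfolding embedding_representatives_def by blast
  moreover have "\<sigma> = \<rho> \<or> \<sigma> = cnj \<circ> \<rho>" "\<tau> = \<rho> \<or> \<tau> = cnj \<circ> \<rho>"
    using \<rho> by (auto simp: fun_eq_iff)
  ultimately show False using assms by blast
qed

lemma finite_representatives:
  assumes "number_field TYPE('k::field_char_0)" "embedding_representatives (\<Sigma> :: ('k \<Rightarrow> complex) set)"
  shows "finite \<Sigma>"
  by (rule finite_subset[OF _ finite_embeddings[OF assms(1)]])
     (use assms(2) in \<open>auto simp: embedding_representatives_def\<close>)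

lemma prod_embeddings_eq_prod_representatives:
  assumes K: "number_field TYPE('k::field_char_0)"
    and \<Sigma>: "embedding_representatives (\<Sigma> :: ('k \<Rightarrow> complex) set)"
    and h: "\<And>\<sigma>. \<sigma> \<in> \<Sigma> \<Longrightarrow> h (cnj \<circ> \<sigma>) = h \<sigma>"
  shows "(\<Prod>\<tau> | embedding \<tau>. h \<tau>) = (\<Prod>\<sigma>\<in>\<Sigma>. (h \<sigma> :: real) ^ wt \<sigma>)"
proof -
  have "(\<Prod>\<tau> | embedding \<tau>. h \<tau>) = (\<Prod>\<sigma>\<in>\<Sigma>. prod h {\<sigma>, cnj \<circ> \<sigma>})"
    unfolding embeddings_eq_UN[OF \<Sigma>]
    by (rule prod.UNION_disjoint) (use finite_representatives[OF K \<Sigma>] embedding_pairs_disjoint[OF \<Sigma>] in auto)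
  also have "\<dots> = (\<Prod>\<sigma>\<in>\<Sigma>. h \<sigma> ^ wt \<sigma>)"
  proof (rule prod.cong[OF refl])
    fix \<sigma> assume \<sigma>: "\<sigma> \<in> \<Sigma>"
    have "prod h {\<sigma>, cnj \<circ> \<sigma>} = (\<Prod>\<tau>\<in>{\<sigma>, cnj \<circ> \<sigma>}. h \<sigma>)"
      by (rule prod.cong) (use h[OF \<sigma>] in auto)
    then show "prod h {\<sigma>, cnj \<circ> \<sigma>} = h \<sigma> ^ wt \<sigma>"
      using card_conjugate_pair[of \<sigma>] \<Sigma> \<sigma> by (simp add: embedding_representatives_def)
  qed
  finally show ?thesis .
qed

lemma card_embeddings_eq_sum_wt:
  assumes K: "number_field TYPE('k::field_char_0)"
    and \<Sigma>: "embedding_representatives (\<Sigma> :: ('k \<Rightarrow> complex) set)"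
  shows "card {\<tau> :: 'k \<Rightarrow> complex. embedding \<tau>} = (\<Sum>\<sigma>\<in>\<Sigma>. wt \<sigma>)"
proof -
  have "card {\<tau> :: 'k \<Rightarrow> complex. embedding \<tau>} = (\<Sum>\<sigma>\<in>\<Sigma>. card {\<sigma>, cnj \<circ> \<sigma>})"
    unfolding embeddings_eq_UN[OF \<Sigma>]
    by (rule card_UN_disjoint) (use finite_representatives[OF K \<Sigma>] embedding_pairs_disjoint[OF \<Sigma>] in auto)
  also have "\<dots> = (\<Sum>\<sigma>\<in>\<Sigma>. wt \<sigma>)"
    using card_conjugate_pair \<Sigma> by (intro sum.cong) (auto simp: embedding_representatives_def)
  finally show ?thesis .
qed

lemma prod_representatives_ge_1:
  assumes "number_field TYPE('k::field_char_0)" "embedding_representatives (\<Sigma> :: ('k \<Rightarrow> complex) set)"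
    and "x \<in> ring_of_integers" "x \<noteq> 0"
  shows "1 \<le> (\<Prod>\<sigma>\<in>\<Sigma>. cmod (\<sigma> x) ^ wt \<sigma>)"
proof -
  have "(\<Prod>\<tau> | embedding \<tau>. cmod (\<tau> x)) = (\<Prod>\<sigma>\<in>\<Sigma>. cmod (\<sigma> x) ^ wt \<sigma>)"
    by (rule prod_embeddings_eq_prod_representatives[OF assms(1,2)]) simp
  then show ?thesis
    using prod_embeddings_ge_1[OF assms(1) _ assms(4)] assms(3) by (simp add: ring_of_integers_def)
qed

lemma sum_wt_eq_degree:
  assumes K: "number_field TYPE('k::field_char_0)" and \<Sigma>: "embedding_representatives (\<Sigma> :: ('k \<Rightarrow> complex) set)"
    and "card {\<sigma> :: 'k \<Rightarrow> complex. real_embedding \<sigma>} = r"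
    and "card {\<sigma> :: 'k \<Rightarrow> complex. complex_embedding \<sigma>} = 2 * s"
  shows "(\<Sum>\<sigma>\<in>\<Sigma>. wt \<sigma>) = r + 2 * s"
proof -
  have E: "{\<sigma> :: 'k \<Rightarrow> complex. embedding \<sigma>} = {\<sigma>. real_embedding \<sigma>} \<union> {\<sigma>. complex_embedding \<sigma>}"
    by (auto simp: real_embedding_def complex_embedding_def)
  have "card {\<sigma> :: 'k \<Rightarrow> complex. embedding \<sigma>} = r + 2 * s"
    using finite_embeddings[OF K] unfolding E assms(3,4)[symmetric]
    by (intro card_Un_disjoint) (auto simp: real_embedding_def complex_embedding_def)
  then show ?thesis
    using card_embeddings_eq_sum_wt[OF K \<Sigma>] by simp
qed

section \<open>Rational points close to a curve\<close>

lemma ring_of_integers_closed: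
  assumes "x \<in> ring_of_integers" "y \<in> ring_of_integers"
  shows "x * y \<in> ring_of_integers" "x + y \<in> ring_of_integers" "x - y \<in> ring_of_integers"
  using assms algebraic_int_mult[of x y] algebraic_int_add[of x y] algebraic_int_add[of x "- y"]
  by (auto simp: ring_of_integers_def)

text \<open>\<open>M\<close> is the set of the embeddings whose coordinate moves along the curve.\<close>

locale diophantine_curve =
  fixes \<Sigma> M :: "('k::field_char_0 \<Rightarrow> complex) set"
    and \<phi> :: "real \<Rightarrow> ('k \<Rightarrow> complex) \<Rightarrow> complex"
  assumes fin\<Sigma>: "finite \<Sigma>" and M\<Sigma>: "M \<subseteq> \<Sigma>"
    and emb: "\<And>\<sigma>. \<sigma> \<in> \<Sigma> \<Longrightarrow> embedding \<sigma>"
    and norm_ge_1: "\<And>x. x \<in> ring_of_integers \<Longrightarrow> x \<noteq> 0 \<Longrightarrow> 1 \<le> (\<Prod>\<sigma>\<in>\<Sigma>. cmod (\<sigma> x) ^ wt \<sigma>)"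
    and moving: "(\<Sum>\<sigma>\<in>\<Sigma> - M. wt \<sigma>) < (\<Sum>\<sigma>\<in>M. wt \<sigma>)"
begin

definition m :: nat where "m = (\<Sum>\<sigma>\<in>M. wt \<sigma>)"
definition n :: nat where "n = (\<Sum>\<sigma>\<in>\<Sigma> - M. wt \<sigma>)"

text \<open>The two inequalities make each moving coordinate bi-Lipschitz on \<open>J\<close>: the
  upper one transfers an approximation to a nearby parameter, the lower one turns closeness to a
  rational point into closeness of parameters.\<close>

definition good :: "real \<Rightarrow> real set \<Rightarrow> bool" where
  "good C J \<longleftrightarrow> 1 \<le> C \<and>
     (\<forall>\<sigma>\<in>M. \<forall>t\<in>J. \<forall>t'\<in>J. cmod (\<phi> t \<sigma> - \<phi> t' \<sigma>) \<le> C * \<bar>t - t'\<bar> \<and>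
                            \<bar>t - t'\<bar> \<le> C * cmod (\<phi> t \<sigma> - \<phi> t' \<sigma>)) \<and>
     (\<forall>\<sigma>\<in>\<Sigma> - M. \<forall>t\<in>J. \<forall>t'\<in>J. \<phi> t \<sigma> = \<phi> t' \<sigma>)"

definition lin :: "'k \<Rightarrow> 'k \<Rightarrow> real \<Rightarrow> ('k \<Rightarrow> complex) \<Rightarrow> real" where
  "lin p q t \<sigma> = cmod (\<sigma> p + \<phi> t \<sigma> * \<sigma> q)"

definition Q :: "'k \<Rightarrow> real" where "Q q = max_norm \<Sigma> (\<lambda>\<sigma>. \<sigma> q)"
definition R :: "'k \<Rightarrow> real" where "R q = max_norm M (\<lambda>\<sigma>. \<sigma> q)"

lemma finM: "finite M" using fin\<Sigma> M\<Sigma> by (rule rev_finite_subset)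

lemma n_less_m: "n < m" using moving by (simp add: m_def n_def)

lemma M_nonempty: "M \<noteq> {}" using moving by auto

lemma \<Sigma>_nonempty: "\<Sigma> \<noteq> {}" using M_nonempty M\<Sigma> by auto

lemma emb_M: "\<sigma> \<in> M \<Longrightarrow> embedding \<sigma>" using emb M\<Sigma> by auto

lemma good_ge_1: "good C J \<Longrightarrow> 1 \<le> C" by (simp add: good_def)

lemma good_subset: "good C J \<Longrightarrow> J' \<subseteq> J \<Longrightarrow> good C J'"
  unfolding good_def by (meson subsetD)

lemma good_upper: "good C J \<Longrightarrow> \<sigma> \<in> M \<Longrightarrow> t \<in> J \<Longrightarrow> t' \<in> J \<Longrightarrow> cmod (\<phi> t \<sigma> - \<phi> t' \<sigma>) \<le> C * \<bar>t - t'\<bar>"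
  and good_lower: "good C J \<Longrightarrow> \<sigma> \<in> M \<Longrightarrow> t \<in> J \<Longrightarrow> t' \<in> J \<Longrightarrow> \<bar>t - t'\<bar> \<le> C * cmod (\<phi> t \<sigma> - \<phi> t' \<sigma>)"
  and good_const: "good C J \<Longrightarrow> \<sigma> \<in> \<Sigma> - M \<Longrightarrow> t \<in> J \<Longrightarrow> t' \<in> J \<Longrightarrow> \<phi> t \<sigma> = \<phi> t' \<sigma>"
  unfolding good_def by blast+

lemma lin_nonneg: "0 \<le> lin p q t \<sigma>" by (simp add: lin_def)

lemma cmod_le_Q: "\<sigma> \<in> \<Sigma> \<Longrightarrow> cmod (\<sigma> q) \<le> Q q"
  unfolding Q_def max_norm_def using fin\<Sigma> by (intro Max_ge) auto

lemma cmod_le_R: "\<sigma> \<in> M \<Longrightarrow> cmod (\<sigma> q) \<le> R q"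
  unfolding R_def max_norm_def using finM by (intro Max_ge) auto

lemma R_attained: "\<exists>\<sigma>\<in>M. cmod (\<sigma> q) = R q"
proof -
  have "R q \<in> (\<lambda>\<sigma>. cmod (\<sigma> q)) ` M"
    unfolding R_def max_norm_def using finM M_nonempty by (intro Max_in) auto
  then show ?thesis by force
qed

lemma R_le_Q: "R q \<le> Q q"
proof -
  obtain \<sigma> where "\<sigma> \<in> M" "cmod (\<sigma> q) = R q" using R_attained by blast
  then show ?thesis using cmod_le_Q[of \<sigma> q] M\<Sigma> by auto
qed

lemma R_nonneg: "0 \<le> R q"
proof -
  obtain \<sigma> where "cmod (\<sigma> q) = R q" using R_attained by blast
  then show ?thesis using norm_ge_zero[of "\<sigma> q"] by simp
qed

lemma max_lin_ge: "\<sigma> \<in> \<Sigma> \<Longrightarrow> lin p q t \<sigma> \<le> max_norm \<Sigma> (\<lambda>\<sigma>. \<sigma> p + \<phi> t \<sigma> * \<sigma> q)"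
  unfolding max_norm_def lin_def using fin\<Sigma> by (intro Max_ge) auto

lemma prod_split: "(\<Prod>\<sigma>\<in>\<Sigma>. h \<sigma>) = (\<Prod>\<sigma>\<in>M. h \<sigma>) * (\<Prod>\<sigma>\<in>\<Sigma> - M. h \<sigma>)" for h :: "_ \<Rightarrow> real"
  using prod.subset_diff[OF M\<Sigma> fin\<Sigma>, of h] by (simp add: mult.commute)

lemma prod_wt_le:
  assumes "\<And>\<sigma>. \<sigma> \<in> M \<Longrightarrow> 0 \<le> h \<sigma> \<and> h \<sigma> \<le> x" "\<And>\<sigma>. \<sigma> \<in> \<Sigma> - M \<Longrightarrow> 0 \<le> h \<sigma> \<and> h \<sigma> \<le> y"
    and "0 \<le> x"
  shows "(\<Prod>\<sigma>\<in>\<Sigma>. h \<sigma> ^ wt \<sigma>) \<le> x ^ m * (y::real) ^ n"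
proof -
  have "(\<Prod>\<sigma>\<in>M. h \<sigma> ^ wt \<sigma>) \<le> (\<Prod>\<sigma>\<in>M. x ^ wt \<sigma>)"
    using assms(1) by (intro prod_mono conjI power_mono zero_le_power) auto
  moreover have "(\<Prod>\<sigma>\<in>\<Sigma> - M. h \<sigma> ^ wt \<sigma>) \<le> (\<Prod>\<sigma>\<in>\<Sigma> - M. y ^ wt \<sigma>)"
    using assms(2) by (intro prod_mono conjI power_mono zero_le_power) auto
  moreover have "0 \<le> (\<Prod>\<sigma>\<in>\<Sigma> - M. h \<sigma> ^ wt \<sigma>)"
    using assms(2) by (intro prod_nonneg zero_le_power) auto
  moreover have "0 \<le> (\<Prod>\<sigma>\<in>M. x ^ wt \<sigma>)" using assms(3) by (intro prod_nonneg) auto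
  ultimately show ?thesis
    unfolding prod_split by (simp add: power_sum m_def n_def mult_mono)
qed

lemma height_ge_1:
  assumes "q \<in> ring_of_integers" "q \<noteq> 0"
  shows "1 \<le> R q ^ m * Q q ^ n"
proof -
  have "1 \<le> (\<Prod>\<sigma>\<in>\<Sigma>. cmod (\<sigma> q) ^ wt \<sigma>)" using norm_ge_1[OF assms] .
  also have "\<dots> \<le> R q ^ m * Q q ^ n"
    by (intro prod_wt_le) (auto simp: cmod_le_R cmod_le_Q R_nonneg)
  finally show ?thesis .
qed

lemma R_pos:
  assumes "q \<in> ring_of_integers" "q \<noteq> 0"
  shows "0 < R q"
proof -
  have "R q \<noteq> 0" using height_ge_1[OF assms] n_less_m by (auto simp: power_0_left)
  then show ?thesis using R_nonneg[of q] by simp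
qed

lemma Q_pos:
  assumes "q \<in> ring_of_integers" "q \<noteq> 0"
  shows "0 < Q q"
  using R_pos[OF assms] R_le_Q[of q] by simp

lemma Q_ge_1:
  assumes "q \<in> ring_of_integers" "q \<noteq> 0"
  shows "1 \<le> Q q"
proof (rule ccontr)
  assume "\<not> ?thesis"
  then have Q1: "Q q < 1" by simp
  have "R q ^ m * Q q ^ n \<le> Q q ^ m * Q q ^ n"
    using R_le_Q R_nonneg Q_pos[OF assms] by (intro mult_right_mono power_mono) auto
  also have "\<dots> = Q q ^ (m + n)" by (simp add: power_add)
  also have "\<dots> < 1" using power_strict_decreasing[of 0 "m + n" "Q q"] Q1 Q_pos[OF assms] n_less_m by simp
  finally show False using height_ge_1[OF assms] by simp
qed

text \<open>Multiply \<open>Q q ^ (m - n)\<close>, which is at least \<open>Q q\<close> because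
  \<open>n < m\<close>, by the bound of \<open>height_ge_1\<close>. Bounded complexity thus bounds
  \<open>Q q\<close> itself.\<close>

lemma Q_le_power_QR:
  assumes "q \<in> ring_of_integers" "q \<noteq> 0"
  shows "Q q \<le> (Q q * R q) ^ m"
proof -
  have "Q q ^ 1 \<le> Q q ^ (m - n)" using Q_ge_1[OF assms] n_less_m by (intro power_increasing) auto
  also have "\<dots> \<le> Q q ^ (m - n) * (R q ^ m * Q q ^ n)"
    using height_ge_1[OF assms] Q_pos[OF assms] by simp
  also have "\<dots> = (Q q ^ (m - n) * Q q ^ n) * R q ^ m" by simp
  also have "Q q ^ (m - n) * Q q ^ n = Q q ^ m" using n_less_m by (simp flip: power_add)
  finally show ?thesis by (simp add: power_mult_distrib)
qed

lemma QR_ge_1: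
  assumes "q \<in> ring_of_integers" "q \<noteq> 0"
  shows "1 \<le> Q q * R q"
proof (rule ccontr)
  assume *: "\<not> ?thesis"
  then have "(Q q * R q) ^ m \<le> Q q * R q"
    using n_less_m Q_pos[OF assms] R_nonneg[of q] power_decreasing[of 1 m "Q q * R q"] by auto
  then show False using Q_le_power_QR[OF assms] Q_ge_1[OF assms] * by linarith
qed

lemma cmod_cross_le:
  assumes "embedding \<sigma>"
  shows "cmod (\<sigma> (p * q' - p' * q)) \<le> lin p q t \<sigma> * cmod (\<sigma> q') + lin p' q' t \<sigma> * cmod (\<sigma> q)"
proof -
  interpret field_char_0_hom \<sigma> using assms by (rule embedding_field_hom)
  have "\<sigma> (p * q' - p' * q) = (\<sigma> p + \<phi> t \<sigma> * \<sigma> q) * \<sigma> q' - (\<sigma> p' + \<phi> t \<sigma> * \<sigma> q') * \<sigma> q"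
    by (simp add: hom_distribs algebra_simps)
  then show ?thesis unfolding lin_def by (metis norm_mult norm_triangle_ineq4)
qed

text \<open>At the moving places the determinant is at most \<open>A\<close> times the sum of the
  two complexities over \<open>Q q * Q q'\<close>. The lower end of the window and
  \<open>R q \<le> Q q\<close> bound both complexities by \<open>Q q ^ 2 / \<beta>\<close>, which
  turns this into \<open>\<theta> * x\<close>. At the stationary places only \<open>1 / x\<close> is
  available, and \<open>n < m\<close> decides.\<close>

lemma proportional_aux:
  assumes q: "p \<in> ring_of_integers" "q \<in> ring_of_integers" "q \<noteq> 0"
    and q': "p' \<in> ring_of_integers" "q' \<in> ring_of_integers" "q' \<noteq> 0"
    and pos: "\<rho> > 0" "\<beta> > 0" "0 \<le> A" "0 \<le> c" and small: "2 * A < \<beta>" "2 * c \<le> 1"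
    and QR: "\<beta> * c \<le> Q q * R q * \<rho>" "Q q * R q * \<rho> \<le> c" "Q q' * R q' * \<rho> \<le> c"
    and mov: "\<And>\<sigma>. \<sigma> \<in> M \<Longrightarrow> lin p q t \<sigma> \<le> A / Q q \<and> lin p' q' t \<sigma> \<le> A / Q q'"
    and stat: "\<And>\<sigma>. \<sigma> \<in> \<Sigma> - M \<Longrightarrow> lin p q t \<sigma> \<le> c / Q q \<and> lin p' q' t \<sigma> \<le> c / Q q'"
    and le: "Q q \<le> Q q'"
  shows "p * q' = p' * q"
proof (rule ccontr)
  assume "p * q' \<noteq> p' * q"
  then have nz: "p * q' - p' * q \<noteq> 0" by simp
  have int: "p * q' - p' * q \<in> ring_of_integers" using q q' by (intro ring_of_integers_closed)
  have Q: "Q q > 0" "Q q' > 0" using Q_pos q q' by auto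
  define \<theta> where "\<theta> = 2 * A / \<beta>"
  define x where "x = Q q / Q q'"
  have \<theta>: "0 \<le> \<theta>" "\<theta> < 1" using small pos by (auto simp: \<theta>_def)
  have x: "0 < x" "x \<le> 1" using Q le by (auto simp: x_def)
  have sq: "c / \<rho> \<le> Q q * Q q / \<beta>"
  proof -
    have "Q q * R q * \<rho> \<le> Q q * Q q * \<rho>"
      using R_le_Q[of q] Q pos by (intro mult_right_mono mult_left_mono) auto
    then have "\<beta> * c \<le> Q q * Q q * \<rho>" using QR(1) by simp
    then show ?thesis using pos by (simp add: field_simps)
  qed
  have 1: "cmod (\<sigma> (p * q' - p' * q)) \<le> \<theta> * x" if \<sigma>: "\<sigma> \<in> M" for \<sigma>
  proof -
    have "cmod (\<sigma> (p * q' - p' * q)) \<le> lin p q t \<sigma> * cmod (\<sigma> q') + lin p' q' t \<sigma> * cmod (\<sigma> q)"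
      using cmod_cross_le emb_M[OF \<sigma>] .
    also have "\<dots> \<le> A / Q q * R q' + A / Q q' * R q"
      using mov[OF \<sigma>] cmod_le_R[OF \<sigma>] pos Q lin_nonneg by (intro add_mono mult_mono) auto
    also have "\<dots> = A * (Q q' * R q' + Q q * R q) / (Q q * Q q')"
      using Q by (simp add: field_simps)
    also have "\<dots> \<le> A * (2 * (Q q * Q q / \<beta>)) / (Q q * Q q')"
    proof (intro divide_right_mono mult_left_mono)
      have "Q q' * R q' \<le> c / \<rho>" "Q q * R q \<le> c / \<rho>" using QR pos by (auto simp: field_simps)
      then show "Q q' * R q' + Q q * R q \<le> 2 * (Q q * Q q / \<beta>)" using sq by linarith
    qed (use pos Q in auto)
    also have "\<dots> = \<theta> * x" using Q pos by (simp add: \<theta>_def x_def field_simps)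
    finally show ?thesis .
  qed
  have 2: "cmod (\<sigma> (p * q' - p' * q)) \<le> 1 / x" if \<sigma>: "\<sigma> \<in> \<Sigma> - M" for \<sigma>
  proof -
    have "cmod (\<sigma> (p * q' - p' * q)) \<le> lin p q t \<sigma> * cmod (\<sigma> q') + lin p' q' t \<sigma> * cmod (\<sigma> q)"
      using cmod_cross_le emb \<sigma> by blast
    also have "\<dots> \<le> c / Q q * Q q' + c / Q q' * Q q"
      using stat[OF \<sigma>] cmod_le_Q \<sigma> pos Q lin_nonneg by (intro add_mono mult_mono) auto
    also have "\<dots> = c * (1 / x) + c * x" by (simp add: x_def)
    also have "\<dots> \<le> c * (1 / x) + c * (1 / x)"
      using x pos by (intro add_left_mono mult_left_mono) (auto simp: field_simps mult_le_one)
    also have "\<dots> = (2 * c) * (1 / x)" by simp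
    also have "\<dots> \<le> 1 * (1 / x)" using small x by (intro mult_right_mono) auto
    finally show ?thesis by simp
  qed
  have "1 \<le> (\<Prod>\<sigma>\<in>\<Sigma>. cmod (\<sigma> (p * q' - p' * q)) ^ wt \<sigma>)" by (rule norm_ge_1[OF int nz])
  also have "\<dots> \<le> (\<theta> * x) ^ m * (1 / x) ^ n"
    using 1 2 \<theta> x by (intro prod_wt_le) auto
  also have "\<dots> = \<theta> ^ m * x ^ (m - n)"
    using n_less_m x by (simp add: power_mult_distrib power_diff power_divide)
  also have "\<dots> \<le> \<theta> ^ m * 1" using x \<theta> by (intro mult_left_mono power_le_one) auto
  also have "\<dots> < 1" using \<theta> n_less_m power_strict_mono[of \<theta> 1 m] by simp
  finally show False by simp
qed

text \<open>Two rational approximations of comparable complexity \<open>Q q * R q\<close> close to points of the same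
  short piece of the curve are proportional: the norm of their determinant is less than 1.\<close>

lemma proportional:
  assumes good: "good C J" and t: "t \<in> J" "t' \<in> J" "\<bar>t - t'\<bar> \<le> \<rho>"
    and q: "p \<in> ring_of_integers" "q \<in> ring_of_integers" "q \<noteq> 0"
    and q': "p' \<in> ring_of_integers" "q' \<in> ring_of_integers" "q' \<noteq> 0"
    and pos: "\<rho> > 0" "\<beta> > 0" "0 \<le> c" and small: "4 * C * c < \<beta>" "2 * c \<le> 1"
    and QR: "\<beta> * c \<le> Q q * R q * \<rho>" "Q q * R q * \<rho> \<le> c"
      "\<beta> * c \<le> Q q' * R q' * \<rho>" "Q q' * R q' * \<rho> \<le> c"
    and lin: "\<And>\<sigma>. \<sigma> \<in> \<Sigma> \<Longrightarrow> lin p q t \<sigma> \<le> c / Q q" "\<And>\<sigma>. \<sigma> \<in> \<Sigma> \<Longrightarrow> lin p' q' t' \<sigma> \<le> c / Q q'"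
  shows "p * q' = p' * q"
proof -
  \<comment> \<open>Moving the second approximation from \<open>t'\<close> to \<open>t\<close> costs
    \<open>C * \<rho> * R q'\<close>, at most \<open>C * c / Q q'\<close> by the window; added to
    the original \<open>c / Q q'\<close> this stays below \<open>2 * C * c / Q q'\<close>.\<close>
  define A where "A = 2 * C * c"
  have C: "1 \<le> C" using good by (rule good_ge_1)
  have A: "0 \<le> A" "2 * A < \<beta>" using C pos small by (auto simp: A_def)
  have Q: "Q q > 0" "Q q' > 0" using Q_pos q q' by auto
  have cA: "c \<le> A"
  proof -
    have "1 * c \<le> (2 * C) * c" using C pos by (intro mult_right_mono) auto
    then show ?thesis by (simp add: A_def)
  qed
  have mov: "lin p q t \<sigma> \<le> A / Q q \<and> lin p' q' t \<sigma> \<le> A / Q q'" if \<sigma>: "\<sigma> \<in> M" for \<sigma>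
  proof
    have "lin p q t \<sigma> \<le> c / Q q" using lin(1) \<sigma> M\<Sigma> by auto
    also have "\<dots> \<le> A / Q q" using cA Q by (simp add: divide_right_mono)
    finally show "lin p q t \<sigma> \<le> A / Q q" .
    have "\<sigma> p' + \<phi> t \<sigma> * \<sigma> q' = (\<sigma> p' + \<phi> t' \<sigma> * \<sigma> q') + (\<phi> t \<sigma> - \<phi> t' \<sigma>) * \<sigma> q'"
      by (simp add: algebra_simps)
    then have "lin p' q' t \<sigma> \<le> lin p' q' t' \<sigma> + cmod (\<phi> t \<sigma> - \<phi> t' \<sigma>) * cmod (\<sigma> q')"
      unfolding lin_def by (metis norm_mult norm_triangle_ineq)
    also have "\<dots> \<le> c / Q q' + (C * \<rho>) * R q'"
    proof (intro add_mono mult_mono)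
      show "lin p' q' t' \<sigma> \<le> c / Q q'" using lin(2) \<sigma> M\<Sigma> by auto
      have "cmod (\<phi> t \<sigma> - \<phi> t' \<sigma>) \<le> C * \<bar>t - t'\<bar>" using good_upper[OF good \<sigma> t(1,2)] .
      also have "\<dots> \<le> C * \<rho>" using C t(3) by (intro mult_left_mono) auto
      finally show "cmod (\<phi> t \<sigma> - \<phi> t' \<sigma>) \<le> C * \<rho>" .
    qed (use cmod_le_R[OF \<sigma>] C pos in auto)
    also have "(C * \<rho>) * R q' = C * (Q q' * R q' * \<rho>) / Q q'" using Q by simp
    also have "\<dots> \<le> C * c / Q q'" using QR(4) C Q by (intro divide_right_mono mult_left_mono) auto
    also have "c / Q q' \<le> C * c / Q q'" using C pos Q by (intro divide_right_mono) (auto simp: mult_le_cancel_right1)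
    finally show "lin p' q' t \<sigma> \<le> A / Q q'" by (simp add: A_def add_divide_distrib[symmetric])
  qed
  have stat: "lin p q t \<sigma> \<le> c / Q q \<and> lin p' q' t \<sigma> \<le> c / Q q'" if \<sigma>: "\<sigma> \<in> \<Sigma> - M" for \<sigma>
  proof -
    have "lin p' q' t \<sigma> = lin p' q' t' \<sigma>" using good_const[OF good \<sigma> t(1,2)] by (simp add: lin_def)
    then show ?thesis using lin \<sigma> by auto
  qed
  show ?thesis
  \<comment> \<open>\<open>proportional_aux\<close> wants the smaller denominator first; it uses the
    lower end of the window for that one only.\<close>
  proof (cases "Q q \<le> Q q'")
    case True
    show ?thesis
      by (rule proportional_aux[OF q q' pos(1,2) A(1) pos(3) A(2) small(2) QR(1,2,4) mov stat True])
  next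
    case False
    have "p' * q = p * q'"
      by (rule proportional_aux[OF q' q pos(1,2) A(1) pos(3) A(2) small(2) QR(3,4,2)])
         (use mov stat False in auto)
    then show ?thesis by simp
  qed
qed

text \<open>The window for complexity times \<rho> has ratio \<beta>, matching the step between
  consecutive scales: the contraction of one round in the game, 1 / 2 for dyadic classes. The bound
  \<open>c\<close> is what forces approximations to coincide, \<epsilon> is the precision to be
  excluded.\<close>

definition bad :: "real \<Rightarrow> real \<Rightarrow> real \<Rightarrow> real \<Rightarrow> real \<Rightarrow> bool" where
  "bad \<beta> c \<epsilon> \<rho> t \<longleftrightarrow> (\<exists>p q. p \<in> ring_of_integers \<and> q \<in> ring_of_integers \<and> q \<noteq> 0 \<and>
     \<beta> * c \<le> Q q * R q * \<rho> \<and> Q q * R q * \<rho> \<le> c \<and> (\<forall>\<sigma>\<in>\<Sigma>. lin p q t \<sigma> \<le> \<epsilon> / Q q))"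

text \<open>By \<open>proportional\<close> all approximations responsible for \<open>S\<close> are
  the same point \<open>z\<close>. The place where \<open>R q\<close> is attained depends on
  \<open>q\<close>, hence one short set for each moving place: there the coordinate of a bad
  parameter is within \<open>\<epsilon> / (Q q * R q)\<close> of
  \<open>- \<sigma> z\<close>.\<close>

lemma bad_set_covered:
  assumes good: "good C J" and S: "S \<subseteq> J" "\<And>t t'. t \<in> S \<Longrightarrow> t' \<in> S \<Longrightarrow> \<bar>t - t'\<bar> \<le> \<rho>"
    and pos: "\<rho> > 0" "\<beta> > 0" "0 < c" and small: "4 * C * c < \<beta>" "2 * c \<le> 1" "\<epsilon> \<le> c" "0 \<le> \<epsilon>"
  shows "\<exists>D. {t \<in> S. bad \<beta> c \<epsilon> \<rho> t} \<subseteq> (\<Union>\<sigma>\<in>M. D \<sigma>) \<and>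
    (\<forall>\<sigma>\<in>M. D \<sigma> \<subseteq> S \<and> (\<forall>t\<in>D \<sigma>. \<forall>t'\<in>D \<sigma>. \<bar>t - t'\<bar> \<le> 2 * C * (\<epsilon> * \<rho> / (\<beta> * c))))"
proof (cases "{t \<in> S. bad \<beta> c \<epsilon> \<rho> t} = {}")
  case True
  show ?thesis unfolding True by (rule exI[of _ "\<lambda>_. {}"]) simp
next
  case False
  define \<delta> where "\<delta> = \<epsilon> * \<rho> / (\<beta> * c)"
  obtain t0 p0 q0 where t0: "t0 \<in> S" and q0: "p0 \<in> ring_of_integers" "q0 \<in> ring_of_integers" "q0 \<noteq> 0"
    "\<beta> * c \<le> Q q0 * R q0 * \<rho>" "Q q0 * R q0 * \<rho> \<le> c" "\<And>\<sigma>. \<sigma> \<in> \<Sigma> \<Longrightarrow> lin p0 q0 t0 \<sigma> \<le> \<epsilon> / Q q0"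
    using False unfolding bad_def by blast
  define z where "z = p0 / q0"
  define D where "D = (\<lambda>\<sigma>. {t \<in> S. cmod (\<phi> t \<sigma> + \<sigma> z) \<le> \<delta>})"
  have weaken: "y / Q q \<le> c / Q q" if "q \<in> ring_of_integers" "q \<noteq> 0" "y \<le> c" for q y
    using that Q_pos[of q] by (intro divide_right_mono) auto
  have "\<exists>\<sigma>\<in>M. t \<in> D \<sigma>" if t: "t \<in> S" "bad \<beta> c \<epsilon> \<rho> t" for t
  proof -
    obtain p q where q: "p \<in> ring_of_integers" "q \<in> ring_of_integers" "q \<noteq> 0"
      "\<beta> * c \<le> Q q * R q * \<rho>" "Q q * R q * \<rho> \<le> c" "\<And>\<sigma>. \<sigma> \<in> \<Sigma> \<Longrightarrow> lin p q t \<sigma> \<le> \<epsilon> / Q q"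
      using t(2) unfolding bad_def by blast
    have "p * q0 = p0 * q"
    proof (rule proportional[OF good _ _ _ q(1-3) q0(1-3) pos(1,2) _ small(1,2) q(4,5) q0(4,5)])
      show "lin p q t \<sigma> \<le> c / Q q" if "\<sigma> \<in> \<Sigma>" for \<sigma>
        using q(6)[OF that] weaken[OF q(2,3) small(3)] by linarith
      show "lin p0 q0 t0 \<sigma> \<le> c / Q q0" if "\<sigma> \<in> \<Sigma>" for \<sigma>
        using q0(6)[OF that] weaken[OF q0(2,3) small(3)] by linarith
    qed (use t t0 S pos in auto)
    then have p: "p = z * q" using q0(3) by (simp add: z_def field_simps)
    obtain \<sigma> where \<sigma>: "\<sigma> \<in> M" "cmod (\<sigma> q) = R q" using R_attained by blast
    interpret field_char_0_hom \<sigma> using emb_M[OF \<sigma>(1)] by (rule embedding_field_hom)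
    have "lin p q t \<sigma> = cmod (\<phi> t \<sigma> + \<sigma> z) * R q"
      unfolding lin_def p \<sigma>(2)[symmetric] norm_mult[symmetric] by (simp add: hom_mult algebra_simps)
    then have "cmod (\<phi> t \<sigma> + \<sigma> z) * R q \<le> \<epsilon> / Q q" using q(6)[of \<sigma>] \<sigma>(1) M\<Sigma> by auto
    then have "cmod (\<phi> t \<sigma> + \<sigma> z) \<le> \<epsilon> / (Q q * R q)"
      using Q_pos[OF q(2,3)] R_pos[OF q(2,3)] by (simp add: field_simps)
    also have "\<dots> = \<epsilon> * \<rho> / (Q q * R q * \<rho>)" using pos by simp
    also have "\<dots> \<le> \<delta>" unfolding \<delta>_def
      using q(4) pos small Q_pos[OF q(2,3)] R_pos[OF q(2,3)] by (intro divide_left_mono mult_pos_pos) auto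
    finally show ?thesis using \<sigma>(1) t(1) by (auto simp: D_def)
  qed
  moreover have "\<bar>t - t'\<bar> \<le> 2 * C * \<delta>" if "\<sigma> \<in> M" "t \<in> D \<sigma>" "t' \<in> D \<sigma>" for \<sigma> t t'
  proof -
    have C: "1 \<le> C" using good by (rule good_ge_1)
    have "\<bar>t - t'\<bar> \<le> C * cmod (\<phi> t \<sigma> - \<phi> t' \<sigma>)"
      using good_lower[OF good that(1)] that S(1) by (auto simp: D_def)
    also have "\<phi> t \<sigma> - \<phi> t' \<sigma> = (\<phi> t \<sigma> + \<sigma> z) - (\<phi> t' \<sigma> + \<sigma> z)" by simp
    also have "C * cmod \<dots> \<le> C * (\<delta> + \<delta>)"
      using that C by (intro mult_left_mono order_trans[OF norm_triangle_ineq4] add_mono) (auto simp: D_def)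
    finally show ?thesis by simp
  qed
  moreover have "D \<sigma> \<subseteq> S" for \<sigma> by (auto simp: D_def)
  ultimately show ?thesis unfolding \<delta>_def[symmetric] by (intro exI[of _ D]) auto
qed

end

section \<open>The modified Schmidt game\<close>

lemma legal_move_Icc:
  fixes x y :: real
  assumes "x \<le> y"
  shows "legal_move \<kappa> t {x..y} Y \<longleftrightarrow>
    (\<exists>z. Y = {z..z + exp (- (\<kappa> * t)) * (y - x)} \<and> x \<le> z \<and> z + exp (- (\<kappa> * t)) * (y - x) \<le> y)"
proof -
  define e where "e = exp (- (\<kappa> * t))"
  have e: "e > 0" by (simp add: e_def)
  have img: "(\<lambda>w. contraction \<kappa> t w + c) ` {x..y} = {e * x + c..e * x + c + e * (y - x)}" for c
  proof -
    have "(\<lambda>w. contraction \<kappa> t w + c) ` {x..y} = (\<lambda>w. e * w + c) ` {x..y}"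
      by (simp add: contraction_def e_def)
    also have "\<dots> = {e * x + c..e * y + c}"
      using e assms by (simp add: image_affinity_atLeastAtMost)
    finally show ?thesis by (simp add: algebra_simps)
  qed
  show ?thesis
  proof
    assume "legal_move \<kappa> t {x..y} Y"
    then obtain c where "Y \<subseteq> {x..y}" "Y = {e * x + c..e * x + c + e * (y - x)}"
      unfolding legal_move_def img by blast
    then show "\<exists>z. Y = {z..z + exp (- (\<kappa> * t)) * (y - x)} \<and> x \<le> z \<and> z + exp (- (\<kappa> * t)) * (y - x) \<le> y"
      using assms e unfolding e_def[symmetric]
      by (intro exI[of _ "e * x + c"]) (simp add: atLeastatMost_subset_iff)
  next
    assume "\<exists>z. Y = {z..z + exp (- (\<kappa> * t)) * (y - x)} \<and> x \<le> z \<and> z + exp (- (\<kappa> * t)) * (y - x) \<le> y"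
    then obtain z where z: "Y = {z..z + e * (y - x)}" "x \<le> z" "z + e * (y - x) \<le> y"
      unfolding e_def by blast
    then have "Y = (\<lambda>w. contraction \<kappa> t w + (z - e * x)) ` {x..y}" unfolding img by simp
    moreover have "Y \<subseteq> {x..y}" using z by auto
    ultimately show "legal_move \<kappa> t {x..y} Y" unfolding legal_move_def by blast
  qed
qed

text \<open>Among \<open>k + 1\<close> separated candidates, each of the \<open>k\<close> short sets meets at most one.\<close>

lemma avoid_short_sets:
  fixes x y :: real
  assumes xy: "x < y" and I: "finite I" "card I \<le> k" and h: "h = (y - x) / (2 * real k + 1)"
    and D: "\<And>i t t'. i \<in> I \<Longrightarrow> t \<in> D i \<Longrightarrow> t' \<in> D i \<Longrightarrow> \<bar>t - t'\<bar> < h"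
  shows "\<exists>z\<ge>x. z + h \<le> y \<and> {z..z + h} \<inter> (\<Union>i\<in>I. D i) = {}"
proof (rule ccontr)
  assume contr: "\<not> ?thesis"
  have h0: "h > 0" using xy h by simp
  have hk: "(2 * real k + 1) * h = y - x" using h by simp
  \<comment> \<open>The \<open>k + 1\<close> candidates of length \<open>h\<close> are separated by
    \<open>k\<close> gaps of the same length; together they fill the interval.\<close>
  define J where "J j = {x + 2 * real j * h..x + 2 * real j * h + h}" for j :: nat
  have "\<exists>i\<in>I. J j \<inter> D i \<noteq> {}" if j: "j \<le> k" for j
  proof -
    have "(2 * real j + 1) * h \<le> (2 * real k + 1) * h" using j h0 by (intro mult_right_mono) auto
    then have "x + 2 * real j * h + h \<le> y" using hk by (simp add: algebra_simps)
    moreover have "x \<le> x + 2 * real j * h" using h0 by simp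
    ultimately have "J j \<inter> (\<Union>i\<in>I. D i) \<noteq> {}" using contr unfolding J_def by blast
    then show ?thesis by blast
  qed
  then obtain f where f: "\<And>j. j \<le> k \<Longrightarrow> f j \<in> I \<and> J j \<inter> D (f j) \<noteq> {}" by metis
  have less: "f i \<noteq> f j" if less: "i < j" "j \<le> k" for i j
  proof
    assume eq: "f i = f j"
    have ij: "i \<le> k" using less by simp
    obtain t where t: "t \<in> J i" "t \<in> D (f i)" using f[OF ij] by blast
    obtain t' where t': "t' \<in> J j" "t' \<in> D (f i)" using f[OF less(2)] eq by auto
    have "(2 * real i + 2) * h \<le> (2 * real j) * h" using less h0 by (intro mult_right_mono) auto
    then have "\<bar>t - t'\<bar> \<ge> h" using t(1) t'(1) by (simp add: J_def algebra_simps)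
    then show False using D[OF _ t(2) t'(2)] f[OF ij] by auto
  qed
  have "inj_on f {..k}"
    by (rule inj_onI) (metis less atMost_iff linorder_neqE_nat)
  then have "card {..k} \<le> card I" using f I(1) by (intro card_inj_on_le[of f]) auto
  then show False using I(2) by simp
qed

text \<open>\<open>F\<close> sees the whole history of Bob's moves, so the forbidden set may use
  constants fixed by an earlier interval.\<close>

definition avoiding_strategy :: "real \<Rightarrow> real \<Rightarrow> (real set list \<Rightarrow> real set) \<Rightarrow> real set list \<Rightarrow> real set" where
  "avoiding_strategy \<kappa> a F Bs = (SOME Y. legal_move \<kappa> a (last Bs) Y \<and> Y \<inter> F Bs = {})"

lemma avoiding_strategy:
  assumes "\<exists>Y. legal_move \<kappa> a (last Bs) Y \<and> Y \<inter> F Bs = {}"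
  shows "legal_move \<kappa> a (last Bs) (avoiding_strategy \<kappa> a F Bs)" "avoiding_strategy \<kappa> a F Bs \<inter> F Bs = {}"
  using someI_ex[OF assms] unfolding avoiding_strategy_def by auto

text \<open>Separates the bookkeeping of the game from the mathematics: it must be possible to avoid
  \<open>F\<close> after any nested history, and a point avoiding \<open>F\<close> in all rounds
  must lie in \<open>S\<close>. The geometry of the play is supplied to both tasks.\<close>

lemma ab_winning_avoiding:
  fixes l u :: real
  assumes pos: "\<kappa> > 0" "a > 0" "b > 0" and lu: "l < u"
    and exist: "\<And>Bs k x y. x < y \<Longrightarrow> {x..y} \<subseteq> {l..u} \<Longrightarrow> Bs k = {x..y} \<Longrightarrow>
      (\<And>i. i < k \<Longrightarrow> {x..y} \<subseteq> Bs i \<and> Bs i \<subseteq> {l..u}) \<Longrightarrow>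
      \<exists>Y. legal_move \<kappa> a {x..y} Y \<and> Y \<inter> F (map Bs [0..<Suc k]) = {}"
    and win: "\<And>Bs A x y t. (\<And>k. Bs k = {x k..y k}) \<Longrightarrow> (\<And>k. x k < y k) \<Longrightarrow> {x 0..y 0} \<subseteq> {l..u} \<Longrightarrow>
      (\<And>k. y (Suc k) - x (Suc k) = exp (- (\<kappa> * a)) * exp (- (\<kappa> * b)) * (y k - x k)) \<Longrightarrow>
      (\<And>k. Bs (Suc k) \<subseteq> Bs k) \<Longrightarrow>
      (\<And>k. A k \<inter> F (map Bs [0..<Suc k]) = {}) \<Longrightarrow> (\<And>k. A k \<subseteq> Bs k) \<Longrightarrow> (\<And>k. t \<in> A k) \<Longrightarrow> t \<in> S"
  shows "ab_winning \<kappa> {l..u} a b S"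
proof -
  define st where "st = avoiding_strategy \<kappa> a F"
  define ea where "ea = exp (- (\<kappa> * a))"
  define eb where "eb = exp (- (\<kappa> * b))"
  have e: "0 < ea" "ea < 1" "0 < eb" "eb < 1" using pos by (auto simp: ea_def eb_def)
  \<comment> \<open>That Bob's intervals are nondegenerate and that Alice's replies are legal is
    proved in one induction, since Bob's next interval is known only as a legal move inside her
    reply.\<close>
  have step: "\<exists>x y. x < y \<and> {x..y} \<subseteq> {l..u} \<and> Bs n = {x..y} \<and> (\<forall>i<n. {x..y} \<subseteq> Bs i \<and> Bs i \<subseteq> {l..u}) \<and>
      legal_move \<kappa> a (Bs n) (alice_move st Bs n) \<and>
      alice_move st Bs n \<inter> F (map Bs [0..<Suc n]) = {}"
    if "\<forall>k\<le>n. bob_legal \<kappa> {l..u} b st Bs k" for Bs n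
    using that
  proof (induction n)
    case 0
    then obtain t0 where t0: "t0 > 0" "legal_move \<kappa> t0 {l..u} (Bs 0)" by auto
    then obtain z where z: "Bs 0 = {z..z + exp (- (\<kappa> * t0)) * (u - l)}" "l \<le> z"
        "z + exp (- (\<kappa> * t0)) * (u - l) \<le> u"
      using legal_move_Icc[of l u] lu by auto
    have "\<exists>x y. x < y \<and> {x..y} \<subseteq> {l..u} \<and> Bs 0 = {x..y}"
      using z lu by (intro exI[of _ z] exI[of _ "z + exp (- (\<kappa> * t0)) * (u - l)"]) auto
    then obtain x y where xy: "x < y" "{x..y} \<subseteq> {l..u}" "Bs 0 = {x..y}" by blast
    have "\<exists>Y. legal_move \<kappa> a (last (map Bs [0..<Suc 0])) Y \<and> Y \<inter> F (map Bs [0..<Suc 0]) = {}"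
      using exist[OF xy(1,2), of Bs 0] xy(3) by simp
    from avoiding_strategy[where Bs = "map Bs [0..<Suc 0]" and F = F, OF this] show ?case
      using xy by (intro exI[of _ x] exI[of _ y]) (simp add: alice_move_def st_def)
  next
    case (Suc n)
    from Suc.IH Suc.prems obtain x y where xy: "x < y" "{x..y} \<subseteq> {l..u}" "Bs n = {x..y}"
      "\<forall>i<n. {x..y} \<subseteq> Bs i \<and> Bs i \<subseteq> {l..u}" "legal_move \<kappa> a {x..y} (alice_move st Bs n)" by fastforce
    then obtain z where z: "alice_move st Bs n = {z..z + ea * (y - x)}" "x \<le> z" "z + ea * (y - x) \<le> y"
      using legal_move_Icc[of x y] unfolding ea_def by auto
    have zz: "z < z + ea * (y - x)" using e xy by simp
    have "legal_move \<kappa> b (alice_move st Bs n) (Bs (Suc n))" using Suc.prems by auto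
    then obtain w where w: "Bs (Suc n) = {w..w + eb * (z + ea * (y - x) - z)}" "z \<le> w"
      "w + eb * (z + ea * (y - x) - z) \<le> z + ea * (y - x)"
      using legal_move_Icc[of z "z + ea * (y - x)" \<kappa> b "Bs (Suc n)"] zz unfolding z(1) eb_def by auto
    define w' where "w' = w + eb * (z + ea * (y - x) - z)"
    have ww: "w < w'" "{w..w'} \<subseteq> {x..y}" "Bs (Suc n) = {w..w'}" "{w..w'} \<subseteq> {l..u}"
      using w z xy e by (auto simp: w'_def)
    have sub: "{w..w'} \<subseteq> Bs i \<and> Bs i \<subseteq> {l..u}" if "i < Suc n" for i
      using that ww(2) xy(2,3,4) by (cases "i = n") (fastforce simp: less_Suc_eq)+
    have "\<exists>Y. legal_move \<kappa> a (last (map Bs [0..<Suc (Suc n)])) Y \<and> Y \<inter> F (map Bs [0..<Suc (Suc n)]) = {}"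
      using exist[of w w' Bs "Suc n"] ww sub by simp
    from avoiding_strategy[where Bs = "map Bs [0..<Suc (Suc n)]" and F = F, OF this] show ?case
      using ww sub by (intro exI[of _ w] exI[of _ w']) (simp add: alice_move_def st_def)
  qed
  have "\<exists>x\<in>S. (\<Inter>k. alice_move st Bs k) = {x}" if leg: "\<forall>k. bob_legal \<kappa> {l..u} b st Bs k" for Bs
  proof -
    have "\<forall>n. \<exists>x y. x < y \<and> {x..y} \<subseteq> {l..u} \<and> Bs n = {x..y} \<and>
      legal_move \<kappa> a {x..y} (alice_move st Bs n) \<and> alice_move st Bs n \<inter> F (map Bs [0..<Suc n]) = {}"
      using step[of _ Bs] leg by metis
    then obtain x y where xy: "\<And>n. x n < y n" "\<And>n. {x n..y n} \<subseteq> {l..u}" "\<And>n. Bs n = {x n..y n}"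
      "\<And>n. legal_move \<kappa> a {x n..y n} (alice_move st Bs n)"
      "\<And>n. alice_move st Bs n \<inter> F (map Bs [0..<Suc n]) = {}" by metis
    have "\<forall>n. \<exists>z. alice_move st Bs n = {z..z + ea * (y n - x n)} \<and> x n \<le> z \<and> z + ea * (y n - x n) \<le> y n"
      using legal_move_Icc[of "x _" "y _"] xy(1,4) unfolding ea_def by (meson less_imp_le)
    then obtain z where z: "\<And>n. alice_move st Bs n = {z n..z n + ea * (y n - x n)}" "\<And>n. x n \<le> z n"
      "\<And>n. z n + ea * (y n - x n) \<le> y n" by metis
    have len: "y (Suc n) - x (Suc n) = ea * eb * (y n - x n)"
      and sub: "{x (Suc n)..y (Suc n)} \<subseteq> {z n..z n + ea * (y n - x n)}" for n
    proof -
      have "legal_move \<kappa> b {z n..z n + ea * (y n - x n)} {x (Suc n)..y (Suc n)}"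
        using leg[rule_format, of "Suc n"] by (simp add: z(1) xy(3))
      moreover have "z n \<le> z n + ea * (y n - x n)" using e xy(1)[of n] by simp
      ultimately obtain w where w: "{x (Suc n)..y (Suc n)} = {w..w + eb * (ea * (y n - x n))}" "z n \<le> w"
        "w + eb * (ea * (y n - x n)) \<le> z n + ea * (y n - x n)"
        using legal_move_Icc[of "z n" "z n + ea * (y n - x n)"] unfolding eb_def by auto
      then have "x (Suc n) = w" "y (Suc n) = w + eb * (ea * (y n - x n))"
        using xy(1)[of "Suc n"] by (auto simp: Icc_eq_Icc)
      then show "y (Suc n) - x (Suc n) = ea * eb * (y n - x n)"
        "{x (Suc n)..y (Suc n)} \<subseteq> {z n..z n + ea * (y n - x n)}" using w by auto
    qed
    have A_sub: "alice_move st Bs n \<subseteq> Bs n" for n using z(2,3)[of n] unfolding z(1) xy(3) by auto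
    have Bs_sub: "Bs (Suc n) \<subseteq> alice_move st Bs n" for n using sub[of n] unfolding z(1) xy(3) .
    have A_dec: "alice_move st Bs n \<subseteq> alice_move st Bs m" if "m \<le> n" for m n
      using that by (induction rule: dec_induct) (use A_sub Bs_sub in blast)+
    have lenn: "y n - x n = (ea * eb) ^ n * (y 0 - x 0)" for n
      by (induction n) (simp_all add: len)
    have "\<exists>t. \<forall>n. t \<in> alice_move st Bs n"
    proof -
      have "(\<Inter>n. alice_move st Bs n) \<noteq> {}"
      proof (rule compact_nest)
        show "compact (alice_move st Bs n)" for n by (simp add: z(1))
        show "alice_move st Bs n \<noteq> {}" for n using e xy(1)[of n] by (simp add: z(1))
        show "alice_move st Bs n \<subseteq> alice_move st Bs m" if "m \<le> n" for m n using A_dec[OF that] .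
      qed
      then show ?thesis by blast
    qed
    then obtain t where t: "\<And>n. t \<in> alice_move st Bs n" by blast
    have "t' = t" if t': "\<And>n. t' \<in> alice_move st Bs n" for t'
    proof (rule ccontr)
      assume "t' \<noteq> t"
      have "\<bar>t' - t\<bar> \<le> (ea * eb) ^ n * (y 0 - x 0)" for n
      proof -
        have "t \<in> {x n..y n}" "t' \<in> {x n..y n}" using t[of n] t'[of n] A_sub[of n] xy(3)[of n] by auto
        then show ?thesis using lenn[of n] by auto
      qed
      moreover have "(\<lambda>n. (ea * eb) ^ n * (y 0 - x 0)) \<longlonglongrightarrow> 0 * (y 0 - x 0)"
        using e by (intro tendsto_intros LIMSEQ_power_zero) (use e mult_strict_mono[of ea 1 eb 1] in \<open>auto simp: abs_mult\<close>)
      ultimately have "\<bar>t' - t\<bar> \<le> 0" by (intro LIMSEQ_le_const[of _ _ "\<bar>t' - t\<bar>"]) auto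
      then show False using \<open>t' \<noteq> t\<close> by simp
    qed
    then have "(\<Inter>k. alice_move st Bs k) = {t}" using t by blast
    moreover have "t \<in> S"
    proof (rule win[of Bs x y "\<lambda>k. alice_move st Bs k"])
      show "Bs (Suc k) \<subseteq> Bs k" for k using A_sub[of k] Bs_sub[of k] by blast
    qed (use xy len t A_sub in \<open>auto simp: ea_def eb_def\<close>)
    ultimately show ?thesis by blast
  qed
  moreover have "legal_move \<kappa> a (Bs n) (alice_move st Bs n)"
    if "\<forall>k\<le>n. bob_legal \<kappa> {l..u} b st Bs k" for Bs n
    using step[OF that] by blast
  ultimately show ?thesis unfolding ab_winning_def by (intro exI[of _ st]) blast
qed

text \<open>The finite set \<open>Z\<close> will be that of the zeros of the derivatives.\<close>

locale diophantine_curve_on = diophantine_curve \<Sigma> M \<phi>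
  for \<Sigma> M :: "('k::field_char_0 \<Rightarrow> complex) set" and \<phi> +
  fixes l u :: real and Z :: "real set"
  assumes lu: "l < u" and finZ: "finite Z"
    and locally_good: "\<And>x. x \<in> {l..u} - Z \<Longrightarrow> \<exists>\<delta>>0. \<exists>C. good C ({x - \<delta>..x + \<delta>} \<inter> {l..u})"
begin

definition good_piece :: "real set \<Rightarrow> bool" where
  "good_piece G \<longleftrightarrow> (\<exists>C. good C G)"

text \<open>A choice depending on the interval alone, so that the strategy can recover its constants
  from the list of moves.\<close>

definition bilipschitz_const :: "real set \<Rightarrow> real" where
  "bilipschitz_const G = (SOME C. good C G)"

lemma bilipschitz_const: "good_piece G \<Longrightarrow> good (bilipschitz_const G) G"
  unfolding good_piece_def bilipschitz_const_def by (rule someI_ex)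

text \<open>The constants of the strategy depend on the first good interval \<open>G\<close> of the play. Since
  \<open>game_c \<beta> G \<le> diameter G\<close>, no approximation is due before \<open>G\<close> is reached.\<close>

definition game_c :: "real \<Rightarrow> real set \<Rightarrow> real" where
  "game_c \<beta> G = min (\<beta> / (8 * bilipschitz_const G)) (min (1 / 2) (diameter G))"

text \<open>Chosen so that, with \<open>C\<close> the constant of \<open>G\<close>, the sets of
  \<open>bad_set_covered\<close> have diameter at most \<open>2 * C * (\<epsilon> * \<rho> /
  (\<beta> * c)) = \<alpha> * \<rho> / 2\<close>, less than the length
  \<open>\<alpha> * \<rho>\<close> of Alice's reply.\<close>

definition game_eps :: "real \<Rightarrow> real \<Rightarrow> real set \<Rightarrow> real" where
  "game_eps \<alpha> \<beta> G = \<alpha> * \<beta> * game_c \<beta> G / (4 * bilipschitz_const G)"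

text \<open>Before an interval is good there are no constants to work with, and Alice only leaves
  \<open>Z\<close>. \<open>List.find\<close> returns the first good interval, so the constants do
  not change from then on.\<close>

definition forbidden :: "real \<Rightarrow> real \<Rightarrow> real set list \<Rightarrow> real set" where
  "forbidden \<alpha> \<beta> Bs = (case List.find good_piece Bs of
      None \<Rightarrow> Z
    | Some G \<Rightarrow> {t \<in> last Bs. bad \<beta> (game_c \<beta> G) (game_eps \<alpha> \<beta> G) (diameter (last Bs)) t})"

lemma K_badly_approximableI:
  assumes "\<epsilon> > 0" and "\<And>p q. p \<in> ring_of_integers \<Longrightarrow> q \<in> ring_of_integers \<Longrightarrow> q \<noteq> 0 \<Longrightarrow>
      \<exists>\<sigma>\<in>\<Sigma>. \<epsilon> / Q q < lin p q t \<sigma>"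
  shows "K_badly_approximable \<Sigma> (\<phi> t)"
  unfolding K_badly_approximable_def
proof (intro exI conjI ballI impI)
  fix p q :: 'k assume pq: "p \<in> ring_of_integers" "q \<in> ring_of_integers" "q \<noteq> 0"
  then obtain \<sigma> where \<sigma>: "\<sigma> \<in> \<Sigma>" "\<epsilon> / Q q < lin p q t \<sigma>" using assms(2) by blast
  then have "\<epsilon> \<le> lin p q t \<sigma> * Q q" using Q_pos[OF pq(2,3)] by (simp add: field_simps)
  also have "\<dots> \<le> max_norm \<Sigma> (\<lambda>\<sigma>. \<sigma> p + \<phi> t \<sigma> * \<sigma> q) * Q q"
    using max_lin_ge[OF \<sigma>(1)] Q_pos[OF pq(2,3)] by (intro mult_right_mono) auto
  finally show "\<epsilon> \<le> max_norm \<Sigma> (\<lambda>\<sigma>. \<sigma> p + \<phi> t \<sigma> * \<sigma> q) * max_norm \<Sigma> (\<lambda>\<sigma>. \<sigma> q)"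
    by (simp add: Q_def)
qed fact

lemma game_constants:
  assumes \<alpha>: "0 < \<alpha>" "\<alpha> < 1" and \<beta>: "0 < \<beta>" "\<beta> < 1" and G: "good_piece G" "0 < diameter G"
  shows "1 \<le> bilipschitz_const G" "0 < game_c \<beta> G" "game_c \<beta> G \<le> diameter G"
    "4 * bilipschitz_const G * game_c \<beta> G < \<beta>" "2 * game_c \<beta> G \<le> 1"
    "0 < game_eps \<alpha> \<beta> G" "game_eps \<alpha> \<beta> G \<le> game_c \<beta> G"
proof -
  show C: "1 \<le> bilipschitz_const G" using bilipschitz_const[OF G(1)] by (rule good_ge_1)
  show c: "0 < game_c \<beta> G" "game_c \<beta> G \<le> diameter G" "2 * game_c \<beta> G \<le> 1"
    using C \<beta> G(2) by (auto simp: game_c_def)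
  have "4 * bilipschitz_const G * game_c \<beta> G \<le> 4 * bilipschitz_const G * (\<beta> / (8 * bilipschitz_const G))"
    using C by (intro mult_left_mono) (auto simp: game_c_def)
  also have "\<dots> < \<beta>" using C \<beta> by simp
  finally show "4 * bilipschitz_const G * game_c \<beta> G < \<beta>" .
  show "0 < game_eps \<alpha> \<beta> G" using C c \<alpha> \<beta> by (simp add: game_eps_def)
  have "\<alpha> * \<beta> * game_c \<beta> G \<le> 1 * game_c \<beta> G"
    using \<alpha> \<beta> c by (intro mult_right_mono mult_le_one) auto
  also have "\<dots> \<le> 4 * bilipschitz_const G * game_c \<beta> G" using C c by (intro mult_right_mono) auto
  finally show "game_eps \<alpha> \<beta> G \<le> game_c \<beta> G"
    using C unfolding game_eps_def by (subst pos_divide_le_eq) (auto simp: mult_ac)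
qed

text \<open>Either way at most \<open>k\<close> short sets are to be avoided, the points of
  \<open>Z\<close> or one set for each moving place, so the same ratio \<alpha> serves before and
  after the first good interval.\<close>

lemma forbidden_avoidable:
  assumes \<alpha>: "0 < \<alpha>" "\<alpha> < 1" and \<beta>: "0 < \<beta>" "\<beta> < 1"
    and k: "card Z + card M \<le> k" "\<alpha> = 1 / (2 * real k + 1)"
    and xy: "x < y" "{x..y} \<subseteq> {l..u}" "Bs i = {x..y}"
      "\<And>j. j < i \<Longrightarrow> {x..y} \<subseteq> Bs j \<and> Bs j \<subseteq> {l..u}"
  shows "\<exists>z\<ge>x. z + \<alpha> * (y - x) \<le> y \<and> {z..z + \<alpha> * (y - x)} \<inter> forbidden \<alpha> \<beta> (map Bs [0..<Suc i]) = {}"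
proof -
  define h where "h = (y - x) / (2 * real k + 1)"
  have h: "h = \<alpha> * (y - x)" "h > 0" using xy(1) by (auto simp: h_def k)
  have last: "last (map Bs [0..<Suc i]) = {x..y}" using xy(3) by simp
  have diam: "diameter {x..y} = y - x" using xy(1) by (simp add: diameter_closed_interval)
  show ?thesis
  proof (cases "List.find good_piece (map Bs [0..<Suc i])")
    case None
    have "\<exists>z\<ge>x. z + h \<le> y \<and> {z..z + h} \<inter> (\<Union>z\<in>Z. {z}) = {}"
      by (rule avoid_short_sets[OF xy(1) finZ _ h_def]) (use h k in auto)
    then show ?thesis using None by (simp add: forbidden_def h(1) del: upt_Suc)
  next
    case (Some G)
    then obtain j where j: "j < Suc i" "good_piece G" "G = Bs j"
      by (auto simp: find_Some_iff simp del: upt_Suc)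
    have sub: "{x..y} \<subseteq> G \<and> G \<subseteq> {l..u}"
      using j xy(2-4) by (cases "j = i") auto
    have "bounded G" using sub bounded_closed_interval bounded_subset by blast
    then have "diameter {x..y} \<le> diameter G" using sub by (intro diameter_subset) auto
    then have "0 < diameter G" using diam xy(1) by simp
    note c = game_constants[OF \<alpha> \<beta> j(2) this]
    let ?r = "2 * bilipschitz_const G * (game_eps \<alpha> \<beta> G * (y - x) / (\<beta> * game_c \<beta> G))"
    have r: "?r = h / 2" using c(1,2) \<beta> by (simp add: game_eps_def h(1))
    have "\<exists>D. {t \<in> {x..y}. bad \<beta> (game_c \<beta> G) (game_eps \<alpha> \<beta> G) (y - x) t} \<subseteq> (\<Union>\<sigma>\<in>M. D \<sigma>) \<and>
        (\<forall>\<sigma>\<in>M. D \<sigma> \<subseteq> {x..y} \<and> (\<forall>t\<in>D \<sigma>. \<forall>t'\<in>D \<sigma>. \<bar>t - t'\<bar> \<le> ?r))"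
      by (rule bad_set_covered[OF bilipschitz_const[OF j(2)]])
         (use sub c xy(1) \<beta> in auto)
    then obtain D where D: "{t \<in> {x..y}. bad \<beta> (game_c \<beta> G) (game_eps \<alpha> \<beta> G) (y - x) t} \<subseteq> (\<Union>\<sigma>\<in>M. D \<sigma>)"
      "\<And>\<sigma> t t'. \<sigma> \<in> M \<Longrightarrow> t \<in> D \<sigma> \<Longrightarrow> t' \<in> D \<sigma> \<Longrightarrow> \<bar>t - t'\<bar> \<le> h / 2" unfolding r by blast
    have D': "\<bar>t - t'\<bar> < h" if "\<sigma> \<in> M" "t \<in> D \<sigma>" "t' \<in> D \<sigma>" for \<sigma> t t'
      using D(2)[OF that] h(2) by linarith
    have "\<exists>z\<ge>x. z + h \<le> y \<and> {z..z + h} \<inter> (\<Union>\<sigma>\<in>M. D \<sigma>) = {}"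
      by (rule avoid_short_sets[OF xy(1) finM _ h_def]) (use k D' in auto)
    then show ?thesis using D(1) Some last diam unfolding forbidden_def h(1)
      by (simp del: upt_Suc) blast
  qed
qed

lemma avoiding_forbidden_badly_approximable:
  assumes \<alpha>: "0 < \<alpha>" "\<alpha> < 1" and \<beta>: "0 < \<beta>" "\<beta> < 1"
    and Bs: "\<And>k. Bs k = {x k..y k}" "\<And>k. x k < y k" "{x 0..y 0} \<subseteq> {l..u}"
      "\<And>k. y (Suc k) - x (Suc k) = \<beta> * (y k - x k)" "\<And>k. Bs (Suc k) \<subseteq> Bs k"
    and t: "\<And>k. t \<in> Bs k" "\<And>k. t \<notin> forbidden \<alpha> \<beta> (map Bs [0..<Suc k])"
  shows "K_badly_approximable \<Sigma> (\<phi> t)"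
proof -
  define \<rho> where "\<rho> k = y k - x k" for k
  have \<rho>_pos: "0 < \<rho> k" for k using Bs(2) by (simp add: \<rho>_def)
  have \<rho>: "\<rho> (j + k) = \<beta> ^ k * \<rho> j" for j k
    by (induction k) (simp_all add: \<rho>_def Bs(4))
  have \<rho>_small: "\<exists>k. \<rho> (j + k) < e" if e: "e > 0" for e j
  proof -
    obtain k where "\<beta> ^ k < e / \<rho> j" using real_arch_pow_inv[of "e / \<rho> j" \<beta>] e \<beta> \<rho>_pos[of j] by auto
    then show ?thesis using \<rho>_pos[of j] by (intro exI[of _ k]) (simp add: \<rho> field_simps)
  qed
  have Bs_sub: "Bs k \<subseteq> {l..u}" for k
  proof (induction k)
    case 0
    show ?case using Bs(1,3) by simp
  next
    case (Suc k)
    then show ?case using Bs(5)[of k] by blast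
  qed
  \<comment> \<open>Otherwise Alice has left \<open>Z\<close> already in her first reply, and the
    shrinking intervals around \<open>t\<close> would end up in a good neighbourhood of it.\<close>
  have "\<exists>j. good_piece (Bs j)"
  proof (rule ccontr)
    assume none: "\<not> ?thesis"
    then have "List.find good_piece (map Bs [0..<Suc 0]) = None" by simp
    then have "t \<notin> Z" using t(2)[of 0] by (simp add: forbidden_def)
    then have "t \<in> {l..u} - Z" using t(1)[of 0] Bs_sub[of 0] by blast
    then obtain \<delta> C where \<delta>: "\<delta> > 0" "good C ({t - \<delta>..t + \<delta>} \<inter> {l..u})" using locally_good by blast
    obtain k where "\<rho> (0 + k) < \<delta>" using \<rho>_small[OF \<delta>(1)] by blast
    then have "Bs k \<subseteq> {t - \<delta>..t + \<delta>} \<inter> {l..u}" using t(1)[of k] Bs_sub[of k] Bs(1)[of k] by (auto simp: \<rho>_def)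
    then have "good_piece (Bs k)" using \<delta>(2) good_subset unfolding good_piece_def by blast
    then show False using none by blast
  qed
  then obtain j where j: "good_piece (Bs j)" "\<And>i. i < j \<Longrightarrow> \<not> good_piece (Bs i)"
    using exists_least_iff[of "\<lambda>j. good_piece (Bs j)"] by blast
  define G where "G = Bs j"
  have diam: "diameter (Bs k) = \<rho> k" for k
    using Bs(2)[of k] by (simp add: Bs(1) \<rho>_def diameter_closed_interval)
  have G: "good_piece G" "0 < diameter G" using j(1) diam[of j] \<rho>_pos[of j] by (auto simp: G_def)
  note c = game_constants[OF \<alpha> \<beta> G]
  have not_bad: "\<not> bad \<beta> (game_c \<beta> G) (game_eps \<alpha> \<beta> G) (\<rho> k) t" if "j \<le> k" for k
  proof -
    have "List.find good_piece (map Bs [0..<Suc k]) = Some G"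
      unfolding find_Some_iff G_def using that j by (intro exI[of _ j]) (simp del: upt_Suc)
    then show ?thesis using t(2)[of k] t(1)[of k] diam[of k] by (simp add: forbidden_def)
  qed
  show ?thesis
  proof (rule K_badly_approximableI[OF c(6)], rule ccontr)
    fix p q :: 'k
    assume pq: "p \<in> ring_of_integers" "q \<in> ring_of_integers" "q \<noteq> 0"
      and "\<not> (\<exists>\<sigma>\<in>\<Sigma>. game_eps \<alpha> \<beta> G / Q q < lin p q t \<sigma>)"
    then have lin: "\<forall>\<sigma>\<in>\<Sigma>. lin p q t \<sigma> \<le> game_eps \<alpha> \<beta> G / Q q" by auto
    define X where "X = Q q * R q"
    have X: "1 \<le> X" unfolding X_def by (rule QR_ge_1[OF pq(2,3)])
    \<comment> \<open>The pair \<open>p\<close>, \<open>q\<close> is due at the first scale where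
      complexity times length is at most \<open>game_c \<beta> G\<close>. The scale before it
      exceeds this bound and is longer by 1 / \<beta>, so the lower end of the window holds as
      well.\<close>
    have "\<exists>i. X * \<rho> (j + i) \<le> game_c \<beta> G"
    proof -
      obtain i where "\<rho> (j + i) < game_c \<beta> G / X" using \<rho>_small[of "game_c \<beta> G / X" j] c(2) X by auto
      then show ?thesis using X by (intro exI[of _ i]) (simp add: field_simps)
    qed
    then obtain i where i: "X * \<rho> (j + i) \<le> game_c \<beta> G" "\<And>i'. i' < i \<Longrightarrow> \<not> X * \<rho> (j + i') \<le> game_c \<beta> G"
      using exists_least_iff[of "\<lambda>i. X * \<rho> (j + i) \<le> game_c \<beta> G"] by blast
    have "\<beta> * game_c \<beta> G \<le> X * \<rho> (j + i)"
    proof (cases i)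
      \<comment> \<open>There is no earlier scale; \<open>game_c \<beta> G \<le> diameter G\<close>
        and \<open>1 \<le> X\<close> take its place.\<close>
      case 0
      have "\<beta> * game_c \<beta> G \<le> 1 * game_c \<beta> G" using \<beta> c(2) by (intro mult_right_mono) auto
      also have "\<dots> \<le> 1 * \<rho> j" using c(3) diam[of j] by (simp add: G_def)
      also have "\<dots> \<le> X * \<rho> j" using X \<rho>_pos[of j] by (intro mult_right_mono) auto
      finally show ?thesis using 0 by simp
    next
      case (Suc i')
      then have "game_c \<beta> G \<le> X * \<rho> (j + i')" using i(2)[of i'] by simp
      then have "\<beta> * game_c \<beta> G \<le> \<beta> * (X * \<rho> (j + i'))" using \<beta> by (intro mult_left_mono) auto
      also have "\<dots> = X * \<rho> (j + i)" using \<rho>[of j i'] \<rho>[of j i] by (simp add: Suc)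
      finally show ?thesis .
    qed
    then have "bad \<beta> (game_c \<beta> G) (game_eps \<alpha> \<beta> G) (\<rho> (j + i)) t"
      unfolding bad_def using pq lin i(1) by (intro exI[of _ p] exI[of _ q]) (simp add: X_def)
    then show False using not_bad[of "j + i"] by simp
  qed
qed

theorem winning_badly_approximable:
  assumes \<kappa>: "\<kappa> > 0"
  shows "winning \<kappa> {l..u} {t \<in> {l..u}. K_badly_approximable \<Sigma> (\<phi> t)}"
proof -
  define k where "k = card Z + card M + 1"
  define \<alpha> where "\<alpha> = 1 / (2 * real k + 1)"
  \<comment> \<open>As \<open>a_winning\<close> demands, \<open>a\<close> is fixed before
    \<open>b\<close>: it depends only on the number of sets to avoid, and \<beta> with all finer
    constants comes afterwards.\<close>
  define a where "a = ln (2 * real k + 1) / \<kappa>"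
  have a: "a > 0" using \<kappa> by (auto simp: a_def k_def)
  have ea: "exp (- (\<kappa> * a)) = \<alpha>" using \<kappa> by (simp add: a_def \<alpha>_def exp_minus inverse_eq_divide)
  have \<alpha>: "0 < \<alpha>" "\<alpha> < 1" by (auto simp: \<alpha>_def k_def)
  have "ab_winning \<kappa> {l..u} a b {t \<in> {l..u}. K_badly_approximable \<Sigma> (\<phi> t)}" if b: "b > 0" for b
  proof -
    define \<beta> where "\<beta> = \<alpha> * exp (- (\<kappa> * b))"
    have "exp (- (\<kappa> * b)) < 1" using \<kappa> b by simp
    then have "\<alpha> * exp (- (\<kappa> * b)) < 1 * 1" using \<alpha> by (intro mult_strict_mono) auto
    then have \<beta>: "0 < \<beta>" "\<beta> < 1" using \<alpha> by (auto simp: \<beta>_def)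
    show ?thesis
    proof (rule ab_winning_avoiding[OF \<kappa> a b lu, where F = "forbidden \<alpha> \<beta>"])
      fix Bs :: "nat \<Rightarrow> real set" and i x y
      assume xy: "x < y" "{x..y} \<subseteq> {l..u}" "Bs i = {x..y}"
        "\<And>j. j < i \<Longrightarrow> {x..y} \<subseteq> Bs j \<and> Bs j \<subseteq> {l..u}"
      obtain z where "x \<le> z" "z + \<alpha> * (y - x) \<le> y"
        "{z..z + \<alpha> * (y - x)} \<inter> forbidden \<alpha> \<beta> (map Bs [0..<Suc i]) = {}"
        using forbidden_avoidable[of \<alpha> \<beta> k x y Bs i, OF \<alpha> \<beta> _ \<alpha>_def xy] by (auto simp: k_def)
      then show "\<exists>Y. legal_move \<kappa> a {x..y} Y \<and> Y \<inter> forbidden \<alpha> \<beta> (map Bs [0..<Suc i]) = {}"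
        using legal_move_Icc[of x y \<kappa> a "{z..z + \<alpha> * (y - x)}"] xy(1) unfolding ea
        by (intro exI[of _ "{z..z + \<alpha> * (y - x)}"]) (auto simp del: upt_Suc)
    next
      fix Bs A x y t
      assume *: "\<And>k. Bs k = {x k..y k}" "\<And>k. x k < y k" "{x 0..y 0} \<subseteq> {l..u}"
        "\<And>k. y (Suc k) - x (Suc k) = exp (- (\<kappa> * a)) * exp (- (\<kappa> * b)) * (y k - x k)"
        "\<And>k. Bs (Suc k) \<subseteq> Bs k" "\<And>k. A k \<inter> forbidden \<alpha> \<beta> (map Bs [0..<Suc k]) = {}"
        "\<And>k. A k \<subseteq> Bs k" "\<And>k. t \<in> A k"
      have "K_badly_approximable \<Sigma> (\<phi> t)"
      proof (rule avoiding_forbidden_badly_approximable[OF \<alpha> \<beta> *(1-3) _ *(5)])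
        show "y (Suc k) - x (Suc k) = \<beta> * (y k - x k)" for k using *(4)[of k] by (simp add: ea \<beta>_def)
        show "t \<in> Bs k" for k using *(7)[of k] *(8)[of k] by blast
        show "t \<notin> forbidden \<alpha> \<beta> (map Bs [0..<Suc k])" for k using *(6)[of k] *(8)[of k] by blast
      qed
      moreover have "t \<in> {l..u}" using *(1)[of 0] *(3) *(7)[of 0] *(8)[of 0] by blast
      ultimately show "t \<in> {t \<in> {l..u}. K_badly_approximable \<Sigma> (\<phi> t)}" by simp
    qed
  qed
  then show ?thesis using a unfolding winning_def a_winning_def by blast
qed

end

section \<open>Hausdorff measure and dimension\<close>

lemma hausdorff_measure_null_iff:
  "hausdorff_measure d (A :: 'a::metric_space set) = 0 \<longleftrightarrow>
    (\<forall>\<delta>>0. \<forall>e>0. \<exists>U :: nat \<Rightarrow> 'a set. A \<subseteq> (\<Union>i. U i) \<and> (\<forall>i. bounded (U i) \<and> diameter (U i) \<le> \<delta>) \<and>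
      (\<Sum>i. ennreal (diameter (U i) powr d)) < ennreal e)"
  (is "_ = ?R")
proof -
  have "hausdorff_measure d A = 0 \<longleftrightarrow> (\<forall>\<delta>>0. hausdorff_premeasure d \<delta> A = 0)"
    unfolding hausdorff_measure_def bot_ennreal[symmetric] SUP_bot_conv by auto
  also have "\<dots> \<longleftrightarrow> (\<forall>\<delta>>0. \<forall>e>0. hausdorff_premeasure d \<delta> A < ennreal e)"
  proof (intro all_cong1 imp_cong refl iffI allI impI)
    fix \<delta> assume *: "\<forall>e>0. hausdorff_premeasure d \<delta> A < ennreal e"
    show "hausdorff_premeasure d \<delta> A = 0"
    proof (rule ccontr)
      assume "hausdorff_premeasure d \<delta> A \<noteq> 0"
      then obtain y where y: "0 < y" "y < hausdorff_premeasure d \<delta> A"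
        using dense[of 0 "hausdorff_premeasure d \<delta> A"] by (auto simp: zero_less_iff_neq_zero)
      then obtain e where e: "y = ennreal e" "0 \<le> e" by (cases y) auto
      then have "0 < e" using y(1) by simp
      then show False using * y(2) e(1) by (meson less_asym)
    qed
  qed simp
  also have "\<dots> \<longleftrightarrow> ?R"
    unfolding hausdorff_premeasure_def INF_less_iff by auto
  finally show ?thesis .
qed

lemma hausdorff_measure_null_subset:
  "hausdorff_measure d A = 0 \<Longrightarrow> A' \<subseteq> A \<Longrightarrow> hausdorff_measure d A' = 0"
  unfolding hausdorff_measure_null_iff by (meson subset_trans)

lemma hausdorff_dim_mono: "A' \<subseteq> A \<Longrightarrow> hausdorff_dim A' \<le> hausdorff_dim A"
  unfolding hausdorff_dim_def
  by (rule INF_superset_mono) (auto dest: hausdorff_measure_null_subset)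

lemma hausdorff_measure_null_UN:
  fixes A :: "nat \<Rightarrow> 'a::metric_space set"
  assumes "\<And>j. hausdorff_measure d (A j) = 0"
  shows "hausdorff_measure d (\<Union>j. A j) = 0"
  unfolding hausdorff_measure_null_iff
proof (intro allI impI)
  fix \<delta> e :: real assume pos: "\<delta> > 0" "e > 0"
  have "\<forall>j. \<exists>U :: nat \<Rightarrow> 'a set. A j \<subseteq> (\<Union>i. U i) \<and> (\<forall>i. bounded (U i) \<and> diameter (U i) \<le> \<delta>) \<and>
      (\<Sum>i. ennreal (diameter (U i) powr d)) < ennreal (e / 4 * (1 / 2) ^ j)"
    using assms pos unfolding hausdorff_measure_null_iff by simp
  then obtain U where U: "\<And>j. A j \<subseteq> (\<Union>i. U j i)" "\<And>i j. bounded (U j i)" "\<And>i j. diameter (U j i) \<le> \<delta>"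
    "\<And>j. (\<Sum>i. ennreal (diameter (U j i) powr d)) < ennreal (e / 4 * (1 / 2) ^ j)"
    by metis
  define V where "V k = (case prod_decode k of (j, i) \<Rightarrow> U j i)" for k
  have "(\<Sum>k. ennreal (diameter (V k) powr d)) = (\<Sum>k. (\<lambda>(j, i). ennreal (diameter (U j i) powr d)) (prod_decode k))"
    by (simp add: V_def case_prod_unfold)
  also have "\<dots> = (\<Sum>j. \<Sum>i. ennreal (diameter (U j i) powr d))"
    by (rule suminf_ennreal_2dimen) simp
  also have "\<dots> \<le> (\<Sum>j. ennreal (e / 4 * (1 / 2) ^ j))"
    using U(4) by (intro suminf_le) (auto intro: less_imp_le)
  also have "\<dots> = ennreal (\<Sum>j. e / 4 * (1 / 2) ^ j)"
    using pos by (intro suminf_ennreal2) (auto intro!: summable_mult summable_geometric)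
  also have "(\<Sum>j. e / 4 * (1 / 2 :: real) ^ j) = e / 2"
    by (subst suminf_mult) (auto simp: suminf_geometric intro!: summable_geometric)
  also have "ennreal (e / 2) < ennreal e" using pos by (simp add: ennreal_less_iff)
  finally have "(\<Sum>k. ennreal (diameter (V k) powr d)) < ennreal e" .
  moreover have "(\<Union>j. A j) \<subseteq> (\<Union>k. V k)"
  proof
    fix x assume "x \<in> (\<Union>j. A j)"
    then obtain j i where "x \<in> U j i" using U(1) by blast
    then have "x \<in> V (prod_encode (j, i))" by (simp add: V_def)
    then show "x \<in> (\<Union>k. V k)" by blast
  qed
  moreover have "bounded (V k) \<and> diameter (V k) \<le> \<delta>" for k
    using U(2,3) by (simp add: V_def case_prod_unfold)
  ultimately show "\<exists>U. (\<Union>j. A j) \<subseteq> (\<Union>i. U i) \<and> (\<forall>i. bounded (U i) \<and> diameter (U i) \<le> \<delta>) \<and>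
      (\<Sum>i. ennreal (diameter (U i) powr d)) < ennreal e" by blast
qed

lemma hausdorff_measure_null_finite_coverI:
  fixes A :: "'a::metric_space set"
  assumes d: "d > 0"
    and cover: "\<And>\<delta> e. \<delta> > 0 \<Longrightarrow> e > 0 \<Longrightarrow> \<exists>I. \<exists>U :: 'i \<Rightarrow> 'a set. finite I \<and> A \<subseteq> (\<Union>i\<in>I. U i) \<and>
      (\<forall>i\<in>I. bounded (U i) \<and> diameter (U i) \<le> \<delta>) \<and> (\<Sum>i\<in>I. diameter (U i) powr d) < e"
  shows "hausdorff_measure d A = 0"
  unfolding hausdorff_measure_null_iff
proof (intro allI impI)
  fix \<delta> e :: real assume pos: "\<delta> > 0" "e > 0"
  obtain I and U :: "'i \<Rightarrow> 'a set" where IU: "finite I" "A \<subseteq> (\<Union>i\<in>I. U i)"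
    "\<forall>i\<in>I. bounded (U i) \<and> diameter (U i) \<le> \<delta>" "(\<Sum>i\<in>I. diameter (U i) powr d) < e"
    using cover[OF pos] by blast
  obtain f where f: "bij_betw f {0..<card I} I" using ex_bij_betw_nat_finite[OF IU(1)] by blast
  define V where "V k = (if k < card I then U (f k) else {})" for k
  have fI: "f k \<in> I" if "k < card I" for k using f that by (auto simp: bij_betw_def)
  have "A \<subseteq> (\<Union>k. V k)"
  proof
    fix x assume "x \<in> A"
    then obtain i where "i \<in> I" "x \<in> U i" using IU(2) by blast
    moreover have "i \<in> f ` {0..<card I}" using f \<open>i \<in> I\<close> by (auto simp: bij_betw_def)
    ultimately obtain k where "k < card I" "x \<in> U (f k)" by auto
    then have "x \<in> V k" by (simp add: V_def)
    then show "x \<in> (\<Union>k. V k)" by blast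
  qed
  moreover have "bounded (V k) \<and> diameter (V k) \<le> \<delta>" for k
    using IU(3) fI pos by (simp add: V_def)
  moreover have "(\<Sum>k. ennreal (diameter (V k) powr d)) = (\<Sum>k\<in>{0..<card I}. ennreal (diameter (U (f k)) powr d))"
    using d by (subst suminf_finite[of "{0..<card I}"]) (auto simp: V_def)
  then have "(\<Sum>k. ennreal (diameter (V k) powr d)) = (\<Sum>i\<in>I. ennreal (diameter (U i) powr d))"
    using sum.reindex_bij_betw[OF f, of "\<lambda>i. ennreal (diameter (U i) powr d)"] by simp
  then have "(\<Sum>k. ennreal (diameter (V k) powr d)) < ennreal e"
    using IU(4) pos by (simp add: ennreal_less_iff sum_nonneg)
  ultimately show "\<exists>U :: nat \<Rightarrow> 'a set. A \<subseteq> (\<Union>i. U i) \<and> (\<forall>i. bounded (U i) \<and> diameter (U i) \<le> \<delta>) \<and>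
      (\<Sum>i. ennreal (diameter (U i) powr d)) < ennreal e" by blast
qed

lemma hausdorff_dim_leI:
  assumes "\<And>d. D < d \<Longrightarrow> hausdorff_measure d A = 0" "0 \<le> D"
  shows "hausdorff_dim A \<le> ereal D"
proof (rule ereal_le_epsilon2)
  fix e :: real assume "0 < e"
  then have "hausdorff_dim A \<le> ereal (D + e)"
    unfolding hausdorff_dim_def using assms by (intro INF_lower) auto
  then show "hausdorff_dim A \<le> ereal D + ereal e" by simp
qed

lemma hausdorff_dim_geI:
  assumes "\<And>d. 0 < d \<Longrightarrow> d < D \<Longrightarrow> hausdorff_measure d A \<noteq> 0"
  shows "ereal D \<le> hausdorff_dim A"
  unfolding hausdorff_dim_def by (rule INF_greatest) (use assms linorder_not_less in auto)

lemma hausdorff_dim_Icc_le_1: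
  fixes l u :: real
  assumes "l < u"
  shows "hausdorff_dim {l..u} \<le> 1"
proof -
  have "hausdorff_measure d {l..u} = 0" if d: "1 < d" for d
  proof (rule hausdorff_measure_null_finite_coverI[where 'i = nat])
    fix \<delta> e :: real assume pos: "\<delta> > 0" "e > 0"
    have "(\<lambda>N. 2 * (u - l) powr d * real (Suc N) powr (1 - d)) \<longlonglongrightarrow> 2 * (u - l) powr d * 0"
      using d by (intro tendsto_intros tendsto_neg_powr filterlim_compose[OF filterlim_real_sequentially filterlim_Suc]) auto
    then have "\<forall>\<^sub>F N in sequentially. 2 * (u - l) powr d * real (Suc N) powr (1 - d) < e"
      using pos by (intro order_tendstoD) auto
    moreover have "(\<lambda>N. (u - l) / real (Suc N)) \<longlonglongrightarrow> 0"
      by (intro real_tendsto_divide_at_top[OF tendsto_const] filterlim_compose[OF filterlim_real_sequentially filterlim_Suc])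
    then have "\<forall>\<^sub>F N in sequentially. (u - l) / real (Suc N) < \<delta>"
      using pos by (intro order_tendstoD) auto
    ultimately have "\<forall>\<^sub>F N in sequentially. 2 * (u - l) powr d * real (Suc N) powr (1 - d) < e \<and> (u - l) / real (Suc N) < \<delta>"
      by (rule eventually_conj)
    then obtain N where N: "2 * (u - l) powr d * real (Suc N) powr (1 - d) < e" "(u - l) / real (Suc N) < \<delta>"
      using eventually_happens'[OF sequentially_bot] by blast
    define h where "h = (u - l) / real (Suc N)"
    have h: "h > 0" "h * real (Suc N) = u - l" using assms by (auto simp: h_def)
    define U where "U i = {l + real i * h..l + real i * h + h}" for i
    have diam: "diameter (U i) = h" for i using h by (simp add: U_def diameter_closed_interval)
    \<comment> \<open>One interval more than the total length requires, because \<open>u\<close>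
      itself gets the index \<open>Suc N\<close>.\<close>
    have "{l..u} \<subseteq> (\<Union>i\<in>{..<Suc N + 1}. U i)"
    proof
      fix x assume x: "x \<in> {l..u}"
      define i where "i = nat \<lfloor>(x - l) / h\<rfloor>"
      have "0 \<le> (x - l) / h" using x h by simp
      then have "real i = real_of_int \<lfloor>(x - l) / h\<rfloor>" by (simp add: i_def)
      then have i: "real i \<le> (x - l) / h" "(x - l) / h < real i + 1" by linarith+
      then have xi: "l + real i * h \<le> x" "x < l + real i * h + h" using h by (auto simp: field_simps)
      have "(x - l) / h \<le> real (Suc N)" using x h by (simp add: pos_divide_le_eq mult.commute)
      then have "real i \<le> real (Suc N)" using i(1) by linarith
      then show "x \<in> (\<Union>i\<in>{..<Suc N + 1}. U i)" using xi by (auto simp: U_def intro!: bexI[of _ i])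
    qed
    moreover have "(\<Sum>i\<in>{..<Suc N + 1}. diameter (U i) powr d) < e"
    proof -
      have "(\<Sum>i\<in>{..<Suc N + 1}. diameter (U i) powr d) = (real (Suc N) + 1) * h powr d"
        by (simp add: diam)
      also have "\<dots> \<le> (2 * real (Suc N)) * h powr d" by (intro mult_right_mono) auto
      also have "\<dots> = 2 * (u - l) powr d * real (Suc N) powr (1 - d)"
        using assms by (simp add: h_def powr_divide powr_diff)
      finally show ?thesis using N(1) by simp
    qed
    moreover have "\<forall>i\<in>{..<Suc N + 1}. bounded (U i) \<and> diameter (U i) \<le> \<delta>"
      using N(2) unfolding diam by (auto simp: U_def h_def)
    ultimately show "\<exists>I. \<exists>U :: nat \<Rightarrow> real set. finite I \<and> {l..u} \<subseteq> (\<Union>i\<in>I. U i) \<and>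
      (\<forall>i\<in>I. bounded (U i) \<and> diameter (U i) \<le> \<delta>) \<and> (\<Sum>i\<in>I. diameter (U i) powr d) < e"
      by (intro exI[of _ "{..<Suc N + 1}"] exI[of _ U]) blast
  qed (use d in auto)
  then show ?thesis using hausdorff_dim_leI[of 1 "{l..u}"] by (simp add: one_ereal_def)
qed

section \<open>Winning sets are thick\<close>

text \<open>Bob answers so as to keep the total weight of the members of a given cover that he still meets
  small compared with \<open>length ^ s\<close>: of his \<open>N\<close> separated replies each member meets at most one.\<close>

lemma light_child:
  fixes x y g :: real and U :: "nat \<Rightarrow> real set" and w :: "nat \<Rightarrow> real"
  assumes xy: "x < y" and N: "N > 0" and g: "g = (y - x) / (2 * real N)"
    and w: "\<And>i. 0 \<le> w i" "summable w"
    and small: "\<And>i t t'. U i \<inter> {x..y} \<noteq> {} \<Longrightarrow> t \<in> U i \<Longrightarrow> t' \<in> U i \<Longrightarrow> \<bar>t - t'\<bar> < g"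
  shows "\<exists>z\<ge>x. z + g \<le> y \<and>
    real N * (\<Sum>i. w i * of_bool (U i \<inter> {z..z + g} \<noteq> {})) \<le> (\<Sum>i. w i * of_bool (U i \<inter> {x..y} \<noteq> {}))"
proof -
  have g0: "g > 0" and gN: "2 * real N * g = y - x" using xy N g by auto
  \<comment> \<open>The gaps between candidates have length at least \<open>g\<close>, more than any
    member meeting the interval can span.\<close>
  define J where "J j = {x + 2 * real j * g..x + 2 * real j * g + g}" for j :: nat
  define W where "W A = (\<Sum>i. w i * of_bool (U i \<inter> A \<noteq> {}))" for A
  have summ: "summable (\<lambda>i. w i * of_bool (U i \<inter> A \<noteq> {}))" for A
    by (rule summable_comparison_test'[OF w(2), of 0]) (use w(1) in auto)
  have J: "x \<le> x + 2 * real j * g" "x + 2 * real j * g + g \<le> y" if j: "j < N" for j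
  proof -
    show "x \<le> x + 2 * real j * g" using g0 by simp
    have "(2 * real j + 1) * g \<le> (2 * real N) * g" using j g0 by (intro mult_right_mono) auto
    then show "x + 2 * real j * g + g \<le> y" using gN by (simp add: algebra_simps)
  qed
  have J_sub: "J j \<subseteq> {x..y}" if "j < N" for j using J[OF that] by (auto simp: J_def)
  have one: "(\<Sum>j<N. of_bool (U i \<inter> J j \<noteq> {})) \<le> (of_bool (U i \<inter> {x..y} \<noteq> {}) :: real)" for i
  proof (cases "\<exists>j<N. U i \<inter> J j \<noteq> {}")
    case True
    then obtain j where j: "j < N" "U i \<inter> J j \<noteq> {}" by blast
    have "U i \<inter> J j' = {}" if j': "j' < N" "j' \<noteq> j" for j'
    proof (rule ccontr)
      assume "U i \<inter> J j' \<noteq> {}"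
      then obtain t t' where t: "t \<in> U i" "t \<in> J j" "t' \<in> U i" "t' \<in> J j'" using j(2) by blast
      have meets: "U i \<inter> {x..y} \<noteq> {}" using j J_sub by blast
      have "\<bar>real j - real j'\<bar> \<ge> 1" using j'(2) by linarith
      then have "\<bar>real j - real j'\<bar> * g \<ge> 1 * g" using g0 by (intro mult_right_mono) auto
      then have "\<bar>real j * g - real j' * g\<bar> \<ge> g" using g0 by (simp add: abs_mult flip: left_diff_distrib)
      then have "\<bar>t - t'\<bar> \<ge> g" using t(2,4) by (auto simp: J_def abs_le_iff split: abs_split)
      then show False using small[OF meets t(1,3)] by simp
    qed
    then have "(\<Sum>j'<N. of_bool (U i \<inter> J j' \<noteq> {}) :: real) = (\<Sum>j'<N. of_bool (j' = j))"
      using j by (intro sum.cong) auto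
    also have "\<dots> = 1" using j(1) by simp
    finally show ?thesis using j J_sub[OF j(1)] by auto
  qed simp
  have "(\<Sum>j<N. W (J j)) = (\<Sum>i. \<Sum>j<N. w i * of_bool (U i \<inter> J j \<noteq> {}))"
    unfolding W_def using summ by (subst suminf_sum) auto
  also have "\<dots> \<le> W {x..y}" unfolding W_def
  proof (rule suminf_le)
    show "(\<Sum>j<N. w i * of_bool (U i \<inter> J j \<noteq> {})) \<le> w i * of_bool (U i \<inter> {x..y} \<noteq> {})" for i
      unfolding sum_distrib_left[symmetric] using one[of i] w(1)[of i] by (intro mult_left_mono) auto
    show "summable (\<lambda>i. \<Sum>j<N. w i * of_bool (U i \<inter> J j \<noteq> {}))"
      by (intro summable_sum summ)
  qed (rule summ)
  finally have total: "(\<Sum>j<N. W (J j)) \<le> W {x..y}" .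
  have "\<exists>j<N. real N * W (J j) \<le> W {x..y}"
  proof (rule ccontr)
    assume "\<not> ?thesis"
    then have "W {x..y} / real N < W (J j)" if "j < N" for j
      using that N by (auto simp: field_simps)
    then have "(\<Sum>j<N. W {x..y} / real N) < (\<Sum>j<N. W (J j))"
      using N by (intro sum_strict_mono) auto
    then show False using total N by simp
  qed
  then obtain j where "j < N" "real N * W (J j) \<le> W {x..y}" by blast
  then show ?thesis using J[of j] unfolding W_def J_def by blast
qed

text \<open>Bob plays against Alice's winning strategy and keeps his interval \<open>light\<close>:
  the weight it meets stays below the \<open>s\<close>-th power of the length of his next interval.
  Each member met is then shorter than that interval, so \<open>light_child\<close> divides the
  weight by \<open>N\<close>, while the power of the length drops only by the factor
  \<open>(\<alpha> * \<beta>) powr s\<close>, which is at least \<open>1 / N\<close>. The weight met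
  tends to 0 and every \<open>w i\<close> is positive, so the limit point escapes each
  member.\<close>

lemma ab_winning_meets_everything:
  fixes S :: "real set" and U :: "nat \<Rightarrow> real set" and w :: "nat \<Rightarrow> real"
  assumes win: "ab_winning 1 {l..u} a b S" and ab: "a > 0" "b > 0"
    and N: "N > 0" "exp (- b) = 1 / (2 * real N)" and s: "0 < s" and Ns: "1 \<le> real N * (exp (- a) * exp (- b)) powr s"
    and x0: "l \<le> x0" "h0 > 0" "x0 + h0 \<le> u" "h0 < u - l"
    and w: "\<And>i. 0 < w i" "summable w" "\<And>i. diameter (U i) powr s \<le> w i" "\<And>i. bounded (U i)"
    and sum: "(\<Sum>i. w i) < (exp (- a) * exp (- b) * h0) powr s"
  shows "\<exists>t\<in>S. t \<in> {x0..x0 + h0} \<and> (\<forall>i. t \<notin> U i)"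
proof -
  define \<alpha> where "\<alpha> = exp (- a)"
  define \<beta> where "\<beta> = exp (- b)"
  have \<alpha>: "0 < \<alpha>" "\<alpha> < 1" and \<beta>: "0 < \<beta>" "\<beta> < 1" using ab by (auto simp: \<alpha>_def \<beta>_def)
  define W where "W A = (\<Sum>i. w i * of_bool (U i \<inter> A \<noteq> {}))" for A
  have w0: "0 \<le> w i" for i using w(1)[of i] by simp
  have summ: "summable (\<lambda>i. w i * of_bool (U i \<inter> A \<noteq> {}))" for A
    by (rule summable_comparison_test'[OF w(2), of 0]) (use w0 in auto)
  have w_le_W: "w i \<le> W A" if "U i \<inter> A \<noteq> {}" for i A
  proof -
    have "(\<Sum>j\<in>{i}. w j * of_bool (U j \<inter> A \<noteq> {})) \<le> W A"
      unfolding W_def using summ w0 by (intro sum_le_suminf) auto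
    then show ?thesis using that by simp
  qed
  define light where "light B \<longleftrightarrow> (\<exists>x y. x < y \<and> B = {x..y} \<and> W B < (\<alpha> * \<beta> * (y - x)) powr s)" for B
  obtain st where st: "\<forall>Bs. (\<forall>n. (\<forall>k\<le>n. bob_legal 1 {l..u} b st Bs k) \<longrightarrow> legal_move 1 a (Bs n) (alice_move st Bs n)) \<and>
      ((\<forall>k. bob_legal 1 {l..u} b st Bs k) \<longrightarrow> (\<exists>x\<in>S. (\<Inter>k. alice_move st Bs k) = {x}))"
    using win unfolding ab_winning_def by (rule exE)
  have st1: "legal_move 1 a (Bs n) (alice_move st Bs n)" if "\<forall>k\<le>n. bob_legal 1 {l..u} b st Bs k" for Bs n
    using st that by blast
  have st2: "\<exists>x\<in>S. (\<Inter>k. alice_move st Bs k) = {x}" if "\<forall>k. bob_legal 1 {l..u} b st Bs k" for Bs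
    using st that by blast
  have reply: "\<exists>Y. legal_move 1 b A Y \<and> light Y \<and> diameter Y = \<alpha> * \<beta> * diameter B \<and> real N * W Y \<le> W B"
    if B: "light B" and A: "legal_move 1 a B A" for A B
  proof -
    obtain x y where xy: "x < y" "B = {x..y}" "W B < (\<alpha> * \<beta> * (y - x)) powr s" using B unfolding light_def by blast
    obtain z where z: "A = {z..z + \<alpha> * (y - x)}" "x \<le> z" "z + \<alpha> * (y - x) \<le> y"
      using A[unfolded xy(2) legal_move_Icc[OF less_imp_le[OF xy(1)]]] unfolding \<alpha>_def mult_1 by blast
    define g where "g = \<alpha> * (y - x) / (2 * real N)"
    have g: "g = \<beta> * (\<alpha> * (y - x))" "g > 0" using N xy(1) \<alpha> by (auto simp: g_def \<beta>_def)
    have AB: "A \<subseteq> B" unfolding z(1) xy(2) using z(2,3) by auto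
    have "\<exists>z'\<ge>z. z' + g \<le> z + \<alpha> * (y - x) \<and>
      real N * (\<Sum>i. w i * of_bool (U i \<inter> {z'..z' + g} \<noteq> {})) \<le> (\<Sum>i. w i * of_bool (U i \<inter> {z..z + \<alpha> * (y - x)} \<noteq> {}))"
    proof (rule light_child)
      fix i t t' assume *: "U i \<inter> {z..z + \<alpha> * (y - x)} \<noteq> {}" "t \<in> U i" "t' \<in> U i"
      have "U i \<inter> B \<noteq> {}" using *(1) AB z(1) by blast
      then have "diameter (U i) powr s < (\<alpha> * \<beta> * (y - x)) powr s"
        using w(3)[of i] w_le_W[of i B] xy(3) by linarith
      then have "diameter (U i) < \<alpha> * \<beta> * (y - x)"
        using s xy(1) \<alpha> \<beta> powr_mono2[of s "\<alpha> * \<beta> * (y - x)" "diameter (U i)"] by (force simp: not_le[symmetric])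
      moreover have "dist t t' \<le> diameter (U i)" using diameter_bounded_bound[OF w(4) *(2,3)] .
      ultimately show "\<bar>t - t'\<bar> < g" by (simp add: g(1) dist_real_def mult_ac)
    qed (use xy(1) \<alpha> N w0 w(2) in \<open>auto simp: g_def\<close>)
    then obtain z' where z': "z \<le> z'" "z' + g \<le> z + \<alpha> * (y - x)" "real N * W {z'..z' + g} \<le> W A"
      unfolding W_def z(1) by blast
    have WAB: "W A \<le> W B" unfolding W_def using AB w0 summ by (intro suminf_le mult_left_mono) auto
    have "real N * W {z'..z' + g} < (\<alpha> * \<beta> * (y - x)) powr s" using z'(3) WAB xy(3) by linarith
    also have "\<dots> \<le> (real N * (\<alpha> * \<beta>) powr s) * (\<alpha> * \<beta> * (y - x)) powr s"
      using Ns by (simp add: \<alpha>_def \<beta>_def mult_le_cancel_right1)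
    also have "\<dots> = real N * (\<alpha> * \<beta> * g) powr s"
      using \<alpha> \<beta> xy(1) by (simp add: g(1) powr_mult mult_ac)
    finally have "W {z'..z' + g} < (\<alpha> * \<beta> * g) powr s" using N(1) by simp
    then have "light {z'..z' + g}" unfolding light_def using g(2)
      by (intro exI[of _ z'] exI[of _ "z' + g"]) simp
    moreover have "legal_move 1 b A {z'..z' + g}"
      using legal_move_Icc[of z "z + \<alpha> * (y - x)" 1 b "{z'..z' + g}"] z' z(1) xy(1) \<alpha>
      by (auto simp: g(1) \<beta>_def)
    moreover have "diameter {z'..z' + g} = \<alpha> * \<beta> * diameter B"
      using g xy(1,2) by (simp add: diameter_closed_interval)
    ultimately show ?thesis using z'(3) WAB by (intro exI[of _ "{z'..z' + g}"]) auto
  qed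
  define B0 where "B0 = {x0..x0 + h0}"
  have light0: "light B0"
  proof -
    have "W B0 \<le> (\<Sum>i. w i)" unfolding W_def using summ w(2) w0 by (intro suminf_le) auto
    then have "W B0 < (\<alpha> * \<beta> * h0) powr s" using sum by (simp add: \<alpha>_def \<beta>_def)
    then show ?thesis unfolding light_def B0_def using x0(2) by (intro exI[of _ x0] exI[of _ "x0 + h0"]) simp
  qed
  have legal0: "\<exists>t>0. legal_move 1 t {l..u} B0"
  proof -
    define t where "t = - ln (h0 / (u - l))"
    have "h0 / (u - l) < 1" "0 < h0 / (u - l)" using x0 by auto
    then have "t > 0" "exp (- t) = h0 / (u - l)" unfolding t_def by auto
    moreover have "exp (- t) * (u - l) = h0" using x0 \<open>exp (- t) = h0 / (u - l)\<close> by simp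
    ultimately show ?thesis
      using legal_move_Icc[of l u 1 t B0] x0 by (intro exI[of _ t]) (auto simp: B0_def)
  qed
  define next_move where "next_move B A = (SOME Y. legal_move 1 b A Y \<and> light Y \<and>
    diameter Y = \<alpha> * \<beta> * diameter B \<and> real N * W Y \<le> W B)" for B A
  \<comment> \<open>Alice's strategy reads the list of Bob's moves, so the play is built as a list
    and the sequence \<open>Bs\<close> is extracted from it.\<close>
  define hist where "hist = rec_nat [B0] (\<lambda>_ h. h @ [next_move (last h) (st h)])"
  have hist_0: "hist 0 = [B0]" and hist_Suc: "hist (Suc k) = hist k @ [next_move (last (hist k)) (st (hist k))]" for k
    by (simp_all add: hist_def)
  define Bs where "Bs k = last (hist k)" for k
  have map_Bs: "map Bs [0..<Suc k] = hist k" for k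
    by (induction k) (simp_all add: Bs_def hist_0 hist_Suc)
  have alice: "alice_move st Bs k = st (hist k)" for k by (simp only: alice_move_def map_Bs)
  have Bs_0: "Bs 0 = B0" by (simp add: Bs_def hist_0)
  have Bs_Suc: "Bs (Suc k) = next_move (Bs k) (alice_move st Bs k)" for k
    by (simp add: Bs_def hist_Suc alice)
  have main: "(\<forall>j\<le>k. bob_legal 1 {l..u} b st Bs j) \<and> light (Bs k)" for k
  proof (induction k)
    case 0
    then show ?case using legal0 light0 by (simp add: Bs_0)
  next
    case (Suc k)
    then have "legal_move 1 a (Bs k) (alice_move st Bs k)" using st1 by blast
    then have "\<exists>Y. legal_move 1 b (alice_move st Bs k) Y \<and> light Y \<and>
        diameter Y = \<alpha> * \<beta> * diameter (Bs k) \<and> real N * W Y \<le> W (Bs k)" using reply Suc by blast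
    from someI_ex[OF this] have "legal_move 1 b (alice_move st Bs k) (Bs (Suc k)) \<and> light (Bs (Suc k))"
      unfolding Bs_Suc next_move_def by blast
    then show ?case using Suc by (auto simp: le_Suc_eq)
  qed
  have moves: "legal_move 1 a (Bs k) (alice_move st Bs k)" for k using main[of k] st1 by blast
  have W_dec: "real N * W (Bs (Suc k)) \<le> W (Bs k)" for k
  proof -
    have "\<exists>Y. legal_move 1 b (alice_move st Bs k) Y \<and> light Y \<and>
        diameter Y = \<alpha> * \<beta> * diameter (Bs k) \<and> real N * W Y \<le> W (Bs k)"
      by (rule reply[OF conjunct2[OF main[of k]] moves[of k]])
    from someI_ex[OF this] show ?thesis unfolding Bs_Suc next_move_def by blast
  qed
  \<comment> \<open>The weights decay only if \<open>N\<close> exceeds 1; \<open>Ns\<close> excludes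
    1 because the contraction factor is below 1.\<close>
  have "2 \<le> real N \<or> N = 1" using N(1) by linarith
  moreover have "N \<noteq> 1"
  proof
    assume "N = 1"
    then have "1 \<le> (\<alpha> * \<beta>) powr s" using Ns by (simp add: \<alpha>_def \<beta>_def)
    moreover have "(\<alpha> * \<beta>) powr s < 1 powr s"
      using s \<alpha> \<beta> mult_strict_mono[of \<alpha> 1 \<beta> 1] by (intro powr_less_mono2) auto
    ultimately show False by simp
  qed
  ultimately have N2: "2 \<le> real N" by blast
  have W_nonneg: "0 \<le> W A" for A unfolding W_def using w0 summ by (intro suminf_nonneg) auto
  have W_pow: "W (Bs k) \<le> W B0 * (1 / 2) ^ k" for k
  proof (induction k)
    case (Suc k)
    have "2 * W (Bs (Suc k)) \<le> real N * W (Bs (Suc k))" using N2 W_nonneg by (intro mult_right_mono) auto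
    then have "W (Bs (Suc k)) \<le> W (Bs k) / 2" using W_dec[of k] by simp
    then show ?case using Suc by simp
  qed (simp add: Bs_0)
  obtain t where t: "t \<in> S" "(\<Inter>k. alice_move st Bs k) = {t}" using st2[of Bs] main by blast
  have tB: "t \<in> Bs k" for k
  proof -
    have "t \<in> alice_move st Bs k" using t(2) by blast
    moreover have "alice_move st Bs k \<subseteq> Bs k" using moves[of k] by (simp add: legal_move_def)
    ultimately show ?thesis by blast
  qed
  have "t \<notin> U i" for i
  proof
    assume "t \<in> U i"
    then have "w i \<le> W (Bs k)" for k using tB[of k] \<open>t \<in> U i\<close> by (intro w_le_W) blast
    then have "w i \<le> W B0 * (1 / 2) ^ k" for k using order_trans[OF _ W_pow[of k]] by blast
    moreover have "(\<lambda>k. W B0 * (1 / 2) ^ k) \<longlonglongrightarrow> W B0 * 0"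
      by (intro tendsto_intros LIMSEQ_power_zero) simp
    ultimately have "w i \<le> 0" by (intro LIMSEQ_le_const[of _ _ "w i"]) auto
    then show False using w(1)[of i] by simp
  qed
  then show ?thesis using t(1) tB[of 0] by (auto simp: Bs_0 B0_def)
qed

lemma winning_hausdorff_measure_pos:
  assumes win: "winning 1 {l..u} S" and lu: "l < u" and d: "0 < d" "d < 1"
    and x0: "l \<le> x0" "h0 > 0" "x0 + h0 \<le> u" "h0 < u - l"
  shows "hausdorff_measure d (S \<inter> {x0..x0 + h0}) \<noteq> 0"
proof
  assume null: "hausdorff_measure d (S \<inter> {x0..x0 + h0}) = 0"
  obtain a where a: "a > 0" "\<And>b. b > 0 \<Longrightarrow> ab_winning 1 {l..u} a b S"
    using win unfolding winning_def a_winning_def by blast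
  \<comment> \<open>With \<open>exp (- b) = 1 / (2 * real N)\<close> the condition on
    \<open>N\<close> needed against the strategy reads
    \<open>real N powr (1 - d) \<ge> (2 / exp (- a)) powr d\<close>. Large \<open>N\<close> satisfy
    it since \<open>d < 1\<close>. As \<open>b\<close> is determined by \<open>N\<close>, a strategy
    must be available for every \<open>b\<close>.\<close>
  define C where "C = (2 / exp (- a)) powr d"
  have C: "C > 0" by (simp add: C_def)
  have "(\<lambda>n. real n powr (- (1 - d))) \<longlonglongrightarrow> 0"
    using d by (intro tendsto_neg_powr filterlim_real_sequentially) auto
  then have "\<forall>\<^sub>F n in sequentially. real n powr (- (1 - d)) < 1 / C"
    using C by (intro order_tendstoD) auto
  moreover have "\<forall>\<^sub>F n in sequentially. n > (0::nat)" by (rule eventually_gt_at_top)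
  ultimately have "\<forall>\<^sub>F n in sequentially. real n powr (- (1 - d)) < 1 / C \<and> n > 0"
    by (rule eventually_conj)
  then obtain N where N': "real N powr (- (1 - d)) < 1 / C" "N > 0"
    using eventually_happens'[OF sequentially_bot] by blast
  then have "inverse (real N powr (1 - d)) < inverse C" by (simp only: powr_minus inverse_eq_divide)
  then have N: "real N powr (1 - d) \<ge> (2 / exp (- a)) powr d" "N > 0"
    using C N'(2) by (auto simp: C_def dest: inverse_less_imp_less)
  define b where "b = ln (2 * real N)"
  have b: "b > 0" "exp (- b) = 1 / (2 * real N)"
    using N(2) by (auto simp: b_def exp_minus inverse_eq_divide)
  have "1 \<le> real N powr (1 - d) / (2 / exp (- a)) powr d" using N by (simp add: field_simps)
  also have "\<dots> = real N * (exp (- a) * exp (- b)) powr d"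
    using N(2) by (simp add: b(2) powr_diff powr_divide powr_mult)
  finally have Nd: "1 \<le> real N * (exp (- a) * exp (- b)) powr d" .
  define e where "e = (exp (- a) * exp (- b) * h0) powr d"
  have e: "e > 0" using x0(2) by (simp add: e_def)
  then have e4: "0 < e / 4" by simp
  obtain U :: "nat \<Rightarrow> real set" where U: "S \<inter> {x0..x0 + h0} \<subseteq> (\<Union>i. U i)" "\<And>i. bounded (U i)"
    "(\<Sum>i. ennreal (diameter (U i) powr d)) < ennreal (e / 4)"
    using null[unfolded hausdorff_measure_null_iff, rule_format, OF e4 e4] by blast
  have summ: "summable (\<lambda>i. diameter (U i) powr d)"
    using U(3) by (intro summable_suminf_not_top) auto
  have "ennreal (\<Sum>i. diameter (U i) powr d) < ennreal (e / 4)"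
    using U(3) summ by (subst suminf_ennreal2[symmetric]) auto
  then have small: "(\<Sum>i. diameter (U i) powr d) < e / 4"
    using e by (simp add: ennreal_less_iff suminf_nonneg summ)
  \<comment> \<open>The geometric term gives positive weight also to members of diameter 0; the
    total stays below \<open>e / 4 + e / 2\<close>.\<close>
  define w where "w i = diameter (U i) powr d + e / 4 * (1 / 2) ^ i" for i
  have geo: "summable (\<lambda>i. e / 4 * (1 / 2) ^ i)" by (intro summable_mult summable_geometric) simp
  have "(\<Sum>i. e / 4 * (1 / 2 :: real) ^ i) = e / 2"
    by (subst suminf_mult) (auto simp: suminf_geometric intro!: summable_geometric)
  then have "(\<Sum>i. w i) = (\<Sum>i. diameter (U i) powr d) + e / 2"
    unfolding w_def using suminf_add[OF summ geo] by simp
  then have w_sum: "(\<Sum>i. w i) < e" using small e by linarith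
  have "\<exists>t\<in>S. t \<in> {x0..x0 + h0} \<and> (\<forall>i. t \<notin> U i)"
  proof (rule ab_winning_meets_everything[OF a(2)[OF b(1)] a(1) b(1) N(2) b(2) d(1) Nd x0])
    show "0 < w i" for i using e by (simp add: w_def add_nonneg_pos)
    show "summable w" unfolding w_def using summ geo by (rule summable_add)
    show "(\<Sum>i. w i) < (exp (- a) * exp (- b) * h0) powr d" using w_sum by (simp add: e_def)
  qed (use e U(2) in \<open>auto simp: w_def\<close>)
  then show False using U(1) by blast
qed

lemma winning_thick:
  assumes win: "winning 1 {l..u} S" and lu: "l < u" and S: "S \<subseteq> {l..u}"
  shows "thick_in {l..u} S"
  unfolding thick_in_def
proof (intro conjI allI impI S)
  fix U assume U: "openin (top_of_set {l..u}) U \<and> U \<noteq> {}"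
  then obtain T where T: "open T" "U = {l..u} \<inter> T" unfolding openin_open by blast
  \<comment> \<open>An interior point leaves room for a first move of Bob inside the given open
    set.\<close>
  obtain c where c: "c \<in> T" "l < c" "c < u"
  proof -
    obtain x where x: "x \<in> T" "x \<in> {l..u}" using U T by blast
    have "x \<in> closure {l<..<u}" using x lu by simp
    then have "T \<inter> {l<..<u} \<noteq> {}" using T(1) x(1) by (meson open_Int_closure_eq_empty disjoint_iff)
    then show thesis using that by auto
  qed
  have "open (T \<inter> {l<..<u})" using T(1) by (intro open_Int) auto
  moreover have "c \<in> T \<inter> {l<..<u}" using c by simp
  ultimately obtain e where e: "e > 0" "cball c e \<subseteq> T \<inter> {l<..<u}"
    unfolding open_contains_cball by blast
  have sub: "{c..c + e} \<subseteq> T \<inter> {l<..<u}" using e by (auto simp: cball_def dist_real_def subset_iff)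
  have "c + e \<in> {l<..<u}" using subsetD[OF sub, of "c + e"] e(1) by simp
  then have "c + e < u" by simp
  have "ereal 1 \<le> hausdorff_dim (S \<inter> {c..c + e})"
    using winning_hausdorff_measure_pos[OF win lu, of _ c e] c e(1) \<open>c + e < u\<close>
    by (intro hausdorff_dim_geI) auto
  also have "\<dots> \<le> hausdorff_dim (S \<inter> U)" using sub T(2) by (intro hausdorff_dim_mono) auto
  finally have "hausdorff_dim {l..u} \<le> hausdorff_dim (S \<inter> U)"
    using hausdorff_dim_Icc_le_1[OF lu] by (simp add: one_ereal_def)
  moreover have "hausdorff_dim (S \<inter> U) \<le> hausdorff_dim {l..u}" using S by (intro hausdorff_dim_mono) auto
  ultimately show "hausdorff_dim (S \<inter> U) = hausdorff_dim {l..u}" by simp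
qed

section \<open>Very well approximable points\<close>

context diophantine_curve_on begin

text \<open>Rational end points make the family countable; the empty set is included so that it can
  be enumerated in any case.\<close>

lemma good_pieces_cover: "\<exists>J :: nat \<Rightarrow> real set. (\<forall>i. good_piece (J i)) \<and> (\<forall>i. J i \<subseteq> {l..u}) \<and> {l..u} - Z \<subseteq> (\<Union>i. J i)"
proof -
  define F where "F = insert {} {J. good_piece J \<and> (\<exists>x\<in>\<rat>. \<exists>y\<in>\<rat>. J = {x..y} \<inter> {l..u})}"
  have "F \<subseteq> insert {} ((\<lambda>(x, y). {x..y} \<inter> {l..u}) ` (\<rat> \<times> \<rat>))" unfolding F_def by auto
  then have count: "countable F" by (rule countable_subset) (intro countable_insert countable_image countable_SIGMA countable_rat)
  have "good 1 {}" by (simp add: good_def)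
  then have good: "good_piece J" if "J \<in> F" for J using that by (auto simp: F_def good_piece_def)
  have F: "from_nat_into F i \<in> F" for i by (rule from_nat_into) (simp add: F_def)
  show ?thesis
  proof (intro exI[of _ "from_nat_into F"] conjI allI)
    show "good_piece (from_nat_into F i)" for i using good F by blast
    show "from_nat_into F i \<subseteq> {l..u}" for i using F[of i] by (auto simp: F_def)
    show "{l..u} - Z \<subseteq> (\<Union>i. from_nat_into F i)"
    proof
      fix t assume t: "t \<in> {l..u} - Z"
      then obtain \<delta> C where \<delta>: "\<delta> > 0" "good C ({t - \<delta>..t + \<delta>} \<inter> {l..u})" using locally_good by blast
      obtain x where x: "x \<in> \<rat>" "t - \<delta> < x" "x < t" using Rats_dense_in_real[of "t - \<delta>" t] \<delta>(1) by auto
      obtain y where y: "y \<in> \<rat>" "t < y" "y < t + \<delta>" using Rats_dense_in_real[of t "t + \<delta>"] \<delta>(1) by auto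
      have "good C ({x..y} \<inter> {l..u})" by (rule good_subset[OF \<delta>(2)]) (use x y in auto)
      then have "{x..y} \<inter> {l..u} \<in> F" using x(1) y(1) by (auto simp: F_def good_piece_def)
      moreover have "t \<in> {x..y} \<inter> {l..u}" using t x y by auto
      ultimately show "t \<in> (\<Union>i. from_nat_into F i)"
        using range_from_nat_into[OF _ count] by (metis UN_iff empty_iff imageE)
    qed
  qed
qed

text \<open>Discreteness from the norm alone: two integers whose values lie in the same boxes of
  side 1 / 2 differ by less than 1 at every place, so by \<open>Q_ge_1\<close> they are equal, and
  only finitely many boxes occur.\<close>

lemma finite_bounded_integers: "finite {q \<in> ring_of_integers. \<forall>\<sigma>\<in>\<Sigma>. cmod (\<sigma> q) \<le> X \<sigma>}"
proof (rule inj_on_finite)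
  define f where "f q = (\<lambda>\<sigma>\<in>\<Sigma>. (\<lfloor>2 * Re (\<sigma> q)\<rfloor>, \<lfloor>2 * Im (\<sigma> q)\<rfloor>))" for q :: 'k
  let ?T = "\<Pi>\<^sub>E \<sigma>\<in>\<Sigma>. {- \<lceil>2 * X \<sigma>\<rceil>..\<lceil>2 * X \<sigma>\<rceil>} \<times> {- \<lceil>2 * X \<sigma>\<rceil>..\<lceil>2 * X \<sigma>\<rceil>}"
  show "finite ?T" using fin\<Sigma> by (intro finite_PiE) auto
  show "f ` {q \<in> ring_of_integers. \<forall>\<sigma>\<in>\<Sigma>. cmod (\<sigma> q) \<le> X \<sigma>} \<subseteq> ?T"
  proof (clarify, unfold f_def restrict_PiE_iff, intro ballI)
    fix q \<sigma> assume *: "\<forall>\<sigma>\<in>\<Sigma>. cmod (\<sigma> q) \<le> X \<sigma>" "\<sigma> \<in> \<Sigma>"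
    have "\<bar>Re (\<sigma> q)\<bar> \<le> X \<sigma>" "\<bar>Im (\<sigma> q)\<bar> \<le> X \<sigma>"
      using * abs_Re_le_cmod[of "\<sigma> q"] abs_Im_le_cmod[of "\<sigma> q"] order_trans by blast+
    moreover have "y \<in> {- \<lceil>2 * X \<sigma>\<rceil>..\<lceil>2 * X \<sigma>\<rceil>}" if "y = \<lfloor>2 * z\<rfloor>" "\<bar>z\<bar> \<le> X \<sigma>" for y z
      using that by (simp; linarith)
    ultimately show "(\<lfloor>2 * Re (\<sigma> q)\<rfloor>, \<lfloor>2 * Im (\<sigma> q)\<rfloor>) \<in> {- \<lceil>2 * X \<sigma>\<rceil>..\<lceil>2 * X \<sigma>\<rceil>} \<times> {- \<lceil>2 * X \<sigma>\<rceil>..\<lceil>2 * X \<sigma>\<rceil>}"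
      by blast
  qed
  show "inj_on f {q \<in> ring_of_integers. \<forall>\<sigma>\<in>\<Sigma>. cmod (\<sigma> q) \<le> X \<sigma>}"
  proof (rule inj_onI, rule ccontr)
    fix q q' assume q: "q \<in> {q \<in> ring_of_integers. \<forall>\<sigma>\<in>\<Sigma>. cmod (\<sigma> q) \<le> X \<sigma>}"
      "q' \<in> {q \<in> ring_of_integers. \<forall>\<sigma>\<in>\<Sigma>. cmod (\<sigma> q) \<le> X \<sigma>}" "f q = f q'" "q \<noteq> q'"
    have "cmod (\<sigma> (q - q')) < 1" if \<sigma>: "\<sigma> \<in> \<Sigma>" for \<sigma>
    proof -
      interpret field_char_0_hom \<sigma> using emb[OF \<sigma>] by (rule embedding_field_hom)
      have "\<lfloor>2 * Re (\<sigma> q)\<rfloor> = \<lfloor>2 * Re (\<sigma> q')\<rfloor>" "\<lfloor>2 * Im (\<sigma> q)\<rfloor> = \<lfloor>2 * Im (\<sigma> q')\<rfloor>"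
        using fun_cong[OF q(3), of \<sigma>] \<sigma> by (auto simp: f_def)
      moreover have "\<bar>x - y\<bar> < 1 / 2" if "\<lfloor>2 * x\<rfloor> = \<lfloor>2 * y\<rfloor>" for x y :: real
        using that floor_correct[of "2 * x"] floor_correct[of "2 * y"] by linarith
      ultimately have "\<bar>Re (\<sigma> q) - Re (\<sigma> q')\<bar> < 1 / 2" "\<bar>Im (\<sigma> q) - Im (\<sigma> q')\<bar> < 1 / 2" by blast+
      then have "\<bar>Re (\<sigma> q - \<sigma> q')\<bar> < 1 / 2" "\<bar>Im (\<sigma> q - \<sigma> q')\<bar> < 1 / 2" by simp_all
      then have "cmod (\<sigma> q - \<sigma> q') < 1" using cmod_le[of "\<sigma> q - \<sigma> q'"] by linarith
      then show ?thesis by (simp add: hom_minus)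
    qed
    then have "Q (q - q') < 1"
      unfolding Q_def max_norm_def using fin\<Sigma> \<Sigma>_nonempty by (subst Max_less_iff) auto
    moreover have "1 \<le> Q (q - q')"
      using q by (intro Q_ge_1 ring_of_integers_closed) auto
    ultimately show False by simp
  qed
qed

lemma finite_approximations:
  "finite {(p, q). p \<in> ring_of_integers \<and> q \<in> ring_of_integers \<and> Q q \<le> X \<and> (\<forall>\<sigma>\<in>\<Sigma>. lin p q t \<sigma> \<le> 1)}"
proof (rule finite_subset)
  let ?A = "{q \<in> ring_of_integers. \<forall>\<sigma>\<in>\<Sigma>. cmod (\<sigma> q) \<le> X}"
  let ?B = "{p \<in> ring_of_integers. \<forall>\<sigma>\<in>\<Sigma>. cmod (\<sigma> p) \<le> 1 + cmod (\<phi> t \<sigma>) * X}"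
  show "finite (?B \<times> ?A)"
    using finite_bounded_integers[of "\<lambda>_. X"] finite_bounded_integers[of "\<lambda>\<sigma>. 1 + cmod (\<phi> t \<sigma>) * X"]
    by (rule finite_cartesian_product[rotated])
  show "{(p, q). p \<in> ring_of_integers \<and> q \<in> ring_of_integers \<and> Q q \<le> X \<and> (\<forall>\<sigma>\<in>\<Sigma>. lin p q t \<sigma> \<le> 1)} \<subseteq> ?B \<times> ?A"
  proof (rule subsetI)
    fix z assume "z \<in> {(p, q). p \<in> ring_of_integers \<and> q \<in> ring_of_integers \<and> Q q \<le> X \<and> (\<forall>\<sigma>\<in>\<Sigma>. lin p q t \<sigma> \<le> 1)}"
    then obtain p q where z: "z = (p, q)" and pq: "p \<in> ring_of_integers" "q \<in> ring_of_integers" "Q q \<le> X"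
      "\<forall>\<sigma>\<in>\<Sigma>. lin p q t \<sigma> \<le> 1" by blast
    have q: "cmod (\<sigma> q) \<le> X" if "\<sigma> \<in> \<Sigma>" for \<sigma> using cmod_le_Q[OF that, of q] pq(3) by simp
    have "cmod (\<sigma> p) \<le> 1 + cmod (\<phi> t \<sigma>) * X" if \<sigma>: "\<sigma> \<in> \<Sigma>" for \<sigma>
    proof -
      have "cmod (\<sigma> p) \<le> lin p q t \<sigma> + cmod (\<phi> t \<sigma> * \<sigma> q)"
        unfolding lin_def using norm_triangle_ineq4[of "\<sigma> p + \<phi> t \<sigma> * \<sigma> q" "\<phi> t \<sigma> * \<sigma> q"] by simp
      also have "\<dots> \<le> 1 + cmod (\<phi> t \<sigma>) * X"
        unfolding norm_mult using pq(4) \<sigma> q[OF \<sigma>] by (intro add_mono mult_left_mono) auto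
      finally show ?thesis .
    qed
    then show "z \<in> ?B \<times> ?A" using pq q by (auto simp: z)
  qed
qed

definition vwa_class :: "real \<Rightarrow> nat \<Rightarrow> real \<Rightarrow> bool" where
  "vwa_class \<gamma> k t \<longleftrightarrow> (\<exists>p q. p \<in> ring_of_integers \<and> q \<in> ring_of_integers \<and> q \<noteq> 0 \<and>
     2 ^ k \<le> Q q * R q \<and> Q q * R q < 2 ^ Suc k \<and> (\<forall>\<sigma>\<in>\<Sigma>. lin p q t \<sigma> \<le> Q q powr (- \<gamma>) / Q q))"

text \<open>At complexity about \<open>2 ^ k\<close> the curve is cut into pieces of length \<rho>,
  of the order of \<open>2 ^ k\<close> many. On each piece the bad parameters lie in
  \<open>card M\<close> sets of diameter at most a constant times \<open>\<epsilon> / 2 ^ k\<close>,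
  so the total is of order \<epsilon>, geometric in \<open>k\<close>.\<close>

lemma vwa_class_cover:
  assumes good: "good C J" and J: "J \<subseteq> {l..u}" and \<gamma>: "\<gamma> > 0" and c: "c = 1 / (16 * C)"
    and k: "2 powr (- \<gamma> / 2 * real k) \<le> c"
  shows "\<exists>V. V \<in> sets lborel \<and> {t \<in> J. vwa_class \<gamma> k t} \<subseteq> V \<and>
    emeasure lborel V \<le> ennreal ((2 * (u - l) / c + 1) * (4 * C * card M) * (2 powr (- \<gamma> / 2)) ^ k)"
proof -
  \<comment> \<open>Since \<open>R q \<le> Q q\<close>, complexity at least \<open>2 ^ k\<close>
    makes \<open>Q q\<close> at least \<open>2 powr (k / 2)\<close>, hence
    \<open>Q q powr (- \<gamma>) \<le> \<epsilon>\<close>.\<close>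
  define \<epsilon> where "\<epsilon> = 2 powr (- \<gamma> / 2 * real k)"
  define \<rho> where "\<rho> = c / 2 ^ Suc k"
  have C: "1 \<le> C" using good by (rule good_ge_1)
  have c0: "0 < c" "4 * C * c < 1 / 2" "2 * c \<le> 1" using C by (auto simp: c field_simps)
  have \<rho>: "\<rho> > 0" using c0 by (simp add: \<rho>_def)
  have \<epsilon>: "0 < \<epsilon>" "\<epsilon> \<le> c" using k by (auto simp: \<epsilon>_def)
  have bad: "bad (1 / 2) c \<epsilon> \<rho> t" if t: "vwa_class \<gamma> k t" for t
  proof -
    obtain p q where pq: "p \<in> ring_of_integers" "q \<in> ring_of_integers" "q \<noteq> 0"
      "2 ^ k \<le> Q q * R q" "Q q * R q < 2 ^ Suc k" "\<And>\<sigma>. \<sigma> \<in> \<Sigma> \<Longrightarrow> lin p q t \<sigma> \<le> Q q powr (- \<gamma>) / Q q"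
      using t unfolding vwa_class_def by blast
    have Qq: "0 < Q q" by (rule Q_pos[OF pq(2,3)])
    have "2 powr real k \<le> Q q * Q q"
      using order_trans[OF pq(4) mult_left_mono[OF R_le_Q[of q] less_imp_le[OF Qq]]] by (simp add: powr_realpow)
    then have "2 powr real k \<le> Q q powr 2" using Qq by (simp add: powr_numeral power2_eq_square)
    then have "(Q q powr 2) powr (- \<gamma> / 2) \<le> (2 powr real k) powr (- \<gamma> / 2)"
      using \<gamma> by (intro powr_mono2') auto
    then have "Q q powr (- \<gamma>) \<le> \<epsilon>" by (simp add: powr_powr \<epsilon>_def mult.commute)
    then have "lin p q t \<sigma> \<le> \<epsilon> / Q q" if "\<sigma> \<in> \<Sigma>" for \<sigma>
      using pq(6)[OF that] Qq divide_right_mono[of "Q q powr (- \<gamma>)" \<epsilon> "Q q"] by linarith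
    moreover have "1 / 2 * c \<le> Q q * R q * \<rho>"
    proof -
      have "2 ^ k * \<rho> \<le> Q q * R q * \<rho>" using pq(4) \<rho> by (intro mult_right_mono) auto
      then show ?thesis by (simp add: \<rho>_def)
    qed
    moreover have "Q q * R q * \<rho> \<le> c"
    proof -
      have "Q q * R q * \<rho> \<le> 2 ^ Suc k * \<rho>" using pq(5) \<rho> by (intro mult_right_mono) auto
      then show ?thesis by (simp add: \<rho>_def)
    qed
    ultimately show ?thesis unfolding bad_def using pq(1-3) by blast
  qed
  define \<eta> where "\<eta> = 2 * C * (\<epsilon> * \<rho> / (1 / 2 * c))"
  have \<eta>: "0 \<le> \<eta>" using C \<epsilon> \<rho> c0 by (simp add: \<eta>_def)
  define P where "P i = {t \<in> J. \<lfloor>(t - l) / \<rho>\<rfloor> = int i}" for i :: nat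
  have P_near: "\<bar>t - t'\<bar> \<le> \<rho>" if "t \<in> P i" "t' \<in> P i" for i t t'
  proof -
    have "\<lfloor>(t - l) / \<rho>\<rfloor> = \<lfloor>(t' - l) / \<rho>\<rfloor>" using that by (simp add: P_def)
    then have "\<bar>(t - l) / \<rho> - (t' - l) / \<rho>\<bar> \<le> 1" by linarith
    moreover have "(t - l) / \<rho> - (t' - l) / \<rho> = (t - t') / \<rho>" by (simp add: diff_divide_distrib)
    ultimately show ?thesis using \<rho> by (simp add: abs_divide)
  qed
  have "\<exists>D. {t \<in> P i. bad (1 / 2) c \<epsilon> \<rho> t} \<subseteq> (\<Union>\<sigma>\<in>M. D \<sigma>) \<and>
      (\<forall>\<sigma>\<in>M. D \<sigma> \<subseteq> P i \<and> (\<forall>t\<in>D \<sigma>. \<forall>t'\<in>D \<sigma>. \<bar>t - t'\<bar> \<le> \<eta>))" for i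
    unfolding \<eta>_def
    by (rule bad_set_covered[OF good]) (use P_near \<rho> c0 \<epsilon> in \<open>auto simp: P_def\<close>)
  then obtain D where D: "\<And>i. {t \<in> P i. bad (1 / 2) c \<epsilon> \<rho> t} \<subseteq> (\<Union>\<sigma>\<in>M. D i \<sigma>)"
    "\<And>i \<sigma> t t'. \<sigma> \<in> M \<Longrightarrow> t \<in> D i \<sigma> \<Longrightarrow> t' \<in> D i \<sigma> \<Longrightarrow> \<bar>t - t'\<bar> \<le> \<eta>" by metis
  \<comment> \<open>A closed interval around a chosen member makes the cover measurable; for an
    empty \<open>D i \<sigma>\<close> the centre is arbitrary, which does no harm.\<close>
  define E where "E i \<sigma> = (let d = (SOME d. d \<in> D i \<sigma>) in {d - \<eta>..d + \<eta>})" for i \<sigma>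
  have DE: "D i \<sigma> \<subseteq> E i \<sigma>" if \<sigma>: "\<sigma> \<in> M" for i \<sigma>
  proof
    fix t assume t: "t \<in> D i \<sigma>"
    then have "(SOME d. d \<in> D i \<sigma>) \<in> D i \<sigma>" by (rule someI)
    then have "\<bar>t - (SOME d. d \<in> D i \<sigma>)\<bar> \<le> \<eta>" using D(2)[OF \<sigma> t] by blast
    then show "t \<in> E i \<sigma>" by (auto simp: E_def Let_def)
  qed
  have E: "E i \<sigma> \<in> sets lborel" "emeasure lborel (E i \<sigma>) = ennreal (2 * \<eta>)" for i \<sigma>
    using \<eta> by (auto simp: E_def Let_def)
  define L where "L = nat \<lfloor>(u - l) / \<rho>\<rfloor>"
  define V where "V = (\<Union>i\<in>{..L}. \<Union>\<sigma>\<in>M. E i \<sigma>)"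
  have "{t \<in> J. vwa_class \<gamma> k t} \<subseteq> V"
  proof clarify
    fix t assume t: "t \<in> J" "vwa_class \<gamma> k t"
    define i where "i = nat \<lfloor>(t - l) / \<rho>\<rfloor>"
    have "0 \<le> (t - l) / \<rho>" "(t - l) / \<rho> \<le> (u - l) / \<rho>"
      using t(1) J \<rho> by (auto intro!: divide_right_mono)
    then have "t \<in> P i" "i \<le> L"
      using t(1) by (auto simp: P_def i_def L_def intro!: nat_mono floor_mono)
    then obtain \<sigma> where \<sigma>: "\<sigma> \<in> M" "t \<in> D i \<sigma>" using subsetD[OF D(1)[of i], of t] bad[OF t(2)] by auto
    then have "t \<in> E i \<sigma>" using subsetD[OF DE] by blast
    then show "t \<in> V" using \<open>i \<le> L\<close> \<sigma>(1) unfolding V_def by blast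
  qed
  moreover have "V \<in> sets lborel" unfolding V_def using E(1) finM by (intro sets.finite_UN) auto
  moreover have "emeasure lborel V \<le> ennreal ((2 * (u - l) / c + 1) * (4 * C * card M) * (2 powr (- \<gamma> / 2)) ^ k)"
  proof -
    have "emeasure lborel V \<le> (\<Sum>i\<in>{..L}. emeasure lborel (\<Union>\<sigma>\<in>M. E i \<sigma>))"
      unfolding V_def using E(1) finM by (intro emeasure_subadditive_finite) (auto intro!: sets.finite_UN)
    also have "\<dots> \<le> (\<Sum>i\<in>{..L}. \<Sum>\<sigma>\<in>M. emeasure lborel (E i \<sigma>))"
      using E(1) finM by (intro sum_mono emeasure_subadditive_finite) auto
    also have "\<dots> = of_nat (Suc L * card M) * ennreal (2 * \<eta>)" by (simp add: E(2) algebra_simps)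
    also have "\<dots> = ennreal (real (Suc L) * (real (card M) * (2 * \<eta>)))"
      using \<eta> by (subst ennreal_of_nat_eq_real_of_nat) (simp add: ennreal_mult[symmetric] mult_ac algebra_simps)
    also have "\<dots> \<le> ennreal ((2 * (u - l) / c + 1) * (4 * C * card M) * (2 powr (- \<gamma> / 2)) ^ k)"
    proof (rule ennreal_leI)
      have \<eta>': "\<eta> = 2 * C * \<epsilon> / 2 ^ k" using c0 by (simp add: \<eta>_def \<rho>_def field_simps)
      have "real L \<le> (u - l) / \<rho>" using lu \<rho> by (simp add: L_def)
      then have "real (Suc L) \<le> (u - l) / \<rho> + 1" by simp
      also have "\<dots> \<le> (2 * (u - l) / c + 1) * 2 ^ k" using c0 by (simp add: \<rho>_def field_simps)
      finally have "real (Suc L) * (real (card M) * (2 * \<eta>)) \<le> (2 * (u - l) / c + 1) * 2 ^ k * (real (card M) * (2 * \<eta>))"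
        using \<eta> by (intro mult_right_mono) auto
      also have "\<dots> = (2 * (u - l) / c + 1) * (4 * C * card M) * \<epsilon>" by (simp add: \<eta>')
      also have "\<epsilon> = (2 powr (- \<gamma> / 2)) ^ k"
        using powr_realpow[of "2 powr (- \<gamma> / 2)" k] by (simp only: \<epsilon>_def powr_powr) simp
      finally show "real (Suc L) * (real (card M) * (2 * \<eta>)) \<le> (2 * (u - l) / c + 1) * (4 * C * card M) * (2 powr (- \<gamma> / 2)) ^ k" .
    qed
    finally show ?thesis .
  qed
  ultimately show ?thesis by blast
qed

definition vwa :: "real \<Rightarrow> real \<Rightarrow> bool" where
  "vwa \<gamma> t \<longleftrightarrow> infinite {(p, q). p \<in> ring_of_integers \<and> q \<in> ring_of_integers \<and> q \<noteq> 0 \<and>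
     (\<forall>\<sigma>\<in>\<Sigma>. lin p q t \<sigma> \<le> Q q powr (- \<gamma>) / Q q)}"

text \<open>By \<open>Q_le_power_QR\<close> bounded complexity means bounded \<open>Q q\<close>, and
  a given point has only finitely many approximations with bounded \<open>Q q\<close>.\<close>

lemma vwa_frequently:
  assumes "vwa \<gamma> t" "\<gamma> > 0"
  shows "\<exists>k\<ge>k0. vwa_class \<gamma> k t"
proof (rule ccontr)
  assume none: "\<not> ?thesis"
  have "{(p, q). p \<in> ring_of_integers \<and> q \<in> ring_of_integers \<and> q \<noteq> 0 \<and>
     (\<forall>\<sigma>\<in>\<Sigma>. lin p q t \<sigma> \<le> Q q powr (- \<gamma>) / Q q)} \<subseteq>
    {(p, q). p \<in> ring_of_integers \<and> q \<in> ring_of_integers \<and> Q q \<le> (2 ^ k0) ^ m \<and> (\<forall>\<sigma>\<in>\<Sigma>. lin p q t \<sigma> \<le> 1)}"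
  proof clarify
    fix p q assume pq: "p \<in> ring_of_integers" "q \<in> ring_of_integers" "q \<noteq> 0"
      "\<forall>\<sigma>\<in>\<Sigma>. lin p q t \<sigma> \<le> Q q powr (- \<gamma>) / Q q"
    define X where "X = Q q * R q"
    have X: "1 \<le> X" unfolding X_def by (rule QR_ge_1[OF pq(2,3)])
    define k where "k = nat \<lfloor>log 2 X\<rfloor>"
    have "0 \<le> log 2 X" using X by simp
    then have "real k = real_of_int \<lfloor>log 2 X\<rfloor>" by (simp add: k_def)
    then have "real k \<le> log 2 X" "log 2 X < real k + 1" by linarith+
    then have "2 powr real k \<le> X" "X < 2 powr (real k + 1)" using X by (auto simp: le_log_iff log_less_iff)
    then have k: "2 ^ k \<le> X" "X < 2 ^ Suc k" by (simp_all add: powr_realpow powr_add mult.commute)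
    then have "vwa_class \<gamma> k t" unfolding vwa_class_def using pq by (intro exI[of _ p] exI[of _ q]) (simp add: X_def)
    then have "k < k0" using none by (meson not_le)
    then have "X \<le> 2 ^ k0" using k(2) power_increasing[of "Suc k" k0 "2::real"] by linarith
    then have "Q q \<le> (2 ^ k0) ^ m"
      using Q_le_power_QR[OF pq(2,3)] power_mono[of X "2 ^ k0" m] X unfolding X_def[symmetric] by linarith
    moreover have "Q q powr (- \<gamma>) / Q q \<le> 1"
    proof -
      have "Q q powr (- \<gamma>) \<le> Q q powr 0" using Q_ge_1[OF pq(2,3)] assms(2) by (intro powr_mono) auto
      then show ?thesis using Q_ge_1[OF pq(2,3)] by (simp add: pos_divide_le_eq)
    qed
    ultimately show "Q q \<le> (2 ^ k0) ^ m \<and> (\<forall>\<sigma>\<in>\<Sigma>. lin p q t \<sigma> \<le> 1)" using pq(4) order_trans by blast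
  qed
  then show False using finite_approximations[of "(2 ^ k0) ^ m" t] assms(1) finite_subset unfolding vwa_def by blast
qed

lemma vwa_negligible_on_good:
  assumes good: "good C J" and J: "J \<subseteq> {l..u}" and \<gamma>: "\<gamma> > 0"
  shows "negligible {t \<in> J. vwa \<gamma> t}"
proof -
  define c where "c = 1 / (16 * C)"
  have C: "1 \<le> C" using good by (rule good_ge_1)
  then have c0: "0 < c" by (simp add: c_def)
  define q where "q = 2 powr (- \<gamma> / 2)"
  have q: "0 < q" "q < 1" using \<gamma> powr_less_one[of 2 "- \<gamma> / 2"] by (auto simp: q_def)
  have qk: "2 powr (- \<gamma> / 2 * real k) = q ^ k" for k
    using powr_realpow[OF q(1), of k] by (simp only: q_def powr_powr)
  \<comment> \<open>Only from this class on is the precision fine enough for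
    \<open>vwa_class_cover\<close>; omitting finitely many classes does not affect
    Borel-Cantelli.\<close>
  obtain k1 where k1: "q ^ k1 < c" using real_arch_pow_inv[OF c0 q(2)] by blast
  have small: "q ^ k \<le> c" if "k1 \<le> k" for k
    using power_decreasing[OF that, of q] q k1 by linarith
  define B where "B = (2 * (u - l) / c + 1) * (4 * C * card M)"
  have B: "0 \<le> B" using C c0 lu by (simp add: B_def)
  have "\<forall>k. \<exists>V. V \<in> sets lborel \<and> {t \<in> J. vwa_class \<gamma> (k1 + k) t} \<subseteq> V \<and> emeasure lborel V \<le> ennreal (B * q ^ (k1 + k))"
    using vwa_class_cover[OF good J \<gamma> c_def, unfolded qk, OF small] unfolding B_def q_def[symmetric] by auto
  then obtain V where V: "\<And>k. V k \<in> sets lborel" "\<And>k. {t \<in> J. vwa_class \<gamma> (k1 + k) t} \<subseteq> V k"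
    "\<And>k. emeasure lborel (V k) \<le> ennreal (B * q ^ (k1 + k))" by metis
  have fin: "emeasure lborel (V k) < \<infinity>" for k using V(3)[of k] by (simp add: order_le_less_trans less_top)
  have "summable (\<lambda>k. measure lborel (V k))"
  proof (rule summable_comparison_test'[of "\<lambda>k. B * q ^ k1 * q ^ k" 0])
    show "summable (\<lambda>k. B * q ^ k1 * q ^ k)" using q by (intro summable_mult summable_geometric) simp
    show "norm (measure lborel (V k)) \<le> B * q ^ k1 * q ^ k" for k
      using enn2real_mono[OF V(3)[of k]] B q by (simp add: measure_def power_add mult.assoc)
  qed
  then have "limsup V \<in> null_sets lborel" using V(1) fin by (intro borel_cantelli_limsup1) auto
  then have "negligible (limsup V)"
    by (simp add: negligible_iff_null_sets null_sets_completionI)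
  moreover have "{t \<in> J. vwa \<gamma> t} \<subseteq> limsup V"
  proof clarify
    fix t assume t: "t \<in> J" "vwa \<gamma> t"
    have "\<exists>k\<ge>k0. t \<in> V k" for k0
    proof -
      obtain k where k: "k \<ge> k1 + k0" "vwa_class \<gamma> k t" using vwa_frequently[OF t(2) \<gamma>] by blast
      then have "t \<in> V (k - k1)" using V(2)[of "k - k1"] t(1) by auto
      then show ?thesis using k(1) by (intro exI[of _ "k - k1"]) simp
    qed
    then show "t \<in> limsup V" unfolding limsup_INF_SUP by (simp add: Bex_def)
  qed
  ultimately show ?thesis by (rule negligible_subset)
qed

theorem very_well_approximable_null:
  "{t \<in> {l..u}. K_very_well_approximable \<Sigma> (\<phi> t)} \<in> null_sets lebesgue"
proof -
  obtain J :: "nat \<Rightarrow> real set" where J: "\<forall>i. good_piece (J i)" "\<forall>i. J i \<subseteq> {l..u}" "{l..u} - Z \<subseteq> (\<Union>i. J i)"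
    using good_pieces_cover by (elim exE conjE) (rule that)
  have vwa: "\<exists>j. vwa (1 / real (Suc j)) t" if t: "K_very_well_approximable \<Sigma> (\<phi> t)" for t
  proof -
    obtain \<gamma> where \<gamma>: "\<gamma> > 0" "infinite {(p, q). p \<in> ring_of_integers \<and> q \<in> ring_of_integers \<and> q \<noteq> 0 \<and>
        max_norm \<Sigma> (\<lambda>\<sigma>. \<sigma> p + \<phi> t \<sigma> * \<sigma> q) * max_norm \<Sigma> (\<lambda>\<sigma>. \<sigma> q) powr (1 + \<gamma>) < 1}"
      using t unfolding K_very_well_approximable_def by blast
    \<comment> \<open>Weakening the exponent to a reciprocal leaves countably many exponents, hence
      a countable union of null sets.\<close>
    obtain j where j: "1 / real (Suc j) < \<gamma>" using nat_approx_posE[OF \<gamma>(1)] by blast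
    have "lin p q t \<sigma> \<le> Q q powr (- (1 / real (Suc j))) / Q q"
      if pq: "q \<in> ring_of_integers" "q \<noteq> 0" and \<sigma>: "\<sigma> \<in> \<Sigma>"
        and less: "max_norm \<Sigma> (\<lambda>\<sigma>. \<sigma> p + \<phi> t \<sigma> * \<sigma> q) * max_norm \<Sigma> (\<lambda>\<sigma>. \<sigma> q) powr (1 + \<gamma>) < 1" for p q \<sigma>
    proof -
      have Q1: "1 \<le> Q q" by (rule Q_ge_1[OF pq])
      have "lin p q t \<sigma> * Q q powr (1 + \<gamma>) \<le> max_norm \<Sigma> (\<lambda>\<sigma>. \<sigma> p + \<phi> t \<sigma> * \<sigma> q) * Q q powr (1 + \<gamma>)"
        using max_lin_ge[OF \<sigma>] by (intro mult_right_mono) auto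
      also have "\<dots> \<le> 1" using less by (simp add: Q_def)
      finally have "lin p q t \<sigma> \<le> 1 / Q q powr (1 + \<gamma>)" using Q1 by (simp add: pos_le_divide_eq)
      also have "\<dots> = Q q powr (- \<gamma>) / Q q" using Q1 by (simp add: powr_add powr_minus field_simps)
      also have "\<dots> \<le> Q q powr (- (1 / real (Suc j))) / Q q"
        using Q1 j by (intro divide_right_mono powr_mono) auto
      finally show ?thesis .
    qed
    then have "{(p, q). p \<in> ring_of_integers \<and> q \<in> ring_of_integers \<and> q \<noteq> 0 \<and>
        max_norm \<Sigma> (\<lambda>\<sigma>. \<sigma> p + \<phi> t \<sigma> * \<sigma> q) * max_norm \<Sigma> (\<lambda>\<sigma>. \<sigma> q) powr (1 + \<gamma>) < 1} \<subseteq>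
      {(p, q). p \<in> ring_of_integers \<and> q \<in> ring_of_integers \<and> q \<noteq> 0 \<and>
        (\<forall>\<sigma>\<in>\<Sigma>. lin p q t \<sigma> \<le> Q q powr (- (1 / real (Suc j))) / Q q)}" by blast
    then show ?thesis using \<gamma>(2) infinite_super unfolding vwa_def by blast
  qed
  have "negligible {t \<in> J i. vwa (1 / real (Suc j)) t}" for i j
    by (rule vwa_negligible_on_good[OF bilipschitz_const[OF J(1)[rule_format]] J(2)[rule_format]]) simp
  then have "negligible (\<Union>i. \<Union>j. {t \<in> J i. vwa (1 / real (Suc j)) t})"
    by (intro negligible_countable_Union countable_image) auto
  moreover have "negligible Z" using finZ by (rule negligible_finite)
  ultimately have "negligible ((\<Union>i. \<Union>j. {t \<in> J i. vwa (1 / real (Suc j)) t}) \<union> Z)"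
    by (rule negligible_Un)
  moreover have "{t \<in> {l..u}. K_very_well_approximable \<Sigma> (\<phi> t)} \<subseteq> (\<Union>i. \<Union>j. {t \<in> J i. vwa (1 / real (Suc j)) t}) \<union> Z"
  proof clarify
    fix t assume t: "t \<in> {l..u}" "K_very_well_approximable \<Sigma> (\<phi> t)" "t \<notin> Z"
    then obtain i where "t \<in> J i" using J(3) by blast
    moreover obtain j where "vwa (1 / real (Suc j)) t" using vwa[OF t(2)] by blast
    ultimately show "t \<in> (\<Union>i. \<Union>j. {t \<in> J i. vwa (1 / real (Suc j)) t})" by blast
  qed
  ultimately show ?thesis unfolding negligible_iff_null_sets[symmetric] by (rule negligible_subset)
qed

end

section \<open>Points that are singular on average\<close>

lemma card_floor_image_le:
  fixes D :: "real set"
  assumes "\<And>t t'. t \<in> D \<Longrightarrow> t' \<in> D \<Longrightarrow> \<bar>t - t'\<bar> \<le> h" and x: "x > 0" and h: "0 \<le> h"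
  shows "real (card ((\<lambda>t. \<lfloor>x * t\<rfloor>) ` D)) \<le> 2 * x * h + 2" and "finite ((\<lambda>t. \<lfloor>x * t\<rfloor>) ` D)"
proof -
  have "\<exists>a. (\<lambda>t. \<lfloor>x * t\<rfloor>) ` D \<subseteq> {\<lfloor>a - x * h\<rfloor>..\<lfloor>a + x * h\<rfloor>}"
  proof (cases "D = {}")
    case False
    then obtain t0 where t0: "t0 \<in> D" by blast
    have "\<lfloor>x * t\<rfloor> \<in> {\<lfloor>x * t0 - x * h\<rfloor>..\<lfloor>x * t0 + x * h\<rfloor>}" if "t \<in> D" for t
    proof -
      have "\<bar>t - t0\<bar> \<le> h" using assms(1)[OF that t0] .
      then have "x * (t0 - h) \<le> x * t" "x * t \<le> x * (t0 + h)" using x by (auto intro!: mult_left_mono)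
      then show ?thesis by (auto simp: algebra_simps intro!: floor_mono)
    qed
    then show ?thesis by blast
  qed simp
  then obtain a where a: "(\<lambda>t. \<lfloor>x * t\<rfloor>) ` D \<subseteq> {\<lfloor>a - x * h\<rfloor>..\<lfloor>a + x * h\<rfloor>}" by blast
  then show "finite ((\<lambda>t. \<lfloor>x * t\<rfloor>) ` D)" by (rule finite_subset) simp
  have "0 \<le> x * h" using x h by simp
  then have "\<lfloor>a - x * h\<rfloor> \<le> \<lfloor>a + x * h\<rfloor>" by (intro floor_mono) linarith
  have "card ((\<lambda>t. \<lfloor>x * t\<rfloor>) ` D) \<le> card {\<lfloor>a - x * h\<rfloor>..\<lfloor>a + x * h\<rfloor>}" by (rule card_mono[OF _ a]) simp
  also have "\<dots> = nat (\<lfloor>a + x * h\<rfloor> - \<lfloor>a - x * h\<rfloor> + 1)" by simp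
  finally have "real (card ((\<lambda>t. \<lfloor>x * t\<rfloor>) ` D)) \<le> real_of_int (\<lfloor>a + x * h\<rfloor> - \<lfloor>a - x * h\<rfloor> + 1)"
    using \<open>\<lfloor>a - x * h\<rfloor> \<le> \<lfloor>a + x * h\<rfloor>\<close> by linarith
  also have "\<dots> \<le> 2 * (x * h) + 2" by linarith
  finally show "real (card ((\<lambda>t. \<lfloor>x * t\<rfloor>) ` D)) \<le> 2 * x * h + 2" by simp
qed

text \<open>One step of the diagonal flow doubles the linear forms and halves the denominators,
  which magnifies the parameter by 4; hence cells of side \<open>1 / 4 ^ k\<close> at time
  \<open>k\<close>.\<close>

definition cell :: "nat \<Rightarrow> real \<Rightarrow> int" where "cell k t = \<lfloor>4 ^ k * t\<rfloor>"

lemma cell_near: "cell k t = cell k t' \<Longrightarrow> \<bar>t - t'\<bar> \<le> 1 / 4 ^ k"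
proof -
  assume "cell k t = cell k t'"
  then have "\<bar>4 ^ k * t - 4 ^ k * t'\<bar> \<le> 1" unfolding cell_def by linarith
  then have "4 ^ k * \<bar>t - t'\<bar> \<le> 1" by (simp add: abs_mult flip: right_diff_distrib)
  then show ?thesis by (simp add: field_simps)
qed

lemma finite_cell_image:
  assumes "X \<subseteq> {l..u}" "l < u"
  shows "finite (cell k ` X)"
  unfolding cell_def
proof (rule card_floor_image_le(2))
  show "\<bar>t - t'\<bar> \<le> u - l" if "t \<in> X" "t' \<in> X" for t t'
    using subsetD[OF assms(1) that(1)] subsetD[OF assms(1) that(2)] by auto
qed (use assms(2) in auto)

lemma card_cell_Suc_le:
  assumes "finite (cell k ` X)"
  shows "card (cell (Suc k) ` X) \<le> 4 * card (cell k ` X)"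
proof -
  have "cell (Suc k) ` X \<subseteq> (\<Union>i\<in>cell k ` X. {4 * i..4 * i + 3})"
  proof clarify
    fix t assume "t \<in> X"
    have "cell (Suc k) t \<in> {4 * cell k t..4 * cell k t + 3}" unfolding cell_def by (simp; linarith)
    then show "cell (Suc k) t \<in> (\<Union>i\<in>cell k ` X. {4 * i..4 * i + 3})" using \<open>t \<in> X\<close> by blast
  qed
  then have "card (cell (Suc k) ` X) \<le> card (\<Union>i\<in>cell k ` X. {4 * i..4 * i + 3})"
    using assms by (intro card_mono finite_UN_I) auto
  also have "\<dots> \<le> (\<Sum>i\<in>cell k ` X. card {4 * i..4 * i + 3})" using assms by (rule card_UN_le)
  finally show ?thesis by simp
qed

context diophantine_curve_on begin

section \<open>Heights along the trajectory\<close>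

definition dg :: nat where "dg = m + n"

lemma dg: "dg = (\<Sum>\<sigma>\<in>\<Sigma>. wt \<sigma>)" "0 < dg" "1 \<le> m"
proof -
  show "dg = (\<Sum>\<sigma>\<in>\<Sigma>. wt \<sigma>)"
    unfolding dg_def m_def n_def using sum.subset_diff[OF M\<Sigma> fin\<Sigma>, of wt] by simp
  show "0 < dg" "1 \<le> m" using n_less_m by (auto simp: dg_def)
qed

text \<open>The height of the vector \<open>(p, q)\<close> at time \<open>k\<close> of the trajectory of \<open>\<phi> t\<close> under the diagonal flow.
  Being a product over the places, it is invariant under multiplication of \<open>(p, q)\<close> by units.\<close>

definition ht :: "nat \<Rightarrow> 'k \<Rightarrow> 'k \<Rightarrow> real \<Rightarrow> real" where
  "ht k p q t = (\<Prod>\<sigma>\<in>\<Sigma>. max (2 ^ k * lin p q t \<sigma>) (cmod (\<sigma> q) / 2 ^ k) ^ wt \<sigma>)"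

lemma prod_wt_scaled_le:
  assumes "\<And>\<sigma>. \<sigma> \<in> \<Sigma> \<Longrightarrow> 0 \<le> x \<sigma> \<and> x \<sigma> \<le> e * y \<sigma>"
  shows "(\<Prod>\<sigma>\<in>\<Sigma>. x \<sigma> ^ wt \<sigma>) \<le> e ^ dg * (\<Prod>\<sigma>\<in>\<Sigma>. (y \<sigma> :: real) ^ wt \<sigma>)"
proof -
  have "(\<Prod>\<sigma>\<in>\<Sigma>. x \<sigma> ^ wt \<sigma>) \<le> (\<Prod>\<sigma>\<in>\<Sigma>. (e * y \<sigma>) ^ wt \<sigma>)"
    using assms by (intro prod_mono conjI power_mono zero_le_power) auto
  then show ?thesis by (simp add: power_mult_distrib prod.distrib power_sum dg(1))
qed

text \<open>At time 0 the second entries of the maxima alone give the norm of \<open>q\<close>. A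
  small height thus occurs only after a descent, which has a beginning.\<close>

lemma ht_0_ge_1:
  assumes "q \<in> ring_of_integers" "q \<noteq> 0"
  shows "1 \<le> ht 0 p q t"
proof -
  have "1 \<le> (\<Prod>\<sigma>\<in>\<Sigma>. cmod (\<sigma> q) ^ wt \<sigma>)" by (rule norm_ge_1[OF assms])
  also have "\<dots> \<le> ht 0 p q t" unfolding ht_def by (intro prod_mono conjI power_mono) auto
  finally show ?thesis .
qed

lemma ht_nonneg: "0 \<le> ht k p q t"
  unfolding ht_def by (intro prod_nonneg ballI zero_le_power) (simp add: le_max_iff_disj)

lemma ht_le_ht_Suc: "ht k p q t \<le> 2 ^ dg * ht (Suc k) p q t"
  unfolding ht_def
proof (rule prod_wt_scaled_le)
  fix \<sigma>
  have "2 ^ k * lin p q t \<sigma> \<le> 2 * (2 ^ Suc k * lin p q t \<sigma>)"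
    using mult_nonneg_nonneg[of "2 ^ k" "lin p q t \<sigma>"] lin_nonneg[of p q t \<sigma>] by simp
  moreover have "cmod (\<sigma> q) / 2 ^ k \<le> 2 * (cmod (\<sigma> q) / 2 ^ Suc k)" by simp
  moreover have "max a b \<le> 2 * max a' b'" if "a \<le> 2 * a'" "b \<le> 2 * b'" for a b a' b' :: real
    using that by (auto simp: max_def)
  ultimately have "max (2 ^ k * lin p q t \<sigma>) (cmod (\<sigma> q) / 2 ^ k)
        \<le> 2 * max (2 ^ Suc k * lin p q t \<sigma>) (cmod (\<sigma> q) / 2 ^ Suc k)" by blast
  then show "0 \<le> max (2 ^ k * lin p q t \<sigma>) (cmod (\<sigma> q) / 2 ^ k) \<and>
      max (2 ^ k * lin p q t \<sigma>) (cmod (\<sigma> q) / 2 ^ k)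
        \<le> 2 * max (2 ^ Suc k * lin p q t \<sigma>) (cmod (\<sigma> q) / 2 ^ Suc k)"
    by (simp add: le_max_iff_disj)
qed

lemma ht_le_ht_add: "ht k p q t \<le> (2 ^ dg) ^ j * ht (k + j) p q t"
proof (induction j)
  case (Suc j)
  have "(2 ^ dg) ^ j * ht (k + j) p q t \<le> (2 ^ dg) ^ j * (2 ^ dg * ht (k + Suc j) p q t)"
    using ht_le_ht_Suc[of "k + j"] by (intro mult_left_mono) auto
  then have "ht k p q t \<le> (2 ^ dg) ^ j * (2 ^ dg * ht (k + Suc j) p q t)" using Suc by linarith
  then show ?case by (simp add: mult_ac)
qed simp

text \<open>Over a cell of time \<open>k\<close> a linear form moves by at most
  \<open>C * cmod (\<sigma> q) / 4 ^ k\<close>, which after scaling by \<open>2 ^ k\<close> is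
  \<open>C\<close> times the second entry of the maximum.\<close>

lemma ht_near:
  assumes good: "good C J" and t: "t \<in> J" "t' \<in> J" "\<bar>t - t'\<bar> \<le> 1 / 4 ^ k"
  shows "ht k p q t' \<le> (1 + C) ^ dg * ht k p q t"
  unfolding ht_def
proof (rule prod_wt_scaled_le)
  fix \<sigma> assume \<sigma>: "\<sigma> \<in> \<Sigma>"
  have C: "1 \<le> C" using good by (rule good_ge_1)
  define a b where "a = 2 ^ k * lin p q t \<sigma>" and "b = cmod (\<sigma> q) / 2 ^ k"
  have ab: "0 \<le> a" "0 \<le> b" using lin_nonneg by (auto simp: a_def b_def)
  have diff: "cmod (\<phi> t' \<sigma> - \<phi> t \<sigma>) \<le> C * (1 / 4 ^ k)"
  proof (cases "\<sigma> \<in> M")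
    case True
    have "cmod (\<phi> t' \<sigma> - \<phi> t \<sigma>) \<le> C * \<bar>t' - t\<bar>" using good_upper[OF good True t(2,1)] .
    also have "\<dots> \<le> C * (1 / 4 ^ k)" using C t(3) by (intro mult_left_mono) (auto simp: abs_minus_commute)
    finally show ?thesis .
  next
    case False
    then show ?thesis using good_const[OF good _ t(2,1), of \<sigma>] \<sigma> C by simp
  qed
  have "\<sigma> p + \<phi> t' \<sigma> * \<sigma> q = (\<sigma> p + \<phi> t \<sigma> * \<sigma> q) + (\<phi> t' \<sigma> - \<phi> t \<sigma>) * \<sigma> q"
    by (simp add: algebra_simps)
  then have "lin p q t' \<sigma> \<le> lin p q t \<sigma> + cmod (\<phi> t' \<sigma> - \<phi> t \<sigma>) * cmod (\<sigma> q)"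
    unfolding lin_def by (metis norm_mult norm_triangle_ineq)
  also have "\<dots> \<le> lin p q t \<sigma> + C * (1 / 4 ^ k) * cmod (\<sigma> q)"
    using diff by (intro add_left_mono mult_right_mono) auto
  finally have "2 ^ k * lin p q t' \<sigma> \<le> 2 ^ k * (lin p q t \<sigma> + C * (1 / 4 ^ k) * cmod (\<sigma> q))"
    by (intro mult_left_mono) auto
  also have "\<dots> = a + C * b"
    using power_mult_distrib[of "2::real" 2 k] by (simp add: a_def b_def field_simps)
  also have "\<dots> \<le> max a b + C * max a b" using C by (intro add_mono mult_left_mono) auto
  also have "\<dots> = (1 + C) * max a b" by (simp add: algebra_simps)
  finally have 1: "2 ^ k * lin p q t' \<sigma> \<le> (1 + C) * max a b" .
  have "b \<le> 1 * max a b" by simp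
  also have "\<dots> \<le> (1 + C) * max a b" using C ab by (intro mult_right_mono) auto
  finally have 2: "b \<le> (1 + C) * max a b" .
  show "0 \<le> max (2 ^ k * lin p q t' \<sigma>) (cmod (\<sigma> q) / 2 ^ k) \<and>
      max (2 ^ k * lin p q t' \<sigma>) (cmod (\<sigma> q) / 2 ^ k)
        \<le> (1 + C) * max (2 ^ k * lin p q t \<sigma>) (cmod (\<sigma> q) / 2 ^ k)"
    using 1 2 ab unfolding a_def[symmetric] b_def[symmetric] by (simp add: le_max_iff_disj)
qed

text \<open>The scalings of form and denominator cancel in each term of the determinant, so its norm
  is at most \<open>2 ^ dg\<close> times the product of the heights.\<close>

lemma ht_proportional:
  assumes "p \<in> ring_of_integers" "q \<in> ring_of_integers" "p' \<in> ring_of_integers" "q' \<in> ring_of_integers"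
    and less: "2 ^ dg * (ht k p q t * ht k p' q' t) < 1"
  shows "p * q' = p' * q"
proof (rule ccontr)
  assume "p * q' \<noteq> p' * q"
  then have nz: "p * q' - p' * q \<noteq> 0" by simp
  have int: "p * q' - p' * q \<in> ring_of_integers" using assms by (intro ring_of_integers_closed)
  let ?f = "\<lambda>p q \<sigma>. max (2 ^ k * lin p q t \<sigma>) (cmod (\<sigma> q) / 2 ^ k)"
  have "1 \<le> (\<Prod>\<sigma>\<in>\<Sigma>. cmod (\<sigma> (p * q' - p' * q)) ^ wt \<sigma>)" by (rule norm_ge_1[OF int nz])
  also have "\<dots> \<le> 2 ^ dg * (\<Prod>\<sigma>\<in>\<Sigma>. (?f p q \<sigma> * ?f p' q' \<sigma>) ^ wt \<sigma>)"
  proof (rule prod_wt_scaled_le)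
    fix \<sigma> assume \<sigma>: "\<sigma> \<in> \<Sigma>"
    have "cmod (\<sigma> (p * q' - p' * q)) \<le> lin p q t \<sigma> * cmod (\<sigma> q') + lin p' q' t \<sigma> * cmod (\<sigma> q)"
      using cmod_cross_le[OF emb[OF \<sigma>]] .
    also have "\<dots> = (2 ^ k * lin p q t \<sigma>) * (cmod (\<sigma> q') / 2 ^ k) + (cmod (\<sigma> q) / 2 ^ k) * (2 ^ k * lin p' q' t \<sigma>)"
      by simp
    also have "\<dots> \<le> ?f p q \<sigma> * ?f p' q' \<sigma> + ?f p q \<sigma> * ?f p' q' \<sigma>"
      using lin_nonneg by (intro add_mono mult_mono) (auto simp: le_max_iff_disj)
    finally show "0 \<le> cmod (\<sigma> (p * q' - p' * q)) \<and> cmod (\<sigma> (p * q' - p' * q)) \<le> 2 * (?f p q \<sigma> * ?f p' q' \<sigma>)"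
      by simp
  qed
  also have "\<dots> = 2 ^ dg * (ht k p q t * ht k p' q' t)"
    by (simp add: ht_def power_mult_distrib prod.distrib)
  finally show False using less by simp
qed

text \<open>The growth rate: \<open>2 * rate\<close> is the factor by which the number of cells grows per step of an
  excursion into a cusp, on average over the excursion.\<close>

definition rate :: real where "rate = 2 powr (real n / real m)"

lemma rate: "1 \<le> rate" "rate \<le> 2" "rate ^ m = 2 ^ n"
proof -
  show "1 \<le> rate" unfolding rate_def by (rule ge_one_powr_ge_zero) auto
  have "rate \<le> 2 powr 1" unfolding rate_def using n_less_m by (intro powr_mono) auto
  then show "rate \<le> 2" by simp
  have "rate ^ m = rate powr real m" by (rule powr_realpow[symmetric]) (simp add: rate_def)
  also have "\<dots> = 2 powr real n" using dg(3) by (simp add: rate_def powr_powr)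
  also have "\<dots> = 2 ^ n" by (simp add: powr_realpow)
  finally show "rate ^ m = 2 ^ n" .
qed

text \<open>If no moving coordinate came that close, each of them would contribute a factor
  \<open>rate ^ (b - a)\<close> to the growth of the height, which already outweighs the largest possible
  decay in the stationary ones.\<close>

lemma excursion_close:
  assumes ab: "a < b" and q: "q \<in> ring_of_integers" "q \<noteq> 0"
    and c: "ht b p q t < ht a p q t"
  shows "\<exists>\<sigma>\<in>M. lin p q t \<sigma> \<le> cmod (\<sigma> q) * ((2 * rate) ^ (b - a) / 4 ^ b)"
proof (rule ccontr)
  assume "\<not> ?thesis"
  then have far: "cmod (\<sigma> q) * ((2 * rate) ^ (b - a) / 4 ^ b) \<le> lin p q t \<sigma>" if "\<sigma> \<in> M" for \<sigma>
    using that by (meson linear)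
  define e where "e = b - a"
  have b: "b = a + e" using ab by (simp add: e_def)
  let ?f = "\<lambda>k \<sigma>. max (2 ^ k * lin p q t \<sigma>) (cmod (\<sigma> q) / 2 ^ k)"
  have f0: "0 \<le> ?f k \<sigma>" for k \<sigma> by (simp add: le_max_iff_disj)
  \<comment> \<open>The form doubles at each step, and 2 is at least \<open>rate\<close>; where the
    denominator dominates at time \<open>a\<close>, the failure of closeness makes the form at time
    \<open>b\<close> large enough.\<close>
  have fM: "rate ^ e * ?f a \<sigma> \<le> ?f b \<sigma>" if \<sigma>: "\<sigma> \<in> M" for \<sigma>
  proof -
    have four: "(4::real) ^ k = 2 ^ k * 2 ^ k" for k using power_mult_distrib[of "2::real" 2 k] by simp
    have "rate ^ e * (2 ^ a * lin p q t \<sigma>) \<le> 2 ^ e * (2 ^ a * lin p q t \<sigma>)"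
      using rate lin_nonneg by (intro mult_right_mono power_mono) auto
    then have 1: "rate ^ e * (2 ^ a * lin p q t \<sigma>) \<le> 2 ^ b * lin p q t \<sigma>" by (simp add: b power_add mult_ac)
    have "rate ^ e * (cmod (\<sigma> q) / 2 ^ a) = 2 ^ b * (cmod (\<sigma> q) * ((2 * rate) ^ e / 4 ^ b))"
      unfolding four by (simp add: b power_add power_mult_distrib)
    also have "\<dots> \<le> 2 ^ b * lin p q t \<sigma>" using far[OF \<sigma>] unfolding e_def[symmetric] by (intro mult_left_mono) auto
    finally have 2: "rate ^ e * (cmod (\<sigma> q) / 2 ^ a) \<le> 2 ^ b * lin p q t \<sigma>" .
    show ?thesis using 1 2 by (auto simp: max_def)
  qed
  have fN: "(1 / 2) ^ e * ?f a \<sigma> \<le> ?f b \<sigma>" for \<sigma>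
  proof -
    have "(1 / 2) ^ e * (2 ^ a * lin p q t \<sigma>) \<le> 2 ^ e * (2 ^ a * lin p q t \<sigma>)"
    proof (intro mult_right_mono)
      have "(1 / 2 :: real) ^ e \<le> 1" by (rule power_le_one) auto
      also have "\<dots> \<le> 2 ^ e" by simp
      finally show "(1 / 2 :: real) ^ e \<le> 2 ^ e" .
    qed (use lin_nonneg in auto)
    then have 1: "(1 / 2) ^ e * (2 ^ a * lin p q t \<sigma>) \<le> 2 ^ b * lin p q t \<sigma>" by (simp add: b power_add mult_ac)
    have 2: "(1 / 2) ^ e * (cmod (\<sigma> q) / 2 ^ a) = cmod (\<sigma> q) / 2 ^ b"
      by (simp add: b power_add power_divide)
    show ?thesis using 1 2 by (auto simp: max_def)
  qed
  have "(rate ^ e) ^ m * (\<Prod>\<sigma>\<in>M. ?f a \<sigma> ^ wt \<sigma>) = (\<Prod>\<sigma>\<in>M. (rate ^ e * ?f a \<sigma>) ^ wt \<sigma>)"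
    by (simp add: power_mult_distrib[of "rate ^ e"] prod.distrib power_sum m_def)
  also have "\<dots> \<le> (\<Prod>\<sigma>\<in>M. ?f b \<sigma> ^ wt \<sigma>)"
    using fM f0 rate(1) by (intro prod_mono conjI power_mono zero_le_power mult_nonneg_nonneg) auto
  finally have M: "(rate ^ e) ^ m * (\<Prod>\<sigma>\<in>M. ?f a \<sigma> ^ wt \<sigma>) \<le> (\<Prod>\<sigma>\<in>M. ?f b \<sigma> ^ wt \<sigma>)" .
  have "((1 / 2) ^ e) ^ n * (\<Prod>\<sigma>\<in>\<Sigma> - M. ?f a \<sigma> ^ wt \<sigma>) = (\<Prod>\<sigma>\<in>\<Sigma> - M. ((1 / 2) ^ e * ?f a \<sigma>) ^ wt \<sigma>)"
    by (simp add: power_mult_distrib[of "(1 / 2) ^ e"] prod.distrib power_sum n_def)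
  also have "\<dots> \<le> (\<Prod>\<sigma>\<in>\<Sigma> - M. ?f b \<sigma> ^ wt \<sigma>)"
    using fN f0 by (intro prod_mono conjI power_mono zero_le_power mult_nonneg_nonneg) auto
  finally have N: "((1 / 2) ^ e) ^ n * (\<Prod>\<sigma>\<in>\<Sigma> - M. ?f a \<sigma> ^ wt \<sigma>) \<le> (\<Prod>\<sigma>\<in>\<Sigma> - M. ?f b \<sigma> ^ wt \<sigma>)" .
  have "ht a p q t = ((rate ^ e) ^ m * ((1 / 2) ^ e) ^ n) * ht a p q t"
  proof -
    have "(rate ^ e) ^ m * ((1 / 2) ^ e) ^ n = (rate ^ m) ^ e * ((1 / 2) ^ n) ^ e"
      by (simp add: power_mult[symmetric] mult.commute)
    also have "\<dots> = 1" by (simp add: rate(3) flip: power_mult_distrib)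
    finally show ?thesis by simp
  qed
  also have "\<dots> = ((rate ^ e) ^ m * (\<Prod>\<sigma>\<in>M. ?f a \<sigma> ^ wt \<sigma>)) * (((1 / 2) ^ e) ^ n * (\<Prod>\<sigma>\<in>\<Sigma> - M. ?f a \<sigma> ^ wt \<sigma>))"
    unfolding ht_def prod_split by (simp only: mult_ac)
  also have "\<dots> \<le> (\<Prod>\<sigma>\<in>M. ?f b \<sigma> ^ wt \<sigma>) * (\<Prod>\<sigma>\<in>\<Sigma> - M. ?f b \<sigma> ^ wt \<sigma>)"
    using M N f0 by (intro mult_mono) (auto intro!: prod_nonneg mult_nonneg_nonneg)
  also have "\<dots> = ht b p q t" unfolding ht_def prod_split ..
  finally show False using c by simp
qed

text \<open>\<open>a\<close> is meant as the last time before \<open>b\<close> with height at least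
  \<open>c\<close>. One step divides the height by at most \<open>2 ^ dg\<close>, whence the upper
  bound, which makes the vector at time \<open>a\<close> unique up to proportionality when
  \<open>c\<close> is small.\<close>

definition excursion :: "real \<Rightarrow> nat \<Rightarrow> nat \<Rightarrow> real \<Rightarrow> bool" where
  "excursion c a b t \<longleftrightarrow> (\<exists>p q. p \<in> ring_of_integers \<and> q \<in> ring_of_integers \<and> q \<noteq> 0 \<and>
     c \<le> ht a p q t \<and> ht a p q t \<le> 2 ^ dg * c \<and> ht b p q t < c)"

text \<open>Heights at time \<open>a\<close> vary by at most \<open>(1 + C) ^ dg\<close> over a
  cell, and \<open>c\<close> is small enough for \<open>ht_proportional\<close>, so one point
  \<open>z\<close> serves the whole cell. By \<open>excursion_close\<close> the parameters lie in
  \<open>card M\<close> sets of diameter at most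
  \<open>2 * C * (2 * rate) ^ (b - a) / 4 ^ b\<close>, and each of these meets at most a constant
  times \<open>(2 * rate) ^ (b - a)\<close> cells of time \<open>b\<close>.\<close>

lemma card_cells_excursion:
  assumes good: "good C J" and c: "c = (1 / (8 * (1 + C))) ^ dg" and ab: "a < b"
    and X: "X \<subseteq> J" "\<And>t t'. t \<in> X \<Longrightarrow> t' \<in> X \<Longrightarrow> cell a t = cell a t'" "\<And>t. t \<in> X \<Longrightarrow> excursion c a b t"
  shows "real (card (cell b ` X)) \<le> real (card M) * (4 * C + 2) * (2 * rate) ^ (b - a)"
    and "finite (cell b ` X)"
proof -
  define Y where "Y = (2 * rate) ^ (b - a) / 4 ^ b"
  have C: "1 \<le> C" using good by (rule good_ge_1)
  have Y: "0 \<le> Y" using rate(1) by (simp add: Y_def)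
  have c0: "0 < c" "c < 1" using C dg(2) by (auto simp: c intro!: power_Suc_less_one power_less_one_iff[THEN iffD2])
  have main: "real (card (cell b ` X)) \<le> real (card M) * (4 * C + 2) * (2 * rate) ^ (b - a) \<and> finite (cell b ` X)"
  proof (cases "X = {}")
    case True
    then show ?thesis using C rate(1) by simp
  next
    case False
    then obtain t0 where t0: "t0 \<in> X" by blast
    then obtain p0 q0 where q0: "p0 \<in> ring_of_integers" "q0 \<in> ring_of_integers" "q0 \<noteq> 0"
      "ht a p0 q0 t0 \<le> 2 ^ dg * c" using X(3) unfolding excursion_def by blast
    define z where "z = p0 / q0"
    define D where "D \<sigma> = {t \<in> X. cmod (\<phi> t \<sigma> + \<sigma> z) \<le> Y}" for \<sigma>
    have cover: "X \<subseteq> (\<Union>\<sigma>\<in>M. D \<sigma>)"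
    proof
      fix t assume t: "t \<in> X"
      then obtain p q where q: "p \<in> ring_of_integers" "q \<in> ring_of_integers" "q \<noteq> 0"
        "c \<le> ht a p q t" "ht a p q t \<le> 2 ^ dg * c" "ht b p q t < c" using X(3) unfolding excursion_def by blast
      have "p * q0 = p0 * q"
      proof (rule ht_proportional[OF q(1,2) q0(1,2)])
        have "ht a p0 q0 t \<le> (1 + C) ^ dg * ht a p0 q0 t0"
          by (rule ht_near[OF good _ _ cell_near[OF X(2)[OF t0 t]]]) (use X(1) t t0 in auto)
        also have "\<dots> \<le> (1 + C) ^ dg * (2 ^ dg * c)" using q0(4) C by (intro mult_left_mono) auto
        finally have "ht a p q t * ht a p0 q0 t \<le> (2 ^ dg * c) * ((1 + C) ^ dg * (2 ^ dg * c))"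
          using q(5) ht_nonneg c0 by (intro mult_mono) auto
        then have "2 ^ dg * (ht a p q t * ht a p0 q0 t) \<le> 2 ^ dg * ((2 ^ dg * c) * ((1 + C) ^ dg * (2 ^ dg * c)))"
          by (intro mult_left_mono) auto
        \<comment> \<open>Three factors \<open>2 ^ dg\<close>: one from the determinant and one from
          each upper bound at time \<open>a\<close>. Together with the distortion they are cancelled
          by one \<open>c\<close>; the other \<open>c\<close> is left over and is below 1.\<close>
        also have "\<dots> = (2 * 2 * 2 * (1 + C)) ^ dg * c * c" by (simp only: power_mult_distrib mult_ac)
        also have "(2 * 2 * 2 * (1 + C)) ^ dg * c = 1"
          using C unfolding c power_mult_distrib[symmetric] by simp
        finally show "2 ^ dg * (ht a p q t * ht a p0 q0 t) < 1" using c0 by simp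
      qed
      then have p: "p = z * q" using q0(3) by (simp add: z_def field_simps)
      obtain \<sigma> where \<sigma>: "\<sigma> \<in> M" "lin p q t \<sigma> \<le> cmod (\<sigma> q) * Y"
        using excursion_close[OF ab q(2,3), of p t] q(4,6) unfolding Y_def by auto
      interpret field_char_0_hom \<sigma> using emb_M[OF \<sigma>(1)] by (rule embedding_field_hom)
      have "lin p q t \<sigma> = cmod (\<sigma> q) * cmod (\<phi> t \<sigma> + \<sigma> z)"
        unfolding lin_def p norm_mult[symmetric] by (simp add: hom_mult algebra_simps)
      then have "cmod (\<phi> t \<sigma> + \<sigma> z) \<le> Y" using \<sigma>(2) q(3) by simp
      then show "t \<in> (\<Union>\<sigma>\<in>M. D \<sigma>)" using \<sigma>(1) t by (auto simp: D_def)
    qed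
    have D: "\<bar>t - t'\<bar> \<le> 2 * C * Y" if "\<sigma> \<in> M" "t \<in> D \<sigma>" "t' \<in> D \<sigma>" for \<sigma> t t'
    proof -
      have "\<bar>t - t'\<bar> \<le> C * cmod (\<phi> t \<sigma> - \<phi> t' \<sigma>)"
        using good_lower[OF good that(1)] that X(1) by (auto simp: D_def)
      also have "\<phi> t \<sigma> - \<phi> t' \<sigma> = (\<phi> t \<sigma> + \<sigma> z) - (\<phi> t' \<sigma> + \<sigma> z)" by simp
      also have "C * cmod \<dots> \<le> C * (Y + Y)"
        using that C by (intro mult_left_mono order_trans[OF norm_triangle_ineq4] add_mono) (auto simp: D_def)
      finally show ?thesis by simp
    qed
    have CY: "0 \<le> 2 * C * Y" using C Y by simp
    have card_D: "real (card (cell b ` D \<sigma>)) \<le> (4 * C + 2) * (2 * rate) ^ (b - a) \<and> finite (cell b ` D \<sigma>)"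
      if \<sigma>: "\<sigma> \<in> M" for \<sigma>
    proof -
      have "real (card (cell b ` D \<sigma>)) \<le> 2 * 4 ^ b * (2 * C * Y) + 2 \<and> finite (cell b ` D \<sigma>)"
        using card_floor_image_le[of "D \<sigma>" "2 * C * Y" "4 ^ b"] D[OF \<sigma>] CY unfolding cell_def by auto
      moreover have "2 * 4 ^ b * (2 * C * Y) + 2 \<le> (4 * C + 2) * (2 * rate) ^ (b - a)"
      proof -
        have "2 * 4 ^ b * (2 * C * Y) = 4 * C * (2 * rate) ^ (b - a)" by (simp add: Y_def)
        moreover have "1 \<le> (2 * rate) ^ (b - a)" using rate(1) by (intro one_le_power) auto
        ultimately show ?thesis unfolding distrib_right by linarith
      qed
      ultimately show ?thesis by linarith
    qed
    have sub: "cell b ` X \<subseteq> (\<Union>\<sigma>\<in>M. cell b ` D \<sigma>)" using cover by blast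
    have fin: "finite (\<Union>\<sigma>\<in>M. cell b ` D \<sigma>)" using finM card_D by blast
    have "card (cell b ` X) \<le> card (\<Union>\<sigma>\<in>M. cell b ` D \<sigma>)" using fin sub by (rule card_mono)
    also have "\<dots> \<le> (\<Sum>\<sigma>\<in>M. card (cell b ` D \<sigma>))" using finM by (rule card_UN_le)
    finally have "real (card (cell b ` X)) \<le> (\<Sum>\<sigma>\<in>M. real (card (cell b ` D \<sigma>)))"
      by (simp flip: of_nat_sum)
    also have "\<dots> \<le> (\<Sum>\<sigma>\<in>M. (4 * C + 2) * (2 * rate) ^ (b - a))" using card_D by (intro sum_mono) blast
    also have "\<dots> = real (card M) * (4 * C + 2) * (2 * rate) ^ (b - a)" by simp
    finally show ?thesis using finite_subset[OF sub fin] by blast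
  qed
  then show "real (card (cell b ` X)) \<le> real (card M) * (4 * C + 2) * (2 * rate) ^ (b - a)" "finite (cell b ` X)"
    by blast+
qed

section \<open>Counting cells of mostly deep points\<close>

definition deep :: "real \<Rightarrow> nat \<Rightarrow> real \<Rightarrow> bool" where
  "deep \<epsilon> k t \<longleftrightarrow> (\<exists>p q. p \<in> ring_of_integers \<and> q \<in> ring_of_integers \<and> q \<noteq> 0 \<and> ht k p q t < \<epsilon>)"

definition mostly_deep :: "real \<Rightarrow> real set \<Rightarrow> nat \<Rightarrow> nat \<Rightarrow> real set" where
  "mostly_deep \<epsilon> J N w = {t \<in> J. card {k \<in> {1..N}. \<not> deep \<epsilon> k t} \<le> w}"

text \<open>Take \<open>a\<close> as the last time before \<open>N\<close> at which the height is at
  least \<open>c\<close>. A step divides the height by at most \<open>2 ^ dg\<close>, so the descent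
  from \<open>c\<close> to below \<epsilon> takes at least \<open>w0\<close> steps.\<close>

lemma deep_excursion:
  assumes c: "0 < c" "c \<le> 1" and \<epsilon>: "\<epsilon> = c / (2 ^ dg) ^ w0" and N: "0 < N" and deep: "deep \<epsilon> N t"
  shows "\<exists>a. a < N \<and> a + w0 \<le> N \<and> excursion c a N t"
proof -
  obtain p q where q: "p \<in> ring_of_integers" "q \<in> ring_of_integers" "q \<noteq> 0" "ht N p q t < \<epsilon>"
    using deep unfolding deep_def by blast
  have "\<epsilon> \<le> c / 1" unfolding \<epsilon> using c by (intro divide_left_mono) auto
  then have hN: "ht N p q t < c" using q(4) by simp
  define A where "A = {a. a < N \<and> c \<le> ht a p q t}"
  have "0 \<in> A" using N ht_0_ge_1[OF q(2,3), of p t] c(2) by (simp add: A_def)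
  moreover have "finite A" by (simp add: A_def)
  ultimately have MaxA: "Max A \<in> A" "\<And>a. a \<in> A \<Longrightarrow> a \<le> Max A" by (auto intro: Max_in)
  define a where "a = Max A"
  have a: "a < N" "c \<le> ht a p q t" using MaxA(1) by (auto simp: a_def A_def)
  have "ht (Suc a) p q t < c"
  proof (cases "Suc a = N")
    case True
    then show ?thesis using hN by simp
  next
    case False
    then have "Suc a \<notin> A" using MaxA(2)[of "Suc a"] by (auto simp: a_def)
    then show ?thesis using False a(1) by (auto simp: A_def)
  qed
  then have "2 ^ dg * ht (Suc a) p q t \<le> 2 ^ dg * c" by (intro mult_left_mono) auto
  then have up: "ht a p q t \<le> 2 ^ dg * c" using ht_le_ht_Suc[of a p q t] by linarith
  have "a + w0 \<le> N"
  proof (rule ccontr)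
    assume "\<not> ?thesis"
    then have less: "N - a < w0" using a(1) by simp
    have "c \<le> (2 ^ dg) ^ (N - a) * ht N p q t" using a ht_le_ht_add[of a p q t "N - a"] by simp
    also have "\<dots> \<le> (2 ^ dg) ^ w0 * ht N p q t"
      using less ht_nonneg by (intro mult_right_mono power_increasing) auto
    also have "\<dots> < (2 ^ dg) ^ w0 * \<epsilon>" using q(4) by (intro mult_strict_left_mono) auto
    also have "\<dots> = c" by (simp add: \<epsilon>)
    finally show False by simp
  qed
  then show ?thesis using a up hN q unfolding excursion_def by blast
qed

text \<open>Either the last time is one of the \<open>w\<close> permitted exceptions and is removed
  alone, or it ends an excursion, and the whole excursion is removed at once. Only the times up to
  its beginning enter the recursion.\<close>

lemma mostly_deep_step:
  assumes c: "0 < c" "c \<le> 1" and \<epsilon>: "\<epsilon> = c / (2 ^ dg) ^ w0"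
    and t: "t \<in> mostly_deep \<epsilon> J (Suc N) w"
  shows "(0 < w \<and> t \<in> mostly_deep \<epsilon> J N (w - 1)) \<or>
    (\<exists>a. a < Suc N \<and> a + w0 \<le> Suc N \<and> excursion c a (Suc N) t \<and> t \<in> mostly_deep \<epsilon> J a w)"
proof (cases "deep \<epsilon> (Suc N) t")
  case True
  obtain a where a: "a < Suc N" "a + w0 \<le> Suc N" "excursion c a (Suc N) t"
    using deep_excursion[OF c \<epsilon> _ True] by auto
  have "card {k \<in> {1..a}. \<not> deep \<epsilon> k t} \<le> card {k \<in> {1..Suc N}. \<not> deep \<epsilon> k t}"
    using a(1) by (intro card_mono) auto
  then show ?thesis using a t by (auto simp: mostly_deep_def)
next
  case False
  have "{k \<in> {1..Suc N}. \<not> deep \<epsilon> k t} = insert (Suc N) {k \<in> {1..N}. \<not> deep \<epsilon> k t}"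
    using False by (auto simp: le_Suc_eq)
  then have "card {k \<in> {1..Suc N}. \<not> deep \<epsilon> k t} = Suc (card {k \<in> {1..N}. \<not> deep \<epsilon> k t})" by simp
  then show ?thesis using t by (auto simp: mostly_deep_def)
qed

text \<open>The slack \<open>\<theta> ^ N\<close> pays for the unknown beginning \<open>a\<close> of
  the last excursion: summing \<open>\<theta> ^ a\<close> over \<open>a \<le> N - w0\<close> costs a
  factor \<open>\<theta> / (\<theta> - 1)\<close> but gains \<open>\<theta> ^ w0\<close>, so long
  excursions beat all constants. An exceptional time costs a factor 4, whence \<open>4 ^ w\<close>.
  The two cases of \<open>mostly_deep_step\<close> get half of the bound each.\<close>

lemma card_cells_mostly_deep:
  assumes good: "good C J" and J: "J \<subseteq> {l..u}" and c: "c = (1 / (8 * (1 + C))) ^ dg"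
    and \<epsilon>: "\<epsilon> = c / (2 ^ dg) ^ w0" and \<theta>: "1 < \<theta>" and w0: "0 < w0"
      "real (card M) * (4 * C + 2) * \<theta> / (\<theta> - 1) \<le> \<theta> ^ w0 / 2"
  shows "real (card (cell N ` mostly_deep \<epsilon> J N w)) \<le> real (card (cell 0 ` J)) * (2 * rate * \<theta>) ^ N * 4 ^ w"
proof (induction N arbitrary: w rule: less_induct)
  case (less N)
  have C: "1 \<le> C" using good by (rule good_ge_1)
  have c0: "0 < c" "c \<le> 1" using C by (auto simp: c intro!: power_le_one)
  define K where "K = real (card (cell 0 ` J))"
  define E where "E = real (card M) * (4 * C + 2)"
  have E: "0 \<le> E" using C by (simp add: E_def)
  have fin: "finite (cell k ` X)" if "X \<subseteq> J" for k X using that J lu by (intro finite_cell_image) auto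
  have md: "mostly_deep \<epsilon> J k v \<subseteq> J" for k v by (auto simp: mostly_deep_def)
  show ?case
  proof (cases N)
    case 0
    have "card (cell 0 ` mostly_deep \<epsilon> J 0 w) \<le> card (cell 0 ` J)" using md fin by (intro card_mono image_mono) auto
    then have "real (card (cell 0 ` mostly_deep \<epsilon> J 0 w)) * 1 \<le> K * 4 ^ w"
      unfolding K_def by (intro mult_mono) auto
    then show ?thesis by (simp add: 0 K_def)
  next
    case (Suc N')
    define A where "A = {a. a < N \<and> a + w0 \<le> N}"
    define P where "P = (if 0 < w then cell N ` mostly_deep \<epsilon> J N' (w - 1) else {})"
    define X where "X a = {t \<in> mostly_deep \<epsilon> J a w. excursion c a N t}" for a
    have X_sub: "X a \<subseteq> mostly_deep \<epsilon> J a w" "X a \<subseteq> J" for a using md by (auto simp: X_def)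
    have finA: "finite A" by (simp add: A_def)
    have finP: "finite P" unfolding P_def using fin md by simp
    have sub: "cell N ` mostly_deep \<epsilon> J N w \<subseteq> P \<union> (\<Union>a\<in>A. cell N ` X a)"
    proof clarify
      fix t assume t: "t \<in> mostly_deep \<epsilon> J N w" "cell N t \<notin> (\<Union>a\<in>A. cell N ` X a)"
      have "t \<notin> X a" if "a \<in> A" for a using t(2) that by blast
      then show "cell N t \<in> P"
        using mostly_deep_step[OF c0 \<epsilon> t(1)[unfolded Suc]] by (auto simp: P_def A_def X_def Suc)
    qed
    \<comment> \<open>The four subcells are paid for by the decrease of \<open>w\<close>; the growth
      factor \<open>2 * rate * \<theta>\<close> of the last step, at least 2, remains and yields the
      half.\<close>
    have P_le: "real (card P) \<le> K * (2 * rate * \<theta>) ^ N * 4 ^ w / 2"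
    proof (cases "0 < w")
      case True
      then obtain w' where w': "w = Suc w'" by (cases w) auto
      have "card P \<le> 4 * card (cell N' ` mostly_deep \<epsilon> J N' w')"
        using card_cell_Suc_le fin md by (simp add: P_def w' Suc)
      then have "real (card P) \<le> 4 * real (card (cell N' ` mostly_deep \<epsilon> J N' w'))" by simp
      also have "\<dots> \<le> 4 * (K * (2 * rate * \<theta>) ^ N' * 4 ^ w')"
        using less.IH[of N' w'] unfolding K_def by (intro mult_left_mono) (auto simp: Suc)
      also have "\<dots> = (K * (2 * rate * \<theta>) ^ N' * 4 ^ w) * 1" by (simp add: w')
      also have "\<dots> \<le> (K * (2 * rate * \<theta>) ^ N' * 4 ^ w) * (rate * \<theta>)"
        using rate(1) \<theta> mult_mono[of 1 rate 1 \<theta>] by (intro mult_left_mono) (auto simp: K_def)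
      finally show ?thesis by (simp add: Suc mult_ac)
    next
      case False
      then show ?thesis using rate(1) \<theta> by (simp add: P_def K_def)
    qed
    have X_le: "real (card (cell N ` X a)) \<le> E * K * 4 ^ w * (2 * rate) ^ N * \<theta> ^ a" if a: "a \<in> A" for a
    proof -
      have aN: "a < N" using a by (simp add: A_def)
      have "card (cell N ` X a) \<le> card (\<Union>i\<in>cell a ` X a. cell N ` {t \<in> X a. cell a t = i})"
      proof (rule card_mono)
        show "finite (\<Union>i\<in>cell a ` X a. cell N ` {t \<in> X a. cell a t = i})"
        proof (intro finite_UN_I fin X_sub(2))
          show "{t \<in> X a. cell a t = i} \<subseteq> J" for i using X_sub(2)[of a] by blast
        qed
      qed blast
      also have "\<dots> \<le> (\<Sum>i\<in>cell a ` X a. card (cell N ` {t \<in> X a. cell a t = i}))"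
        by (rule card_UN_le[OF fin[OF X_sub(2)]])
      finally have "real (card (cell N ` X a)) \<le> (\<Sum>i\<in>cell a ` X a. real (card (cell N ` {t \<in> X a. cell a t = i})))"
        by (simp flip: of_nat_sum)
      also have "\<dots> \<le> (\<Sum>i\<in>cell a ` X a. E * (2 * rate) ^ (N - a))"
        unfolding E_def
        by (intro sum_mono card_cells_excursion(1)[OF good c aN]) (use X_sub(2)[of a] in \<open>auto simp: X_def\<close>)
      also have "\<dots> = real (card (cell a ` X a)) * (E * (2 * rate) ^ (N - a))" by simp
      also have "\<dots> \<le> (K * (2 * rate * \<theta>) ^ a * 4 ^ w) * (E * (2 * rate) ^ (N - a))"
      proof (rule mult_right_mono)
        have "card (cell a ` X a) \<le> card (cell a ` mostly_deep \<epsilon> J a w)"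
          using X_sub(1) fin md by (intro card_mono image_mono) auto
        then show "real (card (cell a ` X a)) \<le> K * (2 * rate * \<theta>) ^ a * 4 ^ w"
          using less.IH[OF aN, of w] unfolding K_def by linarith
        show "0 \<le> E * (2 * rate) ^ (N - a)" using E rate(1) by simp
      qed
      also have "\<dots> = E * K * 4 ^ w * ((2 * rate) ^ a * (2 * rate) ^ (N - a)) * \<theta> ^ a"
        unfolding power_mult_distrib[of "2 * rate" \<theta>] by (simp only: mult_ac)
      also have "(2 * rate) ^ a * (2 * rate) ^ (N - a) = (2 * rate) ^ N"
        unfolding power_add[symmetric] using aN by simp
      finally show ?thesis .
    qed
    have geometric: "E * (\<Sum>a\<in>A. \<theta> ^ a) \<le> \<theta> ^ N / 2"
    proof (cases "w0 \<le> N")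
      case True
      have "(\<Sum>a\<in>A. \<theta> ^ a) \<le> (\<Sum>a<Suc (N - w0). \<theta> ^ a)"
        using True \<theta> by (intro sum_mono2) (auto simp: A_def)
      also have "\<dots> = (\<theta> ^ Suc (N - w0) - 1) / (\<theta> - 1)" using \<theta> by (subst geometric_sum) auto
      also have "\<dots> \<le> \<theta> ^ Suc (N - w0) / (\<theta> - 1)" using \<theta> by (intro divide_right_mono) auto
      finally have "E * (\<Sum>a\<in>A. \<theta> ^ a) \<le> E * (\<theta> ^ Suc (N - w0) / (\<theta> - 1))"
        using E by (intro mult_left_mono) auto
      also have "\<dots> = (E * \<theta> / (\<theta> - 1)) * \<theta> ^ (N - w0)" by simp
      also have "\<dots> \<le> (\<theta> ^ w0 / 2) * \<theta> ^ (N - w0)"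
        using w0(2) \<theta> unfolding E_def by (intro mult_right_mono) auto
      also have "\<dots> = \<theta> ^ N / 2" using True by (simp flip: power_add)
      finally show ?thesis .
    next
      case False
      then have "A = {}" by (auto simp: A_def)
      then show ?thesis using \<theta> by simp
    qed
    have "card (cell N ` mostly_deep \<epsilon> J N w) \<le> card (P \<union> (\<Union>a\<in>A. cell N ` X a))"
      using sub finP finA fin X_sub by (intro card_mono) auto
    also have "\<dots> \<le> card P + card (\<Union>a\<in>A. cell N ` X a)" by (rule card_Un_le)
    also have "\<dots> \<le> card P + (\<Sum>a\<in>A. card (cell N ` X a))" using card_UN_le[OF finA] by (intro add_left_mono)
    finally have "real (card (cell N ` mostly_deep \<epsilon> J N w)) \<le> real (card P) + (\<Sum>a\<in>A. real (card (cell N ` X a)))"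
      by (simp flip: of_nat_sum of_nat_add)
    also have "\<dots> \<le> K * (2 * rate * \<theta>) ^ N * 4 ^ w / 2 + (\<Sum>a\<in>A. E * K * 4 ^ w * (2 * rate) ^ N * \<theta> ^ a)"
      using P_le X_le by (intro add_mono sum_mono) auto
    also have "(\<Sum>a\<in>A. E * K * 4 ^ w * (2 * rate) ^ N * \<theta> ^ a) = K * 4 ^ w * (2 * rate) ^ N * (E * (\<Sum>a\<in>A. \<theta> ^ a))"
      by (simp add: sum_distrib_left mult_ac)
    also have "\<dots> \<le> K * 4 ^ w * (2 * rate) ^ N * (\<theta> ^ N / 2)"
      using geometric rate(1) by (intro mult_left_mono) (auto simp: K_def)
    also have "\<dots> = K * (2 * rate * \<theta>) ^ N * 4 ^ w / 2"
      unfolding power_mult_distrib[of "2 * rate" \<theta>] by simp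
    finally show ?thesis by (simp add: K_def mult_ac)
  qed
qed

section \<open>The dimension bound\<close>

definition eventually_deep :: "real \<Rightarrow> real \<Rightarrow> real set \<Rightarrow> nat \<Rightarrow> real set" where
  "eventually_deep \<epsilon> \<delta> J N0 = {t \<in> J. \<forall>N\<ge>N0. t \<in> mostly_deep \<epsilon> J N (nat \<lfloor>\<delta> * real N\<rfloor>)}"

lemma eventually_deep_null:
  assumes good: "good C J" and J: "J \<subseteq> {l..u}" and s: "1 / 2 + 1 / 2 * (real n / real m) < s"
  shows "\<exists>\<epsilon>>0. \<exists>\<delta>>0. \<forall>N0. hausdorff_measure s (eventually_deep \<epsilon> \<delta> J N0) = 0"
proof -
  have C: "1 \<le> C" using good by (rule good_ge_1)
  define g where "g = 4 powr s / (2 * rate)"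
  have "2 * rate = 2 powr (1 + real n / real m)" by (simp add: rate_def powr_add)
  also have "\<dots> < 2 powr (2 * s)" using s by (intro powr_less_mono) auto
  also have "\<dots> = (2 powr 2) powr s" by (simp only: powr_powr)
  finally have "2 * rate < 4 powr s" by simp
  then have g1: "1 < g" using rate(1) by (simp add: g_def)
  \<comment> \<open>The surplus \<open>g\<close> of \<open>4 powr s\<close> over
    \<open>2 * rate\<close>, which exceeds 1 by the choice of \<open>s\<close>, is split in three:
    slack of the recursion, exceptional times, and decay of the sum over the cover.\<close>
  define \<theta> where "\<theta> = g powr (1 / 3)"
  have \<theta>1: "1 < \<theta>" unfolding \<theta>_def using g1 by (intro gr_one_powr) auto
  have "\<theta> powr real 3 = g" using g1 unfolding \<theta>_def by (simp add: powr_powr)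
  then have \<theta>3: "\<theta> ^ 3 = g" using \<theta>1 powr_realpow[of \<theta> 3] by simp
  \<comment> \<open>With a proportion \<delta> of exceptional times the factor \<open>4 ^ w\<close>
    is at most \<open>\<theta> ^ N\<close>.\<close>
  define \<delta> where "\<delta> = log 4 \<theta>"
  have \<delta>: "0 < \<delta>" "4 powr \<delta> = \<theta>" using \<theta>1 by (simp_all add: \<delta>_def)
  define E where "E = real (card M) * (4 * C + 2)"
  obtain j where j: "2 * (E * \<theta> / (\<theta> - 1)) < \<theta> ^ j" using real_arch_pow[OF \<theta>1] by blast
  define w0 where "w0 = Suc j"
  have "\<theta> ^ j \<le> \<theta> ^ w0" using \<theta>1 by (intro power_increasing) (auto simp: w0_def)
  then have "E * \<theta> / (\<theta> - 1) \<le> \<theta> ^ w0 / 2" using j by linarith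
  then have w0: "0 < w0" "real (card M) * (4 * C + 2) * \<theta> / (\<theta> - 1) \<le> \<theta> ^ w0 / 2"
    unfolding E_def by (simp_all add: w0_def)
  define c where "c = (1 / (8 * (1 + C))) ^ dg"
  define \<epsilon> where "\<epsilon> = c / (2 ^ dg) ^ w0"
  have \<epsilon>: "0 < \<epsilon>" using C by (simp add: \<epsilon>_def c_def)
  define K where "K = real (card (cell 0 ` J))"
  have s0: "0 < s"
  proof -
    have "0 \<le> 1 / 2 * (real n / real m)" by simp
    then show ?thesis using s by linarith
  qed
  have "hausdorff_measure s (eventually_deep \<epsilon> \<delta> J N0) = 0" for N0
  proof (rule hausdorff_measure_null_finite_coverI[OF s0, where 'i = int])
    fix \<eta> e :: real assume pos: "\<eta> > 0" "e > 0"
    have "(\<lambda>N. (1 / 4 :: real) ^ N) \<longlonglongrightarrow> 0" by (intro LIMSEQ_power_zero) simp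
    then have "\<forall>\<^sub>F N in sequentially. (1 / 4 :: real) ^ N < \<eta>" using pos by (intro order_tendstoD) auto
    moreover have "(\<lambda>N. K * (1 / \<theta>) ^ N) \<longlonglongrightarrow> K * 0"
      using \<theta>1 by (intro tendsto_intros LIMSEQ_power_zero) simp
    then have "\<forall>\<^sub>F N in sequentially. K * (1 / \<theta>) ^ N < e" using pos by (intro order_tendstoD) auto
    ultimately have "\<forall>\<^sub>F N in sequentially. ((1 / 4 :: real) ^ N < \<eta> \<and> K * (1 / \<theta>) ^ N < e) \<and> N0 \<le> N"
      by (intro eventually_conj eventually_ge_at_top)
    then obtain N where N: "(1 / 4 :: real) ^ N < \<eta>" "K * (1 / \<theta>) ^ N < e" "N0 \<le> N"
      using eventually_happens'[OF sequentially_bot] by blast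
    define w where "w = nat \<lfloor>\<delta> * real N\<rfloor>"
    define X where "X = mostly_deep \<epsilon> J N w"
    define U where "U i = {t \<in> X. cell N t = i}" for i
    have X_sub: "X \<subseteq> {l..u}" using J by (auto simp: X_def mostly_deep_def)
    have near: "dist t t' \<le> (1 / 4) ^ N" if "t \<in> U i" "t' \<in> U i" for t t' i
      using cell_near[of N t t'] that by (simp add: U_def dist_real_def power_one_over)
    have diam: "diameter (U i) \<le> (1 / 4) ^ N" for i
      using near[of _ i] by (intro diameter_le) (auto simp: dist_real_def)
    have bdd: "bounded (U i)" for i
      using X_sub bounded_subset[OF bounded_closed_interval[of l u], of "U i"] by (auto simp: U_def)
    have fin: "finite (cell N ` X)" using X_sub lu by (rule finite_cell_image)
    have "(\<Sum>i\<in>cell N ` X. diameter (U i) powr s) \<le> (\<Sum>i\<in>cell N ` X. ((1 / 4) ^ N) powr s)"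
      using diam bdd s0 by (intro sum_mono powr_mono2) (auto simp: diameter_ge_0)
    also have "\<dots> = real (card (cell N ` X)) * ((1 / 4) ^ N) powr s" by simp
    also have "\<dots> \<le> (K * (2 * rate * \<theta>) ^ N * 4 ^ w) * ((1 / 4) ^ N) powr s"
      unfolding X_def K_def
      by (intro mult_right_mono card_cells_mostly_deep[OF good J c_def \<epsilon>_def \<theta>1 w0]) auto
    also have "\<dots> \<le> (K * (2 * rate * \<theta>) ^ N * \<theta> ^ N) * ((1 / 4) ^ N) powr s"
    proof (intro mult_right_mono mult_left_mono)
      have "real w \<le> \<delta> * real N" using \<delta>(1) by (simp add: w_def)
      then have "4 powr real w \<le> 4 powr (\<delta> * real N)" by (intro powr_mono) auto
      also have "\<dots> = \<theta> powr real N" unfolding powr_powr[symmetric] \<delta>(2) ..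
      finally show "4 ^ w \<le> \<theta> ^ N" using \<theta>1 by (simp add: powr_realpow)
      show "0 \<le> K * (2 * rate * \<theta>) ^ N" using rate(1) \<theta>1 by (simp add: K_def)
    qed simp
    also have "((1 / 4 :: real) ^ N) powr s = (1 / 4 powr s) ^ N"
    proof -
      have "((1 / 4 :: real) ^ N) powr s = ((1 / 4) powr s) powr real N"
        by (simp add: powr_powr powr_realpow[symmetric] mult.commute)
      also have "\<dots> = (1 / 4 powr s) ^ N" by (simp add: powr_realpow powr_divide power_one_over)
      finally show ?thesis .
    qed
    also have "(K * (2 * rate * \<theta>) ^ N * \<theta> ^ N) * (1 / 4 powr s) ^ N = K * (2 * rate * \<theta> * \<theta> * (1 / 4 powr s)) ^ N"
      by (simp only: power_mult_distrib mult_ac)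
    also have "2 * rate * \<theta> * \<theta> * (1 / 4 powr s) = 1 / \<theta>"
    proof -
      have "\<theta> * \<theta> * \<theta> * (2 * rate) = 4 powr s" using \<theta>3 rate(1) by (simp add: g_def power3_eq_cube field_simps)
      then show ?thesis using \<theta>1 by (simp add: field_simps)
    qed
    also have "K * (1 / \<theta>) ^ N < e" by (rule N(2))
    finally have sum: "(\<Sum>i\<in>cell N ` X. diameter (U i) powr s) < e" .
    have "eventually_deep \<epsilon> \<delta> J N0 \<subseteq> (\<Union>i\<in>cell N ` X. U i)"
      using N(3) by (auto simp: eventually_deep_def X_def U_def w_def)
    moreover have "\<forall>i\<in>cell N ` X. bounded (U i) \<and> diameter (U i) \<le> \<eta>"
    proof (intro ballI conjI bdd)
      show "diameter (U i) \<le> \<eta>" for i using diam[of i] N(1) by linarith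
    qed
    ultimately show "\<exists>I. \<exists>U :: int \<Rightarrow> real set. finite I \<and> eventually_deep \<epsilon> \<delta> J N0 \<subseteq> (\<Union>i\<in>I. U i) \<and>
        (\<forall>i\<in>I. bounded (U i) \<and> diameter (U i) \<le> \<eta>) \<and> (\<Sum>i\<in>I. diameter (U i) powr s) < e"
      using sum fin by blast
  qed
  then show ?thesis using \<epsilon> \<delta>(1) by blast
qed

text \<open>Singularity allows denominators as large as \<open>2 ^ k\<close>, which give no small
  height at time \<open>k\<close>. With precision \<open>(1 / 4) ^ j\<close> the height is small
  \<open>j\<close> steps later: both entries of each maximum are then at most
  \<open>(1 / 2) ^ j\<close>.\<close>

lemma singular_eventually_deep:
  assumes sing: "K_singular_on_average \<Sigma> (\<phi> t)" and pos: "0 < \<epsilon>" "0 < \<delta>" and t: "t \<in> J"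
  shows "\<exists>N0. t \<in> eventually_deep \<epsilon> \<delta> J N0"
proof -
  obtain j where j: "(1 / 2 :: real) ^ j < min \<epsilon> 1" using real_arch_pow_inv[of "min \<epsilon> 1" "1 / 2"] pos by auto
  define S where "S N = {k \<in> {1..N}. \<exists>p\<in>ring_of_integers. \<exists>q\<in>ring_of_integers.
      max_norm \<Sigma> (\<lambda>\<sigma>. \<sigma> p + \<phi> t \<sigma> * \<sigma> q) < (1 / 4) ^ j / 2 ^ k \<and>
      0 < max_norm \<Sigma> (\<lambda>\<sigma>. \<sigma> q) \<and> max_norm \<Sigma> (\<lambda>\<sigma>. \<sigma> q) \<le> 2 ^ k}" for N
  have "(\<lambda>N. 1 / real N * real (card (S N))) \<longlonglongrightarrow> 1"
    using sing[unfolded K_singular_on_average_def, rule_format, of "(1 / 4) ^ j"] unfolding S_def by simp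
  then have "\<forall>\<^sub>F N in sequentially. 1 - \<delta> / 2 < 1 / real N * real (card (S N))"
    using pos by (intro order_tendstoD) auto
  moreover have "\<forall>\<^sub>F N in sequentially. 2 * real j / \<delta> \<le> real N"
    using filterlim_real_sequentially by (simp add: filterlim_at_top)
  ultimately have "\<forall>\<^sub>F N in sequentially. (1 - \<delta> / 2 < 1 / real N * real (card (S N)) \<and>
      2 * real j / \<delta> \<le> real N) \<and> 1 \<le> N"
    by (intro eventually_conj eventually_ge_at_top)
  then obtain N0 where N0: "\<And>N. N0 \<le> N \<Longrightarrow> 1 - \<delta> / 2 < 1 / real N * real (card (S N)) \<and>
      2 * real j / \<delta> \<le> real N \<and> 1 \<le> N" unfolding eventually_sequentially by blast
  have deep: "deep \<epsilon> (k + j) t" if "k \<in> S N" for k N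
  proof -
    obtain p q where q: "p \<in> ring_of_integers" "q \<in> ring_of_integers"
      "max_norm \<Sigma> (\<lambda>\<sigma>. \<sigma> p + \<phi> t \<sigma> * \<sigma> q) < (1 / 4) ^ j / 2 ^ k" "0 < Q q" "Q q \<le> 2 ^ k"
      using \<open>k \<in> S N\<close> unfolding S_def Q_def by blast
    have q0: "q \<noteq> 0"
    proof
      assume q: "q = 0"
      have "max_norm \<Sigma> (\<lambda>\<sigma>. \<sigma> q) \<le> 0" unfolding max_norm_def
      proof (subst Max_le_iff)
        show "\<forall>a\<in>(\<lambda>\<sigma>. cmod (\<sigma> q)) ` \<Sigma>. a \<le> 0"
        proof clarify
          fix \<sigma> assume "\<sigma> \<in> \<Sigma>"
          then interpret field_char_0_hom \<sigma> using emb embedding_field_hom by blast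
          show "cmod (\<sigma> q) \<le> 0" by (simp add: q)
        qed
      qed (use fin\<Sigma> \<Sigma>_nonempty in auto)
      then show False using \<open>0 < Q q\<close> by (simp add: Q_def)
    qed
    have "ht (k + j) p q t \<le> ((1 / 2) ^ j) ^ dg * (\<Prod>\<sigma>\<in>\<Sigma>. 1 ^ wt \<sigma>)"
      unfolding ht_def
    proof (rule prod_wt_scaled_le)
      fix \<sigma> assume \<sigma>: "\<sigma> \<in> \<Sigma>"
      have four: "(1 / 4 :: real) ^ j * 2 ^ j = (1 / 2) ^ j" by (simp flip: power_mult_distrib)
      have "lin p q t \<sigma> \<le> (1 / 4) ^ j / 2 ^ k" using q(3) max_lin_ge[OF \<sigma>, of p q t] by linarith
      then have "2 ^ (k + j) * lin p q t \<sigma> \<le> 2 ^ (k + j) * ((1 / 4) ^ j / 2 ^ k)" by (intro mult_left_mono) auto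
      also have "\<dots> = (1 / 4) ^ j * 2 ^ j" by (simp add: power_add)
      finally have 1: "2 ^ (k + j) * lin p q t \<sigma> \<le> (1 / 2) ^ j" unfolding four .
      have "cmod (\<sigma> q) / 2 ^ (k + j) \<le> 2 ^ k / 2 ^ (k + j)"
        using cmod_le_Q[OF \<sigma>, of q] q(5) by (intro divide_right_mono) auto
      also have "\<dots> = (1 / 2) ^ j" by (simp add: power_add power_one_over)
      finally have 2: "cmod (\<sigma> q) / 2 ^ (k + j) \<le> (1 / 2) ^ j" .
      show "0 \<le> max (2 ^ (k + j) * lin p q t \<sigma>) (cmod (\<sigma> q) / 2 ^ (k + j)) \<and>
          max (2 ^ (k + j) * lin p q t \<sigma>) (cmod (\<sigma> q) / 2 ^ (k + j)) \<le> (1 / 2) ^ j * 1"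
        using 1 2 by (simp add: le_max_iff_disj)
    qed
    also have "\<dots> = ((1 / 2) ^ j) ^ dg" by simp
    also have "\<dots> \<le> ((1 / 2) ^ j) ^ 1"
      using dg(2) by (intro power_decreasing) (auto intro: power_le_one)
    also have "\<dots> < \<epsilon>" using j by simp
    finally show ?thesis unfolding deep_def using q q0 by blast
  qed
  have "card {k \<in> {1..N}. \<not> deep \<epsilon> k t} \<le> nat \<lfloor>\<delta> * real N\<rfloor>" if N: "N0 \<le> N" for N
  proof -
    have N1: "1 - \<delta> / 2 < 1 / real N * real (card (S N))" "2 * real j / \<delta> \<le> real N" "1 \<le> N"
      using N0[OF N] by auto
    have S_sub: "S N \<subseteq> {1..N}" by (auto simp: S_def)
    \<comment> \<open>The first \<open>j\<close> times are lost to the shift. By the choice of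
      \<open>N0\<close> they make up at most half of the permitted \<open>\<delta> * real N\<close>
      exceptions, and the times outside \<open>S N\<close> stay within the other half.\<close>
    have "{k \<in> {1..N}. \<not> deep \<epsilon> k t} \<subseteq> {1..j} \<union> (\<lambda>k. k + j) ` ({1..N} - S N)"
    proof
      fix k assume k: "k \<in> {k \<in> {1..N}. \<not> deep \<epsilon> k t}"
      show "k \<in> {1..j} \<union> (\<lambda>k. k + j) ` ({1..N} - S N)"
      proof (cases "k \<le> j")
        case False
        then have "k - j \<notin> S N" using deep[of "k - j" N] k by auto
        then have "k - j \<in> {1..N} - S N" "k = (k - j) + j" using k False by auto
        then show ?thesis by blast
      qed (use k in auto)
    qed
    then have "card {k \<in> {1..N}. \<not> deep \<epsilon> k t} \<le> card ({1..j} \<union> (\<lambda>k. k + j) ` ({1..N} - S N))"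
      by (intro card_mono) auto
    also have "\<dots> \<le> card {1..j} + card ((\<lambda>k. k + j) ` ({1..N} - S N))" by (rule card_Un_le)
    also have "\<dots> \<le> j + (N - card (S N))"
      using card_image_le[of "{1..N} - S N" "\<lambda>k. k + j"] card_Diff_subset[of "S N" "{1..N}"] S_sub
        finite_subset[OF S_sub] by simp
    finally have "real (card {k \<in> {1..N}. \<not> deep \<epsilon> k t}) \<le> real j + (real N - real (card (S N)))"
      using card_mono[OF _ S_sub] by simp
    also have "\<dots> \<le> \<delta> * real N"
    proof -
      have "(1 - \<delta> / 2) * real N < real (card (S N))" using N1(1,3) by (simp add: field_simps)
      moreover have "2 * real j \<le> \<delta> * real N" using N1(2) pos by (simp add: field_simps)
      ultimately show ?thesis by (simp add: algebra_simps)
    qed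
    finally show ?thesis by (simp add: le_nat_floor)
  qed
  then show ?thesis using t by (auto simp: eventually_deep_def mostly_deep_def)
qed

theorem singular_hausdorff_dim_le:
  "hausdorff_dim {t \<in> {l..u}. K_singular_on_average \<Sigma> (\<phi> t)} \<le> ereal (1 / 2 + 1 / 2 * (real n / real m))"
proof (rule hausdorff_dim_leI)
  fix s assume s: "1 / 2 + 1 / 2 * (real n / real m) < s"
  have "0 \<le> 1 / 2 * (real n / real m)" by simp
  then have s0: "0 < s" using s by linarith
  obtain J :: "nat \<Rightarrow> real set" where J: "\<forall>i. good_piece (J i)" "\<forall>i. J i \<subseteq> {l..u}" "{l..u} - Z \<subseteq> (\<Union>i. J i)"
    using good_pieces_cover by (elim exE conjE) (rule that)
  have "\<forall>i. \<exists>\<epsilon> \<delta>. 0 < \<epsilon> \<and> 0 < \<delta> \<and> (\<forall>N0. hausdorff_measure s (eventually_deep \<epsilon> \<delta> (J i) N0) = 0)"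
    using eventually_deep_null[OF bilipschitz_const[OF J(1)[rule_format]] J(2)[rule_format] s] by blast
  then obtain \<epsilon> \<delta> where ed: "\<And>i. 0 < \<epsilon> i" "\<And>i. 0 < \<delta> i"
    "\<And>i N0. hausdorff_measure s (eventually_deep (\<epsilon> i) (\<delta> i) (J i) N0) = 0" by metis
  have "hausdorff_measure s (\<Union>i. \<Union>N0. eventually_deep (\<epsilon> i) (\<delta> i) (J i) N0) = 0"
    by (intro hausdorff_measure_null_UN ed(3))
  moreover have "hausdorff_measure s Z = 0"
  proof (rule hausdorff_measure_null_finite_coverI[OF s0, where 'i = real])
    fix \<eta> e :: real assume "\<eta> > 0" "e > 0"
    then show "\<exists>I. \<exists>U :: real \<Rightarrow> real set. finite I \<and> Z \<subseteq> (\<Union>i\<in>I. U i) \<and>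
        (\<forall>i\<in>I. bounded (U i) \<and> diameter (U i) \<le> \<eta>) \<and> (\<Sum>i\<in>I. diameter (U i) powr s) < e"
      using finZ by (intro exI[of _ Z] exI[of _ "\<lambda>i. {i}"]) auto
  qed
  \<comment> \<open>The union with \<open>Z\<close> is written as a sequence, constant from index 1
    on, to fit the countable union.\<close>
  ultimately have "hausdorff_measure s (\<Union>b :: nat. if b = 0 then Z else \<Union>i. \<Union>N0. eventually_deep (\<epsilon> i) (\<delta> i) (J i) N0) = 0"
    by (intro hausdorff_measure_null_UN) simp
  then show "hausdorff_measure s {t \<in> {l..u}. K_singular_on_average \<Sigma> (\<phi> t)} = 0"
  proof (rule hausdorff_measure_null_subset)
    show "{t \<in> {l..u}. K_singular_on_average \<Sigma> (\<phi> t)}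
        \<subseteq> (\<Union>b :: nat. if b = 0 then Z else \<Union>i. \<Union>N0. eventually_deep (\<epsilon> i) (\<delta> i) (J i) N0)"
    proof
      fix t assume t: "t \<in> {t \<in> {l..u}. K_singular_on_average \<Sigma> (\<phi> t)}"
      show "t \<in> (\<Union>b :: nat. if b = 0 then Z else \<Union>i. \<Union>N0. eventually_deep (\<epsilon> i) (\<delta> i) (J i) N0)"
      proof (cases "t \<in> Z")
        case True
        then show ?thesis by (intro UN_I[of 0]) auto
      next
        case False
        then obtain i where "t \<in> J i" using t J(3) by blast
        then obtain N0 where "t \<in> eventually_deep (\<epsilon> i) (\<delta> i) (J i) N0"
          using singular_eventually_deep[OF _ ed(1,2)] t by blast
        then show ?thesis by (intro UN_I[of 1]) auto
      qed
    qed
  qed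
qed simp

end

section \<open>Smooth curves\<close>

text \<open>Subtracting the linear map with slope \<open>f' x\<close> leaves a function whose
  derivative near \<open>x\<close> is at most half of \<open>cmod (f' x)\<close>. The mean value
  inequality for it gives both bounds, and works for values in the plane, where a derivative has no
  sign.\<close>

lemma C1_bilipschitz_near:
  fixes f :: "real \<Rightarrow> complex"
  assumes B: "B = {l..u}" and x: "x \<in> B"
    and deriv: "\<And>t. t \<in> B \<Longrightarrow> (f has_vector_derivative f' t) (at t within B)"
    and cont: "continuous_on B f'" and nz: "f' x \<noteq> 0"
  shows "\<exists>\<delta>>0. \<exists>C. \<forall>t\<in>{x - \<delta>..x + \<delta>} \<inter> B. \<forall>t'\<in>{x - \<delta>..x + \<delta>} \<inter> B.
    cmod (f t - f t') \<le> C * \<bar>t - t'\<bar> \<and> \<bar>t - t'\<bar> \<le> C * cmod (f t - f t')"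
proof -
  define e where "e = cmod (f' x) / 2"
  have e: "e > 0" using nz by (simp add: e_def)
  obtain d where d: "d > 0" "\<And>t. t \<in> B \<Longrightarrow> dist t x < d \<Longrightarrow> dist (f' t) (f' x) < e"
    using cont x e unfolding continuous_on_iff by blast
  define \<delta> where "\<delta> = d / 2"
  define J where "J = {x - \<delta>..x + \<delta>} \<inter> B"
  have \<delta>: "\<delta> > 0" using d(1) by (simp add: \<delta>_def)
  have near: "cmod (f' t - f' x) \<le> e" if "t \<in> J" for t
  proof -
    have "dist t x < d" using that d(1) by (auto simp: J_def \<delta>_def dist_real_def)
    then show ?thesis using d(2)[of t] that by (simp add: J_def dist_norm)
  qed
  have main: "cmod ((f t - f t') - (t - t') *\<^sub>R f' x) \<le> e * \<bar>t - t'\<bar>" if "t \<in> J" "t' \<in> J" for t t'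
  proof -
    define h where "h t = f t - t *\<^sub>R f' x" for t
    have "norm (h t - h t') \<le> e * norm (t - t')"
    proof (rule differentiable_bound[of J])
      show "convex J" unfolding J_def B by (intro convex_Int convex_real_interval)
      fix s assume s: "s \<in> J"
      have "(f has_vector_derivative f' s) (at s within J)"
        using deriv[of s] s by (rule_tac has_vector_derivative_within_subset) (auto simp: J_def)
      then have "(h has_vector_derivative (f' s - f' x)) (at s within J)"
        unfolding h_def by (auto intro!: derivative_eq_intros)
      then show "(h has_derivative (\<lambda>y. y *\<^sub>R (f' s - f' x))) (at s within J)"
        by (simp add: has_vector_derivative_def)
      show "onorm (\<lambda>y. y *\<^sub>R (f' s - f' x)) \<le> e"
        using mult_right_mono[OF near[OF s], of "\<bar>_\<bar>"] by (intro onorm_le) (simp add: mult.commute)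
    qed (use that in auto)
    then show ?thesis by (simp add: h_def algebra_simps)
  qed
  define C where "C = max (cmod (f' x) + e) (1 / e)"
  have "cmod (f t - f t') \<le> C * \<bar>t - t'\<bar> \<and> \<bar>t - t'\<bar> \<le> C * cmod (f t - f t')" if "t \<in> J" "t' \<in> J" for t t'
  proof
    let ?y = "(f t - f t') - (t - t') *\<^sub>R f' x"
    have n: "cmod ((t - t') *\<^sub>R f' x) = 2 * e * \<bar>t - t'\<bar>" by (simp add: e_def)
    have "cmod (f t - f t') \<le> cmod ?y + cmod ((t - t') *\<^sub>R f' x)"
      using norm_triangle_ineq[of ?y "(t - t') *\<^sub>R f' x"] by simp
    also have "\<dots> \<le> e * \<bar>t - t'\<bar> + cmod (f' x) * \<bar>t - t'\<bar>"
      using main[OF that] by (simp add: mult.commute)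
    also have "\<dots> = (cmod (f' x) + e) * \<bar>t - t'\<bar>" by (simp add: algebra_simps)
    also have "\<dots> \<le> C * \<bar>t - t'\<bar>" by (intro mult_right_mono) (auto simp: C_def)
    finally show "cmod (f t - f t') \<le> C * \<bar>t - t'\<bar>" .
    have "2 * e * \<bar>t - t'\<bar> \<le> cmod (f t - f t') + cmod ?y"
      unfolding n[symmetric] using norm_triangle_ineq4[of "f t - f t'" ?y] by simp
    then have "e * \<bar>t - t'\<bar> \<le> cmod (f t - f t')" using main[OF that] by linarith
    then have "\<bar>t - t'\<bar> \<le> 1 / e * cmod (f t - f t')" using e by (simp add: field_simps)
    also have "\<dots> \<le> C * cmod (f t - f t')" by (intro mult_right_mono) (auto simp: C_def)
    finally show "\<bar>t - t'\<bar> \<le> C * cmod (f t - f t')" .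
  qed
  then show ?thesis using \<delta> unfolding J_def by blast
qed

theorem corollary3p2:
  fixes \<Sigma> :: "('k::field_char_0 \<Rightarrow> complex) set"
    and r s :: nat
    and l u \<epsilon> :: real
    and B :: "real set"
    and \<phi> :: "real \<Rightarrow> ('k \<Rightarrow> complex) \<Rightarrow> complex"
  assumes K: "number_field TYPE('k)"
    and r: "card {\<sigma> :: 'k \<Rightarrow> complex. real_embedding \<sigma>} = r"
    and s: "card {\<sigma> :: 'k \<Rightarrow> complex. complex_embedding \<sigma>} = 2 * s"
    and \<Sigma>: "embedding_representatives \<Sigma>"
    and B: "l < u" "B = {l..u}"
    and \<phi>_space: "\<forall>t\<in>B. \<phi> t \<in> K_space \<Sigma>"
    and \<phi>_smooth: "\<epsilon> > 0" "\<forall>\<sigma>\<in>\<Sigma>. C1_Holder_on \<epsilon> B (\<lambda>t. \<phi> t \<sigma>)"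
    and \<phi>_zeros: "\<forall>\<sigma>\<in>\<Sigma>. stationary_on B (\<lambda>t. \<phi> t \<sigma>) \<or>
                    finite {t\<in>B. deriv_on B (\<lambda>t. \<phi> t \<sigma>) t = 0}"
    and moving: "real (weighted_card {\<sigma>\<in>\<Sigma>. \<not> stationary_on B (\<lambda>t. \<phi> t \<sigma>)}) > (real r + 2 * real s) / 2"
  shows "hausdorff_dim {t\<in>B. K_singular_on_average \<Sigma> (\<phi> t)}
           \<le> ereal (1 / 2 + 1 / 2 *
               (real (weighted_card {\<sigma>\<in>\<Sigma>. stationary_on B (\<lambda>t. \<phi> t \<sigma>)}) /
                real (weighted_card {\<sigma>\<in>\<Sigma>. \<not> stationary_on B (\<lambda>t. \<phi> t \<sigma>)})))
       \<and> (\<forall>\<kappa>>0. winning \<kappa> B {t\<in>B. K_badly_approximable \<Sigma> (\<phi> t)})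
       \<and> thick_in B {t\<in>B. K_badly_approximable \<Sigma> (\<phi> t)}
       \<and> {t\<in>B. K_very_well_approximable \<Sigma> (\<phi> t)} \<in> null_sets lebesgue"
proof -
  define M where "M = {\<sigma>\<in>\<Sigma>. \<not> stationary_on B (\<lambda>t. \<phi> t \<sigma>)}"
  \<comment> \<open>Away from these points every moving coordinate has nonzero derivative, so
    \<open>C1_bilipschitz_near\<close> applies to all of them at once.\<close>
  define Z where "Z = (\<Union>\<sigma>\<in>M. {t\<in>B. deriv_on B (\<lambda>t. \<phi> t \<sigma>) t = 0})"
  have emb: "embedding \<sigma>" if "\<sigma> \<in> \<Sigma>" for \<sigma> using \<Sigma> that by (auto simp: embedding_representatives_def)
  have fin\<Sigma>: "finite \<Sigma>" by (rule finite_representatives[OF K \<Sigma>])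
  have M\<Sigma>: "M \<subseteq> \<Sigma>" by (auto simp: M_def)
  have finM: "finite M" using fin\<Sigma> M\<Sigma> by (rule rev_finite_subset)
  have stat: "\<Sigma> - M = {\<sigma>\<in>\<Sigma>. stationary_on B (\<lambda>t. \<phi> t \<sigma>)}" by (auto simp: M_def)
  have wM: "weighted_card M = (\<Sum>\<sigma>\<in>M. wt \<sigma>)"
    using finM emb M\<Sigma> by (intro weighted_card_eq_sum) auto
  have wN: "weighted_card (\<Sigma> - M) = (\<Sum>\<sigma>\<in>\<Sigma> - M. wt \<sigma>)"
    using fin\<Sigma> emb by (intro weighted_card_eq_sum) auto
  have "(\<Sum>\<sigma>\<in>\<Sigma> - M. wt \<sigma>) + (\<Sum>\<sigma>\<in>M. wt \<sigma>) = r + 2 * s"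
    using sum_wt_eq_degree[OF K \<Sigma> r s] sum.subset_diff[OF M\<Sigma> fin\<Sigma>, of wt] by simp
  moreover have "(real r + 2 * real s) / 2 < real (\<Sum>\<sigma>\<in>M. wt \<sigma>)"
    using moving unfolding M_def[symmetric] wM .
  \<comment> \<open>More than half of the total degree is the same as outweighing the rest.\<close>
  moreover have "a < b" if "a + b = r + 2 * s" "(real r + 2 * real s) / 2 < real b" for a b
  proof -
    have "real (r + 2 * s) < real (2 * b)" using that(2) by simp
    then have "r + 2 * s < 2 * b" by (simp only: of_nat_less_iff)
    then show ?thesis using that(1) by linarith
  qed
  ultimately have weights: "(\<Sum>\<sigma>\<in>\<Sigma> - M. wt \<sigma>) < (\<Sum>\<sigma>\<in>M. wt \<sigma>)" by blast
  interpret curve: diophantine_curve \<Sigma> M \<phi>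
    by unfold_locales (use fin\<Sigma> M\<Sigma> emb prod_representatives_ge_1[OF K \<Sigma>] weights in auto)
  have deriv: "((\<lambda>t. \<phi> t \<sigma>) has_vector_derivative deriv_on B (\<lambda>t. \<phi> t \<sigma>) t) (at t within B)"
    if "\<sigma> \<in> \<Sigma>" "t \<in> B" for \<sigma> t
    using \<phi>_smooth(2) that unfolding C1_Holder_on_def by (auto simp: vector_derivative_works[symmetric])
  have const: "\<phi> t \<sigma> = \<phi> t' \<sigma>" if "\<sigma> \<in> \<Sigma> - M" "t \<in> B" "t' \<in> B" for \<sigma> t t'
  proof -
    have "((\<lambda>t. \<phi> t \<sigma>) has_vector_derivative 0) (at t within B)" if t: "t \<in> B" for t
      using deriv[of \<sigma> t] \<open>\<sigma> \<in> \<Sigma> - M\<close> t by (simp add: stat stationary_on_def)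
    then obtain c where "\<And>t. t \<in> B \<Longrightarrow> \<phi> t \<sigma> = c"
      using has_vector_derivative_zero_constant[of B "\<lambda>t. \<phi> t \<sigma>"] convex_real_interval(5)[of l u]
      unfolding B(2) by blast
    then show ?thesis using that(2,3) by simp
  qed
  interpret curve: diophantine_curve_on \<Sigma> M \<phi> l u Z
  proof unfold_locales
    show "l < u" by (rule B(1))
    have "finite {t\<in>B. deriv_on B (\<lambda>t. \<phi> t \<sigma>) t = 0}" if "\<sigma> \<in> M" for \<sigma>
      using bspec[OF \<phi>_zeros, of \<sigma>] that by (simp add: M_def)
    then show "finite Z" unfolding Z_def using finM by blast
    fix x assume x: "x \<in> {l..u} - Z"
    define P where "P \<sigma> \<delta> C \<longleftrightarrow> (\<forall>t\<in>{x - \<delta>..x + \<delta>} \<inter> B. \<forall>t'\<in>{x - \<delta>..x + \<delta>} \<inter> B.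
      cmod (\<phi> t \<sigma> - \<phi> t' \<sigma>) \<le> C * \<bar>t - t'\<bar> \<and> \<bar>t - t'\<bar> \<le> C * cmod (\<phi> t \<sigma> - \<phi> t' \<sigma>))" for \<sigma> \<delta> C
    have "\<exists>\<delta>>0. \<exists>C. P \<sigma> \<delta> C" if \<sigma>: "\<sigma> \<in> M" for \<sigma>
    proof -
      have \<sigma>': "\<sigma> \<in> \<Sigma>" using \<sigma> M\<Sigma> by blast
      have cont: "continuous_on B (deriv_on B (\<lambda>t. \<phi> t \<sigma>))"
        using bspec[OF \<phi>_smooth(2) \<sigma>'] unfolding C1_Holder_on_def by (elim conjE)
      have xB: "x \<in> B" using x by (simp add: B(2))
      then have nz: "deriv_on B (\<lambda>t. \<phi> t \<sigma>) x \<noteq> 0" using x \<sigma> unfolding Z_def by blast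
      show ?thesis unfolding P_def by (rule C1_bilipschitz_near[OF B(2) xB deriv[OF \<sigma>'] cont nz])
    qed
    then obtain d c where dc: "\<And>\<sigma>. \<sigma> \<in> M \<Longrightarrow> 0 < d \<sigma>" "\<And>\<sigma>. \<sigma> \<in> M \<Longrightarrow> P \<sigma> (d \<sigma>) (c \<sigma>)" by metis
    define \<delta> where "\<delta> = Min (d ` M)"
    define C where "C = Max (insert 1 (c ` M))"
    have \<delta>: "\<delta> > 0" unfolding \<delta>_def using finM curve.M_nonempty dc(1) by (subst Min_gr_iff) auto
    have d_ge: "\<delta> \<le> d \<sigma>" if "\<sigma> \<in> M" for \<sigma> unfolding \<delta>_def using finM that by (intro Min_le) auto
    have c_le: "c \<sigma> \<le> C" if "\<sigma> \<in> M" for \<sigma> unfolding C_def using finM that by (intro Max_ge) auto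
    have "curve.good C ({x - \<delta>..x + \<delta>} \<inter> {l..u})"
      unfolding curve.good_def
    proof (intro conjI ballI)
      show "1 \<le> C" unfolding C_def using finM by (intro Max_ge) auto
      show "\<phi> t \<sigma> = \<phi> t' \<sigma>" if "\<sigma> \<in> \<Sigma> - M" "t \<in> {x - \<delta>..x + \<delta>} \<inter> {l..u}" "t' \<in> {x - \<delta>..x + \<delta>} \<inter> {l..u}" for \<sigma> t t'
        using const[OF that(1)] that(2,3) by (auto simp: B(2))
      fix \<sigma> t t' assume *: "\<sigma> \<in> M" "t \<in> {x - \<delta>..x + \<delta>} \<inter> {l..u}" "t' \<in> {x - \<delta>..x + \<delta>} \<inter> {l..u}"
      have t: "t \<in> {x - d \<sigma>..x + d \<sigma>} \<inter> B" "t' \<in> {x - d \<sigma>..x + d \<sigma>} \<inter> B"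
        using * d_ge[OF *(1)] by (auto simp: B(2))
      note dc = dc(2)[OF *(1), unfolded P_def, rule_format, OF t]
      have "c \<sigma> * \<bar>t - t'\<bar> \<le> C * \<bar>t - t'\<bar>" "c \<sigma> * cmod (\<phi> t \<sigma> - \<phi> t' \<sigma>) \<le> C * cmod (\<phi> t \<sigma> - \<phi> t' \<sigma>)"
        using c_le[OF *(1)] by (auto intro: mult_right_mono)
      then show "cmod (\<phi> t \<sigma> - \<phi> t' \<sigma>) \<le> C * \<bar>t - t'\<bar>" "\<bar>t - t'\<bar> \<le> C * cmod (\<phi> t \<sigma> - \<phi> t' \<sigma>)"
        using dc by linarith+
    qed
    then show "\<exists>\<delta>>0. \<exists>C. curve.good C ({x - \<delta>..x + \<delta>} \<inter> {l..u})" using \<delta> by blast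
  qed
  have "real (weighted_card {\<sigma>\<in>\<Sigma>. stationary_on B (\<lambda>t. \<phi> t \<sigma>)}) /
      real (weighted_card {\<sigma>\<in>\<Sigma>. \<not> stationary_on B (\<lambda>t. \<phi> t \<sigma>)}) = real curve.n / real curve.m"
    unfolding curve.n_def curve.m_def stat[symmetric] M_def[symmetric] wM wN ..
  then have "hausdorff_dim {t\<in>B. K_singular_on_average \<Sigma> (\<phi> t)}
           \<le> ereal (1 / 2 + 1 / 2 *
               (real (weighted_card {\<sigma>\<in>\<Sigma>. stationary_on B (\<lambda>t. \<phi> t \<sigma>)}) /
                real (weighted_card {\<sigma>\<in>\<Sigma>. \<not> stationary_on B (\<lambda>t. \<phi> t \<sigma>)})))"
    using curve.singular_hausdorff_dim_le unfolding B(2) by simp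
  moreover have win: "\<forall>\<kappa>>0. winning \<kappa> B {t\<in>B. K_badly_approximable \<Sigma> (\<phi> t)}"
    using curve.winning_badly_approximable unfolding B(2) by blast
  moreover have "thick_in B {t\<in>B. K_badly_approximable \<Sigma> (\<phi> t)}"
    \<comment> \<open>Thickness is derived from the game with \<kappa> = 1.\<close>
    unfolding B(2) by (rule winning_thick[OF _ B(1)]) (use win B(2) in auto)
  moreover have "{t\<in>B. K_very_well_approximable \<Sigma> (\<phi> t)} \<in> null_sets lebesgue"
    using curve.very_well_approximable_null unfolding B(2) .
  ultimately show ?thesis by blast
qed

end
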